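(* Let $G$ be a discrete group equipped with a $\mathbb{T}$-valued 2-cocycle $\sigma$. Let $\phi\colon G\to\mathbb{C}$ be a complex-valued function. The following assertions are equivalent. 1. The function $\phi$ induces a selfadjoint contractively decomposable Fourier multiplier $M_\phi\colon\mathrm{VN}(G,\sigma)\to\mathrm{VN}(G,\sigma)$ on the twisted group von Neumann algebra $\mathrm{VN}(G,\sigma)$. 2. The function $\phi$ induces a Fourier multiplier $M_\phi\colon\mathrm{VN}(G,\sigma)\to\mathrm{VN}(G,\sigma)$ with property $(\mathcal{P})$. 3. There exist some real-valued functions $\varphi_1,\varphi_2\colon G\to\mathbb{R}$ such that $$\begin{bmatrix} M_{\varphi_1}&M_\phi\\ M_\phi^\circ&M_{\varphi_2}\end{bmatrix}\colon M_2(\mathrm{VN}(G,\sigma))\to M_2(\mathrm{VN}(G,\sigma))$$ is unital, completely positive, weak* continuous and selfadjoint.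
   Context: 2-cocycles are normalized: $\sigma\colon G\times G\to\mathbb{T}$ with $\sigma(s,t)\sigma(st,r)=\sigma(t,r)\sigma(s,tr)$ and $\sigma(s,e)=\sigma(e,s)=1$. On $\ell^2_G$ with canonical basis $(\varepsilon_t)$ let $\lambda_{\sigma,s}\varepsilon_t=\sigma(s,t)\varepsilon_{st}$; $\mathrm{VN}(G,\sigma)$ is the von Neumann algebra generated by the $\lambda_{\sigma,s}$, with trace $\tau_{G,\sigma}(x)=\langle\varepsilon_e,x\varepsilon_e\rangle$. $\phi$ induces a Fourier multiplier $M_\phi$ on $\mathrm{VN}(G,\sigma)$ if there is a normal bounded operator $M_\phi$ with $M_\phi(\lambda_{\sigma,s})=\phi(s)\lambda_{\sigma,s}$ for all $s\in G$. Put $T^\circ(x)=T(x^* )^*$. $2\times2$ matrices of maps act entrywise: $\begin{bmatrix} v_1&T\\ S&v_2\end{bmatrix}\begin{bmatrix} a&b\\ c&d\end{bmatrix}=\begin{bmatrix} v_1(a)&T(b)\\ S(c)&v_2(d)\end{bmatrix}$. For a von Neumann algebra $M$, a linear map $T\colon M\to M$ is contractively decomposable if it is decomposable, i.e. there are linear maps $v_1,v_2\colon M\to M$ with $\begin{bmatrix} v_1&T\\ T^\circ&v_2\end{bmatrix}\colon M_2(M)\to M_2(M)$ completely positive, and $\|T\|_{\mathrm{dec}}=\inf\max\{\|v_1\|,\|v_2\|\}\le1$. If $M$ has a normal semifinite faithful trace $\tau$, a normal contraction $T\colon M\to M$ is selfadjoint if $\tau(T(x)y^* )=\tau(xT(y)^*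 )$ for all $x,y\in M\cap L^1(M)$ ($M_2(M)$ carries the trace $\mathrm{Tr}\otimes\tau$). A weak* continuous operator $T\colon M\to M$ satisfies $(\mathcal{P})$ if there exist linear maps $v_1,v_2\colon M\to M$ such that $\begin{bmatrix} v_1&T\\ T^\circ&v_2\end{bmatrix}\colon M_2(M)\to M_2(M)$ is completely positive, completely contractive, weak* continuous and selfadjoint. *)

theory Defs
  imports "HOL-Analysis.Analysis"
begin

section \<open>Complex Hilbert spaces\<close>

text \<open>A complex Hilbert space is a complete real inner product space with a compatible complex
  structure. The complex inner product is linear in its \<^emph>\<open>second\<close> argument.\<close>

class complex_hilbert_space = real_inner + complete_space +
  fixes scaleC :: "complex \<Rightarrow> 'a \<Rightarrow> 'a"  (infixr \<open>*\<^sub>C\<close> 75)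
    and cinner :: "'a \<Rightarrow> 'a \<Rightarrow> complex"
  assumes scaleC_add_right: "c *\<^sub>C (x + y) = c *\<^sub>C x + c *\<^sub>C y"
    and scaleC_add_left: "(c + d) *\<^sub>C x = c *\<^sub>C x + d *\<^sub>C x"
    and scaleC_scaleC: "c *\<^sub>C d *\<^sub>C x = (c * d) *\<^sub>C x"
    and scaleC_of_real: "complex_of_real r *\<^sub>C x = r *\<^sub>R x"
    and cinner_commute: "cinner x y = cnj (cinner y x)"
    and cinner_add_right: "cinner x (y + z) = cinner x y + cinner x z"
    and cinner_scaleC_right: "cinner x (c *\<^sub>C y) = c * cinner x y"
    and inner_eq_Re_cinner: "inner x y = Re (cinner x y)"

lemma cinner_scaleC_left: "cinner (c *\<^sub>C x) y = cnj c * cinner x y"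
  by (metis cinner_commute cinner_scaleC_right complex_cnj_mult)

lemma cinner_self: "cinner x x = complex_of_real ((norm x)\<^sup>2)"
proof (rule complex_eqI)
  show "Re (cinner x x) = Re (complex_of_real ((norm x)\<^sup>2))"
    by (simp add: power2_norm_eq_inner inner_eq_Re_cinner)
  show "Im (cinner x x) = Im (complex_of_real ((norm x)\<^sup>2))"
    using cinner_commute[of x x] by (metis Im_complex_of_real Reals_cnj_iff complex_is_Real_iff)
qed

lemma norm_scaleC: "norm (c *\<^sub>C x) = cmod c * norm x"
proof -
  have "complex_of_real ((norm (c *\<^sub>C x))\<^sup>2) = (c * cnj c) * cinner x x"
    by (simp only: cinner_self[symmetric] cinner_scaleC_left cinner_scaleC_right mult_ac)
  also have "\<dots> = complex_of_real ((cmod c * norm x)\<^sup>2)"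
    by (simp add: cinner_self complex_norm_square[symmetric] power_mult_distrib)
  finally have "(norm (c *\<^sub>C x))\<^sup>2 = (cmod c * norm x)\<^sup>2"
    using of_real_eq_iff by blast
  then show ?thesis
    by (simp add: power2_eq_iff_nonneg)
qed

instantiation prod :: (complex_hilbert_space, complex_hilbert_space) complex_hilbert_space
begin

definition scaleC_prod :: "complex \<Rightarrow> 'a \<times> 'b \<Rightarrow> 'a \<times> 'b" where
  "scaleC_prod c x = (c *\<^sub>C fst x, c *\<^sub>C snd x)"

definition cinner_prod :: "'a \<times> 'b \<Rightarrow> 'a \<times> 'b \<Rightarrow> complex" where
  "cinner_prod x y = cinner (fst x) (fst y) + cinner (snd x) (snd y)"

instance
proof
  fix x y z :: "'a \<times> 'b" and c d :: complex and r :: real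
  show "c *\<^sub>C (x + y) = c *\<^sub>C x + c *\<^sub>C y"
    by (simp add: scaleC_prod_def scaleC_add_right)
  show "(c + d) *\<^sub>C x = c *\<^sub>C x + d *\<^sub>C x"
    by (simp add: scaleC_prod_def scaleC_add_left)
  show "c *\<^sub>C d *\<^sub>C x = (c * d) *\<^sub>C x"
    by (simp add: scaleC_prod_def scaleC_scaleC)
  show "complex_of_real r *\<^sub>C x = r *\<^sub>R x"
    by (simp add: scaleC_prod_def scaleC_of_real scaleR_prod_def)
  show "cinner x y = cnj (cinner y x)"
    by (simp add: cinner_prod_def cinner_commute[symmetric])
  show "cinner x (y + z) = cinner x y + cinner x z"
    by (simp add: cinner_prod_def cinner_add_right)
  show "cinner x (c *\<^sub>C y) = c * cinner x y"
    by (simp add: cinner_prod_def scaleC_prod_def cinner_scaleC_right distrib_left)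
  show "inner x y = Re (cinner x y)"
    by (simp add: cinner_prod_def inner_prod_def inner_eq_Re_cinner)
qed

end


section \<open>Square-summable families\<close>

typedef 'a ell2 = "{f :: 'a \<Rightarrow> complex. (\<lambda>t. (cmod (f t))\<^sup>2) summable_on UNIV}"
  morphisms ell2_coeff Abs_ell2
  by (rule exI[of _ "\<lambda>_. 0"]) simp

setup_lifting type_definition_ell2

lemma ell2_coeff_summable: "(\<lambda>t. (cmod (ell2_coeff f t))\<^sup>2) summable_on UNIV"
  using ell2_coeff[of f] by simp

lemma square_summable_add:
  assumes "(\<lambda>t. (cmod (f t))\<^sup>2) summable_on UNIV" "(\<lambda>t. (cmod (g t))\<^sup>2) summable_on UNIV"
  shows "(\<lambda>t. (cmod (f t + g t))\<^sup>2) summable_on UNIV"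
proof (rule summable_on_comparison_test)
  show "(\<lambda>t. 2 * (cmod (f t))\<^sup>2 + 2 * (cmod (g t))\<^sup>2) summable_on UNIV"
    using assms by (intro summable_on_add summable_on_cmult_right)
  fix t
  have "(cmod (f t + g t))\<^sup>2 \<le> (cmod (f t) + cmod (g t))\<^sup>2"
    by (simp add: norm_triangle_ineq power_mono)
  also have "\<dots> \<le> 2 * (cmod (f t))\<^sup>2 + 2 * (cmod (g t))\<^sup>2"
    using sum_squares_bound[of "cmod (f t)" "cmod (g t)"]
    by (simp add: power2_sum)
  finally show "(cmod (f t + g t))\<^sup>2 \<le> 2 * (cmod (f t))\<^sup>2 + 2 * (cmod (g t))\<^sup>2" .
qed simp

lemma square_summable_scale:
  assumes "(\<lambda>t. (cmod (f t))\<^sup>2) summable_on UNIV"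
  shows "(\<lambda>t. (cmod (c * f t))\<^sup>2) summable_on UNIV"
  using summable_on_cmult_right[OF assms, of "(cmod c)\<^sup>2"]
  by (simp add: norm_mult power_mult_distrib)

lemma Re_cnj_mult_self: "Re (cnj z * z) = (cmod z)\<^sup>2"
  unfolding cmod_power2 by (simp add: power2_eq_square)

lemma square_summable_prod:
  assumes "(\<lambda>t. (cmod (f t))\<^sup>2) summable_on UNIV" "(\<lambda>t. (cmod (g t))\<^sup>2) summable_on UNIV"
  shows "(\<lambda>t. cnj (f t) * g t) summable_on UNIV"
proof -
  have "(\<lambda>t. norm (cnj (f t) * g t)) summable_on UNIV"
  proof (rule summable_on_comparison_test)
    show "(\<lambda>t. (cmod (f t))\<^sup>2 + (cmod (g t))\<^sup>2) summable_on UNIV"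
      using assms by (intro summable_on_add)
    fix t
    show "norm (cnj (f t) * g t) \<le> (cmod (f t))\<^sup>2 + (cmod (g t))\<^sup>2"
    proof -
      have "0 \<le> cmod (f t) * cmod (g t)" by simp
      moreover have "2 * (cmod (f t) * cmod (g t)) \<le> (cmod (f t))\<^sup>2 + (cmod (g t))\<^sup>2"
        using sum_squares_bound[of "cmod (f t)" "cmod (g t)"] by (simp only: mult.assoc)
      ultimately show ?thesis unfolding norm_mult complex_mod_cnj by linarith
    qed
  qed simp
  then show ?thesis
    by (rule abs_summable_summable)
qed

instantiation ell2 :: (type) real_inner
begin

lift_definition zero_ell2 :: "'a ell2" is "\<lambda>_. 0" by simp
lift_definition plus_ell2 :: "'a ell2 \<Rightarrow> 'a ell2 \<Rightarrow> 'a ell2" is "\<lambda>f g t. f t + g t"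
  by (rule square_summable_add)
lift_definition uminus_ell2 :: "'a ell2 \<Rightarrow> 'a ell2" is "\<lambda>f t. - f t" by simp
lift_definition minus_ell2 :: "'a ell2 \<Rightarrow> 'a ell2 \<Rightarrow> 'a ell2" is "\<lambda>f g t. f t - g t"
  subgoal for f g using square_summable_add[of f "\<lambda>t. - g t"] by simp
  done
lift_definition scaleR_ell2 :: "real \<Rightarrow> 'a ell2 \<Rightarrow> 'a ell2" is "\<lambda>r f t. complex_of_real r * f t"
  by (rule square_summable_scale)
lift_definition inner_ell2 :: "'a ell2 \<Rightarrow> 'a ell2 \<Rightarrow> real"
  is "\<lambda>f g. Re (\<Sum>\<^sub>\<infinity>t. cnj (f t) * g t)" .
definition norm_ell2 :: "'a ell2 \<Rightarrow> real" where "norm_ell2 f = sqrt (inner f f)"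
definition dist_ell2 :: "'a ell2 \<Rightarrow> 'a ell2 \<Rightarrow> real" where "dist_ell2 f g = norm (f - g)"
definition sgn_ell2 :: "'a ell2 \<Rightarrow> 'a ell2" where "sgn_ell2 f = inverse (norm f) *\<^sub>R f"
definition uniformity_ell2 :: "('a ell2 \<times> 'a ell2) filter" where
  "uniformity_ell2 = (INF e\<in>{0<..}. principal {(x, y). dist x y < e})"
definition open_ell2 :: "'a ell2 set \<Rightarrow> bool" where
  "open_ell2 U = (\<forall>x\<in>U. eventually (\<lambda>(x', y). x' = x \<longrightarrow> y \<in> U) uniformity)"

instance
proof
  fix x y z :: "'a ell2" and a b :: real and U :: "'a ell2 set"
  show "x + y + z = x + (y + z)" by transfer (simp add: add.assoc)
  show "x + y = y + x" by transfer (simp add: add.commute)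
  show "0 + x = x" by transfer simp
  show "- x + x = 0" by transfer simp
  show "x - y = x + - y" by transfer simp
  show "a *\<^sub>R (x + y) = a *\<^sub>R x + a *\<^sub>R y" by transfer (simp add: distrib_left)
  show "(a + b) *\<^sub>R x = a *\<^sub>R x + b *\<^sub>R x" by transfer (simp add: distrib_right)
  show "a *\<^sub>R b *\<^sub>R x = (a * b) *\<^sub>R x" by transfer (simp add: mult.assoc)
  show "1 *\<^sub>R x = x" by transfer simp
  show "dist x y = norm (x - y)" by (rule dist_ell2_def)
  show "sgn x = inverse (norm x) *\<^sub>R x" by (rule sgn_ell2_def)
  show "uniformity = (INF e\<in>{0<..}. principal {(x :: 'a ell2, y). dist x y < e})"
    by (rule uniformity_ell2_def)
  show "open U = (\<forall>x\<in>U. eventually (\<lambda>(x', y). x' = x \<longrightarrow> y \<in> U) uniformity)"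
    by (rule open_ell2_def)
  show "inner x y = inner y x"
  proof transfer
    fix f g :: "'a \<Rightarrow> complex"
    have "(\<Sum>\<^sub>\<infinity>t. cnj (f t) * g t) = (\<Sum>\<^sub>\<infinity>t. cnj (cnj (g t) * f t))"
      by (simp add: mult.commute)
    also have "\<dots> = cnj (\<Sum>\<^sub>\<infinity>t. cnj (g t) * f t)" by (rule infsum_cnj)
    finally show "Re (\<Sum>\<^sub>\<infinity>t. cnj (f t) * g t) = Re (\<Sum>\<^sub>\<infinity>t. cnj (g t) * f t)"
      by simp
  qed
  show "inner (x + y) z = inner x z + inner y z"
    by transfer (simp add: distrib_right infsum_add square_summable_prod)
  show "inner (a *\<^sub>R x) y = a * inner x y"
    by transfer (simp add: mult.assoc infsum_cmult_right square_summable_prod)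
  have inner_self: "inner x x = (\<Sum>\<^sub>\<infinity>t. (cmod (ell2_coeff x t))\<^sup>2)" for x :: "'a ell2"
  proof transfer
    fix f :: "'a \<Rightarrow> complex"
    assume "(\<lambda>t. (cmod (f t))\<^sup>2) summable_on UNIV"
    then have "(\<lambda>t. cnj (f t) * f t) summable_on UNIV" by (intro square_summable_prod)
    then have "Re (\<Sum>\<^sub>\<infinity>t. cnj (f t) * f t) = (\<Sum>\<^sub>\<infinity>t. Re (cnj (f t) * f t))"
      by (rule infsum_Re[symmetric])
    also have "\<dots> = (\<Sum>\<^sub>\<infinity>t. (cmod (f t))\<^sup>2)"
      by (simp only: Re_cnj_mult_self)
    finally show "Re (\<Sum>\<^sub>\<infinity>t. cnj (f t) * f t) = (\<Sum>\<^sub>\<infinity>t. (cmod (f t))\<^sup>2)" .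
  qed
  show "0 \<le> inner x x" by (simp add: inner_self infsum_nonneg)
  show "inner x x = 0 \<longleftrightarrow> x = 0"
  proof
    assume "inner x x = 0"
    then have "(cmod (ell2_coeff x t))\<^sup>2 = 0" for t
      unfolding inner_self
      by (intro nonneg_infsum_le_0D[of "\<lambda>t. (cmod (ell2_coeff x t))\<^sup>2" UNIV] ell2_coeff_summable) auto
    then have "ell2_coeff x = ell2_coeff 0"
      by (auto simp: zero_ell2.rep_eq)
    then show "x = 0" by (simp add: ell2_coeff_inject)
  next
    assume "x = 0"
    then show "inner x x = 0" by (simp add: inner_self zero_ell2.rep_eq)
  qed
  show "norm x = sqrt (inner x x)" by (rule norm_ell2_def)
qed

end

lemma norm_ell2_sq: "(norm f)\<^sup>2 = (\<Sum>\<^sub>\<infinity>t. (cmod (ell2_coeff f t))\<^sup>2)"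
proof -
  have "(norm f)\<^sup>2 = inner f f" by (rule power2_norm_eq_inner)
  also have "\<dots> = Re (\<Sum>\<^sub>\<infinity>t. cnj (ell2_coeff f t) * ell2_coeff f t)"
    by (simp add: inner_ell2.rep_eq)
  also have "\<dots> = (\<Sum>\<^sub>\<infinity>t. Re (cnj (ell2_coeff f t) * ell2_coeff f t))"
    by (simp only: infsum_Re[OF square_summable_prod[OF ell2_coeff_summable ell2_coeff_summable]])
  also have "\<dots> = (\<Sum>\<^sub>\<infinity>t. (cmod (ell2_coeff f t))\<^sup>2)"
    by (simp only: Re_cnj_mult_self)
  finally show ?thesis .
qed

lemma sum_coeff_le_norm_ell2_sq:
  assumes "finite F"
  shows "(\<Sum>t\<in>F. (cmod (ell2_coeff f t))\<^sup>2) \<le> (norm f)\<^sup>2"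
  unfolding norm_ell2_sq
  by (rule finite_sum_le_infsum[OF ell2_coeff_summable assms]) auto

lemma cmod_coeff_le_norm_ell2: "cmod (ell2_coeff f t) \<le> norm f"
  using sum_coeff_le_norm_ell2_sq[of "{t}" f] by (simp add: power2_le_iff_abs_le)

instance ell2 :: (type) complete_space
proof
  fix X :: "nat \<Rightarrow> 'a ell2"
  assume X: "Cauchy X"
  have "Cauchy (\<lambda>n. ell2_coeff (X n) t)" for t
  proof (rule metric_CauchyI)
    fix e :: real
    assume "e > 0"
    obtain N where "\<And>m n. m \<ge> N \<Longrightarrow> n \<ge> N \<Longrightarrow> dist (X m) (X n) < e"
      using metric_CauchyD[OF X \<open>e > 0\<close>] by blast
    moreover have "dist (ell2_coeff (X m) t) (ell2_coeff (X n) t) \<le> dist (X m) (X n)" for m n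
      using cmod_coeff_le_norm_ell2[of "X m - X n" t] by (simp add: dist_norm minus_ell2.rep_eq)
    ultimately show "\<exists>N. \<forall>m\<ge>N. \<forall>n\<ge>N. dist (ell2_coeff (X m) t) (ell2_coeff (X n) t) < e"
      by (meson le_less_trans)
  qed
  then have "\<exists>l. (\<lambda>n. ell2_coeff (X n) t) \<longlonglongrightarrow> l" for t
    by (simp add: Cauchy_convergent_iff convergent_def)
  then obtain g where g: "\<And>t. (\<lambda>n. ell2_coeff (X n) t) \<longlonglongrightarrow> g t"
    by metis
  have fin: "\<exists>N. \<forall>m\<ge>N. \<forall>F. finite F \<longrightarrow> (\<Sum>t\<in>F. (cmod (ell2_coeff (X m) t - g t))\<^sup>2) \<le> e\<^sup>2"
    if "e > 0" for e :: real
  proof -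
    obtain N where N: "\<And>m n. m \<ge> N \<Longrightarrow> n \<ge> N \<Longrightarrow> dist (X m) (X n) < e"
      using metric_CauchyD[OF X \<open>e > 0\<close>] by blast
    have "(\<Sum>t\<in>F. (cmod (ell2_coeff (X m) t - g t))\<^sup>2) \<le> e\<^sup>2" if "m \<ge> N" "finite F" for m F
    proof (rule LIMSEQ_le_const2)
      show "(\<lambda>n. \<Sum>t\<in>F. (cmod (ell2_coeff (X m) t - ell2_coeff (X n) t))\<^sup>2)
          \<longlonglongrightarrow> (\<Sum>t\<in>F. (cmod (ell2_coeff (X m) t - g t))\<^sup>2)"
        by (intro tendsto_intros g)
      show "\<exists>N. \<forall>n\<ge>N. (\<Sum>t\<in>F. (cmod (ell2_coeff (X m) t - ell2_coeff (X n) t))\<^sup>2) \<le> e\<^sup>2"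
      proof (intro exI allI impI)
        fix n assume "n \<ge> N"
        then have "norm (X m - X n) \<le> e" using N[of m n] \<open>m \<ge> N\<close> by (simp add: dist_norm)
        then have "(norm (X m - X n))\<^sup>2 \<le> e\<^sup>2" by (simp add: power_mono)
        then show "(\<Sum>t\<in>F. (cmod (ell2_coeff (X m) t - ell2_coeff (X n) t))\<^sup>2) \<le> e\<^sup>2"
          using sum_coeff_le_norm_ell2_sq[OF \<open>finite F\<close>, of "X m - X n"]
          by (simp add: minus_ell2.rep_eq)
      qed
    qed
    then show ?thesis by blast
  qed
  have summ: "(\<lambda>t. (cmod (h t))\<^sup>2) summable_on UNIV"
    if "\<And>F. finite F \<Longrightarrow> (\<Sum>t\<in>F. (cmod (h t))\<^sup>2) \<le> e\<^sup>2" for h :: "'a \<Rightarrow> complex" and e :: real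
    by (rule nonneg_bdd_above_summable_on) (auto intro!: bdd_aboveI[of _ "e\<^sup>2"] that)
  obtain N where N: "\<And>F. finite F \<Longrightarrow> (\<Sum>t\<in>F. (cmod (ell2_coeff (X N) t - g t))\<^sup>2) \<le> 1\<^sup>2"
    using fin[of 1] by auto
  have "(\<lambda>t. (cmod (ell2_coeff (X N) t + - (ell2_coeff (X N) t - g t)))\<^sup>2) summable_on UNIV"
    using summ[OF N] by (intro square_summable_add ell2_coeff_summable) (simp add: norm_minus_commute)
  then have "(\<lambda>t. (cmod (g t))\<^sup>2) summable_on UNIV" by simp
  then obtain l where l: "ell2_coeff l = g"
    by (metis (mono_tags) Abs_ell2_inverse mem_Collect_eq)
  have "X \<longlonglongrightarrow> l"
  proof (rule metric_LIMSEQ_I)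
    fix r :: real
    assume "r > 0"
    then obtain N where N: "\<And>m F. m \<ge> N \<Longrightarrow> finite F \<Longrightarrow>
        (\<Sum>t\<in>F. (cmod (ell2_coeff (X m) t - g t))\<^sup>2) \<le> (r / 2)\<^sup>2"
      using fin[of "r / 2"] by auto
    have "dist (X m) l < r" if "m \<ge> N" for m
    proof -
      have "(norm (X m - l))\<^sup>2 \<le> (r / 2)\<^sup>2"
        unfolding norm_ell2_sq
        using N[OF that] by (intro infsum_le_finite_sums ell2_coeff_summable) (simp add: minus_ell2.rep_eq l)
      then have "norm (X m - l) \<le> r / 2"
        using \<open>r > 0\<close> by (simp add: power2_le_iff_abs_le)
      then show ?thesis using \<open>r > 0\<close> by (simp add: dist_norm)
    qed
    then show "\<exists>N. \<forall>m\<ge>N. dist (X m) l < r" by blast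
  qed
  then show "convergent X" by (auto simp: convergent_def)
qed

instantiation ell2 :: (type) complex_hilbert_space
begin

lift_definition scaleC_ell2 :: "complex \<Rightarrow> 'a ell2 \<Rightarrow> 'a ell2" is "\<lambda>c f t. c * f t"
  by (rule square_summable_scale)
lift_definition cinner_ell2 :: "'a ell2 \<Rightarrow> 'a ell2 \<Rightarrow> complex"
  is "\<lambda>f g. \<Sum>\<^sub>\<infinity>t. cnj (f t) * g t" .

instance
proof
  fix x y z :: "'a ell2" and c d :: complex and r :: real
  show "c *\<^sub>C (x + y) = c *\<^sub>C x + c *\<^sub>C y" by transfer (simp add: distrib_left)
  show "(c + d) *\<^sub>C x = c *\<^sub>C x + d *\<^sub>C x" by transfer (simp add: distrib_right)
  show "c *\<^sub>C d *\<^sub>C x = (c * d) *\<^sub>C x" by transfer (simp add: mult.assoc)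
  show "complex_of_real r *\<^sub>C x = r *\<^sub>R x" by transfer simp
  show "cinner x y = cnj (cinner y x)"
    by transfer (simp add: infsum_cnj[symmetric] mult.commute)
  show "cinner x (y + z) = cinner x y + cinner x z"
    by transfer (simp add: distrib_left infsum_add square_summable_prod)
  show "cinner x (c *\<^sub>C y) = c * cinner x y"
    by transfer (simp add: mult.left_commute infsum_cmult_right square_summable_prod)
  show "inner x y = Re (cinner x y)" by transfer simp
qed

end

lift_definition ell2_basis :: "'a \<Rightarrow> 'a ell2" is "\<lambda>s t. if t = s then 1 else 0"
  subgoal for s by (rule finite_nonzero_values_imp_summable_on) (simp add: if_distrib)
  done


section \<open>Bounded operators and von Neumann algebras\<close>

text \<open>The library type of bounded \<^emph>\<open>real\<close>-linear operators carries the operator norm; the bounded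
  operators of a complex Hilbert space are its complex-linear elements.\<close>

definition bounded_ops :: "('h::complex_hilbert_space \<Rightarrow>\<^sub>L 'h) set" where
  "bounded_ops = {a :: 'h \<Rightarrow>\<^sub>L 'h. \<forall>c \<xi>. a (c *\<^sub>C \<xi>) = c *\<^sub>C a \<xi>}"

lift_definition scaleC_op ::
  "complex \<Rightarrow> ('h::complex_hilbert_space \<Rightarrow>\<^sub>L 'h) \<Rightarrow> ('h \<Rightarrow>\<^sub>L 'h)"
  is "\<lambda>c a \<xi>. c *\<^sub>C a \<xi>"
proof -
  fix c :: complex and a :: "'h \<Rightarrow> 'h"
  assume a: "bounded_linear a"
  have "bounded_linear (\<lambda>\<xi>::'h. c *\<^sub>C \<xi>)"
    by (rule bounded_linear_intro[where K = "cmod c"])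
      (simp_all add: scaleC_add_right scaleC_of_real[symmetric] scaleC_scaleC norm_scaleC mult.commute)
  then show "bounded_linear (\<lambda>\<xi>. c *\<^sub>C a \<xi>)"
    using a by (rule bounded_linear_compose)
qed

definition adj_op :: "('h::complex_hilbert_space \<Rightarrow>\<^sub>L 'h) \<Rightarrow> ('h \<Rightarrow>\<^sub>L 'h)" where
  "adj_op a = (THE b :: 'h \<Rightarrow>\<^sub>L 'h. \<forall>\<xi> \<eta>. cinner (b \<xi>) \<eta> = cinner \<xi> (a \<eta>))"

definition commutant :: "('h::complex_hilbert_space \<Rightarrow>\<^sub>L 'h) set \<Rightarrow> ('h \<Rightarrow>\<^sub>L 'h) set" where
  "commutant S = {b \<in> bounded_ops. \<forall>a\<in>S. a o\<^sub>L b = b o\<^sub>L a}"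

definition von_neumann_algebra :: "('h::complex_hilbert_space \<Rightarrow>\<^sub>L 'h) set \<Rightarrow> bool" where
  "von_neumann_algebra M \<longleftrightarrow>
    M \<subseteq> bounded_ops \<and> (\<forall>a\<in>M. adj_op a \<in> M) \<and> commutant (commutant M) = M"

text \<open>The weak* topology of a von Neumann algebra is induced by the functionals
  \<open>a \<mapsto> \<Sum>n. \<langle>\<xi>\<^sub>n, a \<eta>\<^sub>n\<rangle>\<close> with \<open>\<xi>\<close>, \<open>\<eta>\<close> square-summable, which make up its predual.\<close>

definition square_summable_seq :: "(nat \<Rightarrow> 'h::complex_hilbert_space) \<Rightarrow> bool" where
  "square_summable_seq \<xi> \<longleftrightarrow> summable (\<lambda>n. (norm (\<xi> n))\<^sup>2)"

definition weak_star_topology ::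
  "('h::complex_hilbert_space \<Rightarrow>\<^sub>L 'h) set \<Rightarrow> ('h \<Rightarrow>\<^sub>L 'h) topology" where
  "weak_star_topology M = topology_generated_by
    {{a \<in> M. (\<Sum>n. cinner (\<xi> n) (a (\<eta> n))) \<in> U} | \<xi> \<eta> U.
      square_summable_seq \<xi> \<and> square_summable_seq \<eta> \<and> open U}"


section \<open>Maps on a von Neumann algebra\<close>

text \<open>A map on \<open>M\<close> is a HOL function of which only the values on \<open>M\<close> matter.\<close>

definition linear_map ::
  "('h::complex_hilbert_space \<Rightarrow>\<^sub>L 'h) set \<Rightarrow> (('h \<Rightarrow>\<^sub>L 'h) \<Rightarrow> ('h \<Rightarrow>\<^sub>L 'h)) \<Rightarrow> bool" where
  "linear_map M T \<longleftrightarrow> (\<forall>x\<in>M. T x \<in> M) \<and> (\<forall>x\<in>M. \<forall>y\<in>M. T (x + y) = T x + T y) \<and>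
    (\<forall>c. \<forall>x\<in>M. T (scaleC_op c x) = scaleC_op c (T x))"

definition weak_star_continuous ::
  "('h::complex_hilbert_space \<Rightarrow>\<^sub>L 'h) set \<Rightarrow> (('h \<Rightarrow>\<^sub>L 'h) \<Rightarrow> ('h \<Rightarrow>\<^sub>L 'h)) \<Rightarrow> bool" where
  "weak_star_continuous M T \<longleftrightarrow> continuous_map (weak_star_topology M) (weak_star_topology M) T"

definition map_norm ::
  "('h::complex_hilbert_space \<Rightarrow>\<^sub>L 'h) set \<Rightarrow> (('h \<Rightarrow>\<^sub>L 'h) \<Rightarrow> ('h \<Rightarrow>\<^sub>L 'h)) \<Rightarrow> ennreal" where
  "map_norm M T = (SUP x\<in>{x \<in> M. norm x \<le> 1}. ennreal (norm (T x)))"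

text \<open>An \<open>n \<times> n\<close> matrix over the operators on \<open>H\<close> is a function of two indices below \<open>n\<close>, acting
  on the \<open>n\<close>-fold Hilbert sum of \<open>H\<close>; positivity and norm are those of the resulting operator.\<close>

definition matrix_over :: "nat \<Rightarrow> 'a set \<Rightarrow> (nat \<Rightarrow> nat \<Rightarrow> 'a) \<Rightarrow> bool" where
  "matrix_over n M a \<longleftrightarrow> (\<forall>i<n. \<forall>j<n. a i j \<in> M)"

definition matrix_positive ::
  "nat \<Rightarrow> (nat \<Rightarrow> nat \<Rightarrow> ('h::complex_hilbert_space \<Rightarrow>\<^sub>L 'h)) \<Rightarrow> bool" where
  "matrix_positive n a \<longleftrightarrow>
    (\<forall>\<xi> :: nat \<Rightarrow> 'h. (\<Sum>i<n. cinner (\<xi> i) (\<Sum>j<n. a i j (\<xi> j))) \<in> \<real>\<^sub>\<ge>\<^sub>0)"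

definition matrix_norm ::
  "nat \<Rightarrow> (nat \<Rightarrow> nat \<Rightarrow> ('h::complex_hilbert_space \<Rightarrow>\<^sub>L 'h)) \<Rightarrow> real" where
  "matrix_norm n a =
    (SUP \<xi> \<in> {\<xi> :: nat \<Rightarrow> 'h. (\<Sum>j<n. (norm (\<xi> j))\<^sup>2) \<le> 1}.
      sqrt (\<Sum>i<n. (norm (\<Sum>j<n. a i j (\<xi> j)))\<^sup>2))"

definition completely_positive ::
  "('h::complex_hilbert_space \<Rightarrow>\<^sub>L 'h) set \<Rightarrow> (('h \<Rightarrow>\<^sub>L 'h) \<Rightarrow> ('h \<Rightarrow>\<^sub>L 'h)) \<Rightarrow> bool" where
  "completely_positive M T \<longleftrightarrow> linear_map M T \<and>
    (\<forall>n a. matrix_over n M a \<and> matrix_positive n a \<longrightarrow> matrix_positive n (\<lambda>i j. T (a i j)))"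

definition completely_contractive ::
  "('h::complex_hilbert_space \<Rightarrow>\<^sub>L 'h) set \<Rightarrow> (('h \<Rightarrow>\<^sub>L 'h) \<Rightarrow> ('h \<Rightarrow>\<^sub>L 'h)) \<Rightarrow> bool" where
  "completely_contractive M T \<longleftrightarrow> linear_map M T \<and>
    (\<forall>n a. matrix_over n M a \<longrightarrow> matrix_norm n (\<lambda>i j. T (a i j)) \<le> matrix_norm n a)"

text \<open>The traces below are finite, so \<open>M \<inter> L\<^sup>1(M) = M\<close>.\<close>

definition selfadjoint_map ::
  "('h::complex_hilbert_space \<Rightarrow>\<^sub>L 'h) set \<Rightarrow> (('h \<Rightarrow>\<^sub>L 'h) \<Rightarrow> complex) \<Rightarrow>
    (('h \<Rightarrow>\<^sub>L 'h) \<Rightarrow> ('h \<Rightarrow>\<^sub>L 'h)) \<Rightarrow> bool" where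
  "selfadjoint_map M \<tau> T \<longleftrightarrow> linear_map M T \<and> weak_star_continuous M T \<and> map_norm M T \<le> 1 \<and>
    (\<forall>x\<in>M. \<forall>y\<in>M. \<tau> (T x o\<^sub>L adj_op y) = \<tau> (x o\<^sub>L adj_op (T y)))"

definition unital_map :: "(('h::complex_hilbert_space \<Rightarrow>\<^sub>L 'h) \<Rightarrow> ('h \<Rightarrow>\<^sub>L 'h)) \<Rightarrow> bool" where
  "unital_map T \<longleftrightarrow> T id_blinfun = id_blinfun"

definition circ_map ::
  "(('h::complex_hilbert_space \<Rightarrow>\<^sub>L 'h) \<Rightarrow> ('h \<Rightarrow>\<^sub>L 'h)) \<Rightarrow> ('h \<Rightarrow>\<^sub>L 'h) \<Rightarrow> ('h \<Rightarrow>\<^sub>L 'h)" where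
  "circ_map T x = adj_op (T (adj_op x))"


section \<open>Two by two matrices\<close>

text \<open>For an algebra \<open>M\<close> of operators on \<open>H\<close>, the algebra \<open>M\<^sub>2(M)\<close> acts on \<open>H \<times> H\<close>.\<close>

definition inl_blinfun :: "'h::complex_hilbert_space \<Rightarrow>\<^sub>L ('h \<times> 'h)" where
  "inl_blinfun = Blinfun (\<lambda>\<xi>. (\<xi>, 0))"

lemma inl_blinfun_apply [simp]: "inl_blinfun \<xi> = (\<xi>, 0)"
  unfolding inl_blinfun_def
  by (subst bounded_linear_Blinfun_apply)
    (auto intro: bounded_linear_Pair bounded_linear_ident bounded_linear_zero)

definition inr_blinfun :: "'h::complex_hilbert_space \<Rightarrow>\<^sub>L ('h \<times> 'h)" where
  "inr_blinfun = Blinfun (\<lambda>\<xi>. (0, \<xi>))"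

lemma inr_blinfun_apply [simp]: "inr_blinfun \<xi> = (0, \<xi>)"
  unfolding inr_blinfun_def
  by (subst bounded_linear_Blinfun_apply)
    (auto intro: bounded_linear_Pair bounded_linear_ident bounded_linear_zero)

definition mat2 :: "('h::complex_hilbert_space \<Rightarrow>\<^sub>L 'h) \<Rightarrow> ('h \<Rightarrow>\<^sub>L 'h) \<Rightarrow> ('h \<Rightarrow>\<^sub>L 'h) \<Rightarrow>
    ('h \<Rightarrow>\<^sub>L 'h) \<Rightarrow> (('h \<times> 'h) \<Rightarrow>\<^sub>L ('h \<times> 'h))" where
  "mat2 a b c d = (inl_blinfun o\<^sub>L ((a o\<^sub>L fst_blinfun) + (b o\<^sub>L snd_blinfun))) +
    (inr_blinfun o\<^sub>L ((c o\<^sub>L fst_blinfun) + (d o\<^sub>L snd_blinfun)))"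

lemma mat2_apply: "mat2 a b c d (\<xi>, \<eta>) = (a \<xi> + b \<eta>, c \<xi> + d \<eta>)"
  by (simp add: mat2_def plus_blinfun.rep_eq)

definition entry11 :: "(('h::complex_hilbert_space \<times> 'h) \<Rightarrow>\<^sub>L ('h \<times> 'h)) \<Rightarrow> ('h \<Rightarrow>\<^sub>L 'h)" where
  "entry11 x = fst_blinfun o\<^sub>L x o\<^sub>L inl_blinfun"
definition entry12 :: "(('h::complex_hilbert_space \<times> 'h) \<Rightarrow>\<^sub>L ('h \<times> 'h)) \<Rightarrow> ('h \<Rightarrow>\<^sub>L 'h)" where
  "entry12 x = fst_blinfun o\<^sub>L x o\<^sub>L inr_blinfun"
definition entry21 :: "(('h::complex_hilbert_space \<times> 'h) \<Rightarrow>\<^sub>L ('h \<times> 'h)) \<Rightarrow> ('h \<Rightarrow>\<^sub>L 'h)" where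
  "entry21 x = snd_blinfun o\<^sub>L x o\<^sub>L inl_blinfun"
definition entry22 :: "(('h::complex_hilbert_space \<times> 'h) \<Rightarrow>\<^sub>L ('h \<times> 'h)) \<Rightarrow> ('h \<Rightarrow>\<^sub>L 'h)" where
  "entry22 x = snd_blinfun o\<^sub>L x o\<^sub>L inr_blinfun"

lemma entry_mat2 [simp]:
  "entry11 (mat2 a b c d) = a" "entry12 (mat2 a b c d) = b"
  "entry21 (mat2 a b c d) = c" "entry22 (mat2 a b c d) = d"
  by (auto intro!: blinfun_eqI simp: entry11_def entry12_def entry21_def entry22_def mat2_apply)

definition mat2_algebra ::
  "('h::complex_hilbert_space \<Rightarrow>\<^sub>L 'h) set \<Rightarrow> (('h \<times> 'h) \<Rightarrow>\<^sub>L ('h \<times> 'h)) set" where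
  "mat2_algebra M = {mat2 a b c d | a b c d. a \<in> M \<and> b \<in> M \<and> c \<in> M \<and> d \<in> M}"

definition mat2_trace ::
  "(('h::complex_hilbert_space \<Rightarrow>\<^sub>L 'h) \<Rightarrow> complex) \<Rightarrow> (('h \<times> 'h) \<Rightarrow>\<^sub>L ('h \<times> 'h)) \<Rightarrow> complex" where
  "mat2_trace \<tau> x = \<tau> (entry11 x) + \<tau> (entry22 x)"

definition block_map ::
  "(('h::complex_hilbert_space \<Rightarrow>\<^sub>L 'h) \<Rightarrow> ('h \<Rightarrow>\<^sub>L 'h)) \<Rightarrow> (('h \<Rightarrow>\<^sub>L 'h) \<Rightarrow> ('h \<Rightarrow>\<^sub>L 'h)) \<Rightarrow>
   (('h \<Rightarrow>\<^sub>L 'h) \<Rightarrow> ('h \<Rightarrow>\<^sub>L 'h)) \<Rightarrow> (('h \<Rightarrow>\<^sub>L 'h) \<Rightarrow> ('h \<Rightarrow>\<^sub>L 'h)) \<Rightarrow>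
   (('h \<times> 'h) \<Rightarrow>\<^sub>L ('h \<times> 'h)) \<Rightarrow> (('h \<times> 'h) \<Rightarrow>\<^sub>L ('h \<times> 'h))" where
  "block_map v\<^sub>1 T S v\<^sub>2 x = mat2 (v\<^sub>1 (entry11 x)) (T (entry12 x)) (S (entry21 x)) (v\<^sub>2 (entry22 x))"

definition decomposing_pairs ::
  "('h::complex_hilbert_space \<Rightarrow>\<^sub>L 'h) set \<Rightarrow> (('h \<Rightarrow>\<^sub>L 'h) \<Rightarrow> ('h \<Rightarrow>\<^sub>L 'h)) \<Rightarrow>
    ((('h \<Rightarrow>\<^sub>L 'h) \<Rightarrow> ('h \<Rightarrow>\<^sub>L 'h)) \<times> (('h \<Rightarrow>\<^sub>L 'h) \<Rightarrow> ('h \<Rightarrow>\<^sub>L 'h))) set" where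
  "decomposing_pairs M T = {(v\<^sub>1, v\<^sub>2). linear_map M v\<^sub>1 \<and> linear_map M v\<^sub>2 \<and>
    completely_positive (mat2_algebra M) (block_map v\<^sub>1 T (circ_map T) v\<^sub>2)}"

definition decomposable ::
  "('h::complex_hilbert_space \<Rightarrow>\<^sub>L 'h) set \<Rightarrow> (('h \<Rightarrow>\<^sub>L 'h) \<Rightarrow> ('h \<Rightarrow>\<^sub>L 'h)) \<Rightarrow> bool" where
  "decomposable M T \<longleftrightarrow> linear_map M T \<and> decomposing_pairs M T \<noteq> {}"

definition dec_norm ::
  "('h::complex_hilbert_space \<Rightarrow>\<^sub>L 'h) set \<Rightarrow> (('h \<Rightarrow>\<^sub>L 'h) \<Rightarrow> ('h \<Rightarrow>\<^sub>L 'h)) \<Rightarrow> ennreal" where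
  "dec_norm M T = (INF (v\<^sub>1, v\<^sub>2) \<in> decomposing_pairs M T. max (map_norm M v\<^sub>1) (map_norm M v\<^sub>2))"

definition contractively_decomposable ::
  "('h::complex_hilbert_space \<Rightarrow>\<^sub>L 'h) set \<Rightarrow> (('h \<Rightarrow>\<^sub>L 'h) \<Rightarrow> ('h \<Rightarrow>\<^sub>L 'h)) \<Rightarrow> bool" where
  "contractively_decomposable M T \<longleftrightarrow> decomposable M T \<and> dec_norm M T \<le> 1"

definition property_P ::
  "('h::complex_hilbert_space \<Rightarrow>\<^sub>L 'h) set \<Rightarrow> (('h \<Rightarrow>\<^sub>L 'h) \<Rightarrow> complex) \<Rightarrow>
    (('h \<Rightarrow>\<^sub>L 'h) \<Rightarrow> ('h \<Rightarrow>\<^sub>L 'h)) \<Rightarrow> bool" where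
  "property_P M \<tau> T \<longleftrightarrow> linear_map M T \<and> weak_star_continuous M T \<and>
    (\<exists>v\<^sub>1 v\<^sub>2. linear_map M v\<^sub>1 \<and> linear_map M v\<^sub>2 \<and>
      (let \<Phi> = block_map v\<^sub>1 T (circ_map T) v\<^sub>2 in
        completely_positive (mat2_algebra M) \<Phi> \<and>
        completely_contractive (mat2_algebra M) \<Phi> \<and>
        weak_star_continuous (mat2_algebra M) \<Phi> \<and>
        selfadjoint_map (mat2_algebra M) (mat2_trace \<tau>) \<Phi>))"


section \<open>Twisted group von Neumann algebras\<close>

text \<open>The discrete group is a type of class \<^class>\<open>group_add\<close>: groups in this class need not be
  commutative, but the product of \<open>s\<close> and \<open>t\<close> is written \<open>s + t\<close> and the unit is \<open>0\<close>.\<close>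

definition two_cocycle :: "('g::group_add \<Rightarrow> 'g \<Rightarrow> complex) \<Rightarrow> bool" where
  "two_cocycle \<sigma> \<longleftrightarrow> (\<forall>s t. cmod (\<sigma> s t) = 1) \<and>
    (\<forall>s t r. \<sigma> s t * \<sigma> (s + t) r = \<sigma> t r * \<sigma> s (t + r)) \<and>
    (\<forall>s. \<sigma> s 0 = 1 \<and> \<sigma> 0 s = 1)"

lemma twisted_translation_square_sum:
  fixes \<sigma> :: "'g::group_add \<Rightarrow> 'g \<Rightarrow> complex"
  assumes "two_cocycle \<sigma>"
  shows "(\<lambda>t. (cmod (\<sigma> s (- s + t) * ell2_coeff f (- s + t)))\<^sup>2) summable_on UNIV"
    and "(\<Sum>\<^sub>\<infinity>t. (cmod (\<sigma> s (- s + t) * ell2_coeff f (- s + t)))\<^sup>2) = (norm f)\<^sup>2"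
proof -
  have bij: "bij_betw (\<lambda>t. - s + t) UNIV (UNIV :: 'g set)"
    by (rule bij_betwI[where g = "\<lambda>t. s + t"]) (auto simp: add.assoc[symmetric])
  have eq: "(cmod (\<sigma> s (- s + t) * ell2_coeff f (- s + t)))\<^sup>2 = (cmod (ell2_coeff f (- s + t)))\<^sup>2" for t
    using assms by (simp add: two_cocycle_def norm_mult)
  show "(\<lambda>t. (cmod (\<sigma> s (- s + t) * ell2_coeff f (- s + t)))\<^sup>2) summable_on UNIV"
    unfolding eq
    using summable_on_reindex_bij_betw[OF bij, of "\<lambda>t. (cmod (ell2_coeff f t))\<^sup>2"]
    by (simp add: ell2_coeff_summable)
  show "(\<Sum>\<^sub>\<infinity>t. (cmod (\<sigma> s (- s + t) * ell2_coeff f (- s + t)))\<^sup>2) = (norm f)\<^sup>2"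
    unfolding eq norm_ell2_sq
    by (rule infsum_reindex_bij_betw[OF bij, of "\<lambda>t. (cmod (ell2_coeff f t))\<^sup>2"])
qed

definition twisted_translation ::
  "('g::group_add \<Rightarrow> 'g \<Rightarrow> complex) \<Rightarrow> 'g \<Rightarrow> ('g ell2 \<Rightarrow>\<^sub>L 'g ell2)" where
  "twisted_translation \<sigma> s =
    Blinfun (\<lambda>f. Abs_ell2 (\<lambda>t. \<sigma> s (- s + t) * ell2_coeff f (- s + t)))"

lemma twisted_translation_coeff:
  assumes "two_cocycle \<sigma>"
  shows "ell2_coeff (twisted_translation \<sigma> s f) t = \<sigma> s (- s + t) * ell2_coeff f (- s + t)"
proof -
  let ?L = "\<lambda>f. Abs_ell2 (\<lambda>t. \<sigma> s (- s + t) * ell2_coeff f (- s + t))"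
  have L: "ell2_coeff (?L f) = (\<lambda>t. \<sigma> s (- s + t) * ell2_coeff f (- s + t))" for f
    using twisted_translation_square_sum(1)[OF assms] by (simp add: Abs_ell2_inverse)
  have "bounded_linear ?L"
  proof (rule bounded_linear_intro[where K = 1])
    show "?L (f + g) = ?L f + ?L g" for f g
      by (rule ell2_coeff_inject[THEN iffD1], rule trans[OF L])
        (simp add: L plus_ell2.rep_eq distrib_left)
    show "?L (r *\<^sub>R f) = r *\<^sub>R ?L f" for r f
      by (rule ell2_coeff_inject[THEN iffD1], rule trans[OF L])
        (simp add: L scaleR_ell2.rep_eq mult.left_commute)
    have "(norm (?L f))\<^sup>2 = (norm f)\<^sup>2" for f
      unfolding norm_ell2_sq[of "?L f"] L by (rule twisted_translation_square_sum(2)[OF assms])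
    then show "norm (?L f) \<le> norm f * 1" for f
      by (simp add: power2_eq_iff_nonneg)
  qed
  then show ?thesis
    by (simp add: twisted_translation_def bounded_linear_Blinfun_apply L)
qed

lemma twisted_translation_basis:
  assumes "two_cocycle \<sigma>"
  shows "twisted_translation \<sigma> s (ell2_basis t) = \<sigma> s t *\<^sub>C ell2_basis (s + t)"
proof -
  have "- s + u = t \<longleftrightarrow> u = s + t" for u
    by (metis add.assoc add.left_inverse add.right_inverse add_0)
  then show ?thesis
    using assms
    by (auto simp: ell2_coeff_inject[symmetric] twisted_translation_coeff scaleC_ell2.rep_eq
        ell2_basis.rep_eq)
qed

definition VN :: "('g::group_add \<Rightarrow> 'g \<Rightarrow> complex) \<Rightarrow> ('g ell2 \<Rightarrow>\<^sub>L 'g ell2) set" where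
  "VN \<sigma> = von_neumann_algebra hull range (twisted_translation \<sigma>)"

definition VN_trace :: "('g::group_add ell2 \<Rightarrow>\<^sub>L 'g ell2) \<Rightarrow> complex" where
  "VN_trace x = cinner (ell2_basis 0) (x (ell2_basis 0))"

text \<open>\<open>fourier_multiplier \<sigma> \<phi> T\<close> says that \<open>\<phi>\<close> induces a Fourier multiplier and that \<open>T\<close> is this
  multiplier, which is determined on \<^term>\<open>VN \<sigma>\<close> by \<open>\<phi>\<close>.\<close>

definition fourier_multiplier ::
  "('g::group_add \<Rightarrow> 'g \<Rightarrow> complex) \<Rightarrow> ('g \<Rightarrow> complex) \<Rightarrow>
    (('g ell2 \<Rightarrow>\<^sub>L 'g ell2) \<Rightarrow> ('g ell2 \<Rightarrow>\<^sub>L 'g ell2)) \<Rightarrow> bool" where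
  "fourier_multiplier \<sigma> \<phi> T \<longleftrightarrow> linear_map (VN \<sigma>) T \<and> map_norm (VN \<sigma>) T < \<infinity> \<and>
    weak_star_continuous (VN \<sigma>) T \<and>
    (\<forall>s. T (twisted_translation \<sigma> s) = scaleC_op (\<phi> s) (twisted_translation \<sigma> s))"

end

theory Submission
  imports Defs
begin

text \<open>The implications are proved in the cycle from (1) to (3) to (2) and back to (1).  All of them turn
on one kernel.  For functions \<open>\<psi>\<^sub>1\<close>, \<open>\<phi>\<close>, \<open>\<psi>\<^sub>2\<close> on \<open>G\<close> consider the matrix, indexed by
\<open>{1, 2} \<times> G\<close>, whose blocks have the entries \<open>\<psi>\<^sub>1(u t\<inverse>)\<close>, \<open>\<phi>(u t\<inverse>)\<close>, the conjugate of \<open>\<phi>(t u\<inverse>)\<close>, and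
\<open>\<psi>\<^sub>2(u t\<inverse>)\<close>.  A block map with corner \<open>M\<^sub>\<phi>\<close> is completely positive only if such a matrix is positive
semidefinite, and a positive semidefinite matrix of this form defines a completely positive block
map.  The cocycle has modulus one and cancels from both statements.

\<^emph>\<open>From (1) to (3).\<close>  Selfadjointness makes \<open>\<phi>\<close> real.  For every \<open>\<epsilon> > 0\<close> there are decomposing maps
\<open>v\<^sub>1\<close>, \<open>v\<^sub>2\<close> of norm below \<open>1 + \<epsilon>\<close>.  They need not be multipliers or weak* continuous, but their
symbols \<open>\<psi>\<^sub>i(s) = \<tau>(v\<^sub>i(\<lambda>\<^sub>s) \<lambda>\<^sub>s\<^sup>*)\<close> make the kernel positive: apply the block map to the positive
matrix with entries \<open>\<lambda>\<^sub>s \<lambda>\<^sub>t\<^sup>*\<close> and test the result on basis vectors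
(\<open>psd_kernel_of_completely_positive\<close>).  The admissible pairs of symbols form decreasing closed
subsets of a product of discs, so a pair bounded by \<open>1\<close> survives as \<open>\<epsilon>\<close> tends to \<open>0\<close>
(\<open>psd_block_kernel_limit\<close>).  Averaging the kernel with its conjugate and raising its diagonal to
\<open>1\<close> keep positivity and yield real symbols with value \<open>1\<close> at the unit
(\<open>psd_block_kernel_normalize\<close>).

It remains to produce the multipliers (\<open>psd_block_multipliers\<close>).  They are Schur multipliers: the
entry \<open>x\<^sub>u\<^sub>t\<close> of an operator is multiplied by the entry of the kernel.  A vector in \<open>\<ell>\<^sup>2\<close> has countable
support, so that only countably many rows of the kernel matter at a time, and Gaussian elimination
of these rows writes the kernel as \<open>\<Sum>\<^sub>m cnj (c\<^sub>m p) c\<^sub>m q\<close> (\<open>psd_kernel_countable_decomposition\<close>).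
With the diagonal operators \<open>D\<^sub>m\<close> given by \<open>c\<^sub>m\<close> this reads
\<open>\<langle>\<xi>, \<Phi>(x) \<eta>\<rangle> = \<Sum>\<^sub>m \<langle>D\<^sub>m \<xi>, x D\<^sub>m \<eta>\<rangle>\<close> where \<open>\<Sum>\<^sub>m \<parallel>D\<^sub>m \<xi>\<parallel>\<^sup>2 \<le> \<parallel>\<xi>\<parallel>\<^sup>2\<close>, and boundedness, complete
positivity and weak* continuity are immediate from this formula.  That such a Schur multiplier
maps the twisted group algebra to itself follows from the commutation theorem
(\<open>VN_eq_twisted_convolutions\<close>): the algebra consists of all bounded operators whose matrix satisfies
\<open>x\<^sub>u\<^sub>t = \<sigma>(u t\<inverse>, t) f(u t\<inverse>)\<close> for some function \<open>f\<close>.  Finally a Schur multiplier with real entries is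
symmetric for the trace.

\<^emph>\<open>From (3) to (2).\<close>  A unital completely positive map is completely contractive
(\<open>completely_contractive_of_unital\<close>).

\<^emph>\<open>From (2) to (1).\<close>  Contractivity and selfadjointness of the block map restrict to its corners
(\<open>property_P_imp_selfadjoint_decomposable\<close>).

Comments write the group multiplicatively with unit \<open>e\<close>; in formulas it is additive with unit \<open>0\<close>.\<close>

section \<open>Complex inner products\<close>

lemma cinner_add_left: "cinner (x + y) z = cinner x z + cinner y z"
  by (metis cinner_add_right cinner_commute complex_cnj_add)

lemma scaleC_zero_left [simp]: "0 *\<^sub>C x = 0"
  using scaleC_of_real[of 0 x] by simp

lemma scaleC_one [simp]: "1 *\<^sub>C x = x"
  using scaleC_of_real[of 1 x] by simp

lemma scaleC_minus_one: "(- 1) *\<^sub>C x = - x"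
  using scaleC_of_real[of "-1" x] by simp

lemma scaleC_zero_right [simp]: "c *\<^sub>C (0::'a::complex_hilbert_space) = 0"
  using scaleC_add_right[of c 0 0] by simp

lemma cinner_zero_right [simp]: "cinner x 0 = 0"
  using cinner_scaleC_right[of x 0 0] by simp

lemma cinner_zero_left [simp]: "cinner 0 x = 0"
  using cinner_scaleC_left[of 0 0 x] by simp

lemma cinner_minus_right: "cinner x (- y) = - cinner x y"
  using cinner_scaleC_right[of x "- 1" y] by (simp add: scaleC_minus_one)

lemma cinner_diff_right: "cinner x (y - z) = cinner x y - cinner x z"
  using cinner_add_right[of x y "- z"] by (simp add: cinner_minus_right)

lemma cinner_sum_right: "cinner x (\<Sum>i\<in>I. f i) = (\<Sum>i\<in>I. cinner x (f i))"
  by (induction I rule: infinite_finite_induct) (auto simp: cinner_add_right)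

lemma cinner_sum_left: "cinner (\<Sum>i\<in>I. f i) x = (\<Sum>i\<in>I. cinner (f i) x)"
  by (induction I rule: infinite_finite_induct) (auto simp: cinner_add_left)

lemma cinner_extensionality:
  assumes "\<And>\<xi>. cinner \<xi> x = cinner \<xi> y"
  shows "x = y"
proof -
  have "cinner (x - y) (x - y) = 0"
    using assms[of "x - y"] by (simp add: cinner_diff_right)
  then show ?thesis by (simp add: cinner_self)
qed

text \<open>The complex inequality follows from the real one after a rotation of \<open>y\<close> that makes the inner
product real and nonnegative.\<close>

lemma norm_cinner_le: "cmod (cinner x y) \<le> norm x * norm y"
proof (cases "cinner x y = 0")
  case False
  define c where "c = cnj (cinner x y) / cmod (cinner x y)"
  have c: "cmod c = 1" using False by (simp add: c_def norm_divide)
  have "cinner x (c *\<^sub>C y) = complex_of_real (cmod (cinner x y))"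
    using False
    by (simp add: c_def cinner_scaleC_right complex_norm_square[symmetric] power2_eq_square mult.commute[of "cnj _"])
  then have "cmod (cinner x y) = inner x (c *\<^sub>C y)"
    by (simp add: inner_eq_Re_cinner)
  also have "\<dots> \<le> norm x * norm (c *\<^sub>C y)" by (rule norm_cauchy_schwarz)
  finally show ?thesis by (simp add: norm_scaleC c)
qed simp

lemma norm_blinfun_le_of_cinner:
  fixes a :: "'h::complex_hilbert_space \<Rightarrow>\<^sub>L 'h"
  assumes "0 \<le> C" and "\<And>\<xi> \<eta>. cmod (cinner \<xi> (a \<eta>)) \<le> C * norm \<xi> * norm \<eta>"
  shows "norm a \<le> C"
proof (rule norm_blinfun_bound[OF assms(1)])
  fix \<eta>
  have "norm (a \<eta>) * norm (a \<eta>) \<le> norm (a \<eta>) * (C * norm \<eta>)"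
    using assms(2)[of "a \<eta>" \<eta>] by (simp add: cinner_self norm_mult power2_eq_square mult_ac)
  then show "norm (a \<eta>) \<le> C * norm \<eta>"
    by (cases "norm (a \<eta>) = 0") (use assms(1) in auto)
qed

lemma bounded_opsD: "a \<in> bounded_ops \<Longrightarrow> a (c *\<^sub>C \<xi>) = c *\<^sub>C a \<xi>"
  by (simp add: bounded_ops_def)

lemma norm_cinner_blinfun_le:
  fixes a :: "'h::complex_hilbert_space \<Rightarrow>\<^sub>L 'h"
  shows "cmod (cinner \<xi> (a \<eta>)) \<le> norm a * norm \<xi> * norm \<eta>"
proof -
  have "cmod (cinner \<xi> (a \<eta>)) \<le> norm \<xi> * norm (a \<eta>)" by (rule norm_cinner_le)
  also have "\<dots> \<le> norm \<xi> * (norm a * norm \<eta>)"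
    by (intro mult_left_mono norm_blinfun) auto
  finally show ?thesis by (simp add: mult_ac)
qed

lemma adj_op_eqI:
  fixes a b :: "'h::complex_hilbert_space \<Rightarrow>\<^sub>L 'h"
  assumes "\<And>\<xi> \<eta>. cinner (b \<xi>) \<eta> = cinner \<xi> (a \<eta>)"
  shows "adj_op a = b"
  unfolding adj_op_def
proof (rule the_equality)
  show "\<forall>\<xi> \<eta>. cinner (b \<xi>) \<eta> = cinner \<xi> (a \<eta>)" using assms by blast
next
  fix b' :: "'h \<Rightarrow>\<^sub>L 'h"
  assume b': "\<forall>\<xi> \<eta>. cinner (b' \<xi>) \<eta> = cinner \<xi> (a \<eta>)"
  show "b' = b"
  proof (rule blinfun_eqI, rule cinner_extensionality)
    fix \<xi> \<eta>
    show "cinner \<eta> (b' \<xi>) = cinner \<eta> (b \<xi>)"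
      using b' assms by (metis cinner_commute)
  qed
qed

section \<open>Square-summable families and matrices\<close>

lemma ell2_eqI: "(\<And>t. ell2_coeff f t = ell2_coeff g t) \<Longrightarrow> f = g"
  by (metis ell2_coeff_inject ext)

lemma ell2_coeff_basis: "ell2_coeff (ell2_basis s) t = (if t = s then 1 else 0)"
  by (simp add: ell2_basis.rep_eq)

lemma cinner_basis: "cinner (ell2_basis t) f = ell2_coeff f t"
proof -
  have "cinner (ell2_basis t) f = (\<Sum>\<^sub>\<infinity>s. cnj (ell2_coeff (ell2_basis t) s) * ell2_coeff f s)"
    by (simp add: cinner_ell2.rep_eq)
  also have "\<dots> = (\<Sum>\<^sub>\<infinity>s\<in>{t}. cnj (ell2_coeff (ell2_basis t) s) * ell2_coeff f s)"
    by (rule infsum_cong_neutral) (auto simp: ell2_coeff_basis)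
  finally show ?thesis by (simp add: ell2_coeff_basis)
qed

lemma ell2_coeff_sum: "ell2_coeff (\<Sum>i\<in>I. f i) t = (\<Sum>i\<in>I. ell2_coeff (f i) t)"
  by (simp add: cinner_basis[symmetric] cinner_sum_right)

lemma norm_ell2_basis [simp]: "norm (ell2_basis t) = 1"
proof -
  have "complex_of_real ((norm (ell2_basis t))\<^sup>2) = 1"
    by (simp only: cinner_self[symmetric] cinner_basis ell2_coeff_basis) simp
  then have "(norm (ell2_basis t))\<^sup>2 = 1" using of_real_eq_1_iff by blast
  then show ?thesis by (metis norm_ge_zero power2_eq_1_iff neg_0_le_iff_le not_one_le_zero)
qed

lemma ell2_coeff_finite_combination:
  assumes "finite F"
  shows "ell2_coeff (\<Sum>t\<in>F. c t *\<^sub>C ell2_basis t) u = (if u \<in> F then c u else 0)"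
  using assms by (simp add: ell2_coeff_sum scaleC_ell2.rep_eq ell2_coeff_basis if_distrib cong: if_cong)

lemma norm_sq_finite_combination:
  assumes "finite F"
  shows "(norm (\<Sum>t\<in>F. c t *\<^sub>C ell2_basis t))\<^sup>2 = (\<Sum>t\<in>F. (cmod (c t))\<^sup>2)"
proof -
  have "(norm (\<Sum>t\<in>F. c t *\<^sub>C ell2_basis t))\<^sup>2
      = (\<Sum>\<^sub>\<infinity>u. (cmod (if u \<in> F then c u else 0))\<^sup>2)"
    by (simp only: norm_ell2_sq ell2_coeff_finite_combination[OF assms])
  also have "\<dots> = (\<Sum>\<^sub>\<infinity>u\<in>F. (cmod (c u))\<^sup>2)"
    by (rule infsum_cong_neutral) auto
  finally show ?thesis using assms by simp
qed

lemma ell2_has_sum_basis: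
  fixes f :: "'a ell2"
  shows "((\<lambda>t. ell2_coeff f t *\<^sub>C ell2_basis t) has_sum f) UNIV"
  unfolding has_sum_def
proof (rule tendstoI)
  fix e :: real assume "e > 0"
  have "((\<lambda>t. (cmod (ell2_coeff f t))\<^sup>2) has_sum (norm f)\<^sup>2) UNIV"
    unfolding norm_ell2_sq by (rule has_sum_infsum[OF ell2_coeff_summable])
  then have "eventually (\<lambda>F. dist (\<Sum>t\<in>F. (cmod (ell2_coeff f t))\<^sup>2) ((norm f)\<^sup>2) < e\<^sup>2)
      (finite_subsets_at_top UNIV)"
    unfolding has_sum_def using \<open>e > 0\<close> by (intro tendstoD) auto
  moreover have "eventually (\<lambda>F. finite F) (finite_subsets_at_top (UNIV :: 'a set))"
    by (rule eventually_finite_subsets_at_top_weakI)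
  ultimately show "eventually (\<lambda>F. dist (\<Sum>t\<in>F. ell2_coeff f t *\<^sub>C ell2_basis t) f < e)
      (finite_subsets_at_top UNIV)"
  proof eventually_elim
    case (elim F)
    let ?p = "\<Sum>t\<in>F. ell2_coeff f t *\<^sub>C ell2_basis t"
    let ?q = "(\<Sum>t\<in>F. (cmod (ell2_coeff f t))\<^sup>2)"
    have pp: "cinner ?p ?p = complex_of_real ?q"
      using norm_sq_finite_combination[OF elim(2), of "ell2_coeff f"] by (simp only: cinner_self)
    have "cinner ?p f = complex_of_real ?q"
      by (simp add: cinner_sum_left cinner_scaleC_left cinner_basis mult.commute[of "cnj _"]
          complex_norm_square[symmetric])
    then have "inner ?p f = ?q" by (simp add: inner_eq_Re_cinner)
    moreover have "inner ?p ?p = ?q" using pp by (simp add: inner_eq_Re_cinner)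
    ultimately have "(norm (?p - f))\<^sup>2 = (norm f)\<^sup>2 - ?q"
      by (simp add: power2_norm_eq_inner inner_diff_left inner_diff_right inner_commute)
    then have "(dist ?p f)\<^sup>2 < e\<^sup>2"
      using elim(1) by (simp add: dist_norm dist_real_def abs_real_def split: if_splits)
    then show ?case using \<open>e > 0\<close> by (simp add: power_less_imp_less_base)
  qed
qed

text \<open>A bounded complex-linear functional commutes with the expansion of a vector in the basis; this is
the source of all matrix computations below.\<close>

lemma bounded_functional_has_sum:
  fixes F :: "'a ell2 \<Rightarrow> complex"
  assumes add: "\<And>x y. F (x + y) = F x + F y" and scale: "\<And>c x. F (c *\<^sub>C x) = c * F x"
    and bound: "\<And>x. cmod (F x) \<le> C * norm x"
  shows "((\<lambda>t. ell2_coeff f t * F (ell2_basis t)) has_sum F f) UNIV"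
proof -
  have "bounded_linear F"
    by (rule bounded_linear_intro[where K = C])
      (use add bound scale[of "complex_of_real _"] in
        \<open>auto simp: scaleC_of_real mult.commute scaleR_conv_of_real\<close>)
  from has_sum_bounded_linear[OF this ell2_has_sum_basis[of f]]
  show ?thesis by (simp add: scale o_def)
qed

text \<open>This transports identities from basis vectors to all vectors.  The set \<open>S\<close> will be a countable
  set of rows in which a factorization of the kernel is available.\<close>

lemma bounded_functional_eq_on_support:
  fixes F G :: "'a ell2 \<Rightarrow> complex"
  assumes "\<And>x y. F (x + y) = F x + F y" "\<And>c x. F (c *\<^sub>C x) = c * F x"
    and "\<And>x. cmod (F x) \<le> C * norm x"
    and "\<And>x y. G (x + y) = G x + G y" "\<And>c x. G (c *\<^sub>C x) = c * G x"
    and "\<And>x. cmod (G x) \<le> D * norm x"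
    and eq: "\<And>t. t \<in> S \<Longrightarrow> F (ell2_basis t) = G (ell2_basis t)"
    and supp: "\<And>t. t \<notin> S \<Longrightarrow> ell2_coeff f t = 0"
  shows "F f = G f"
proof -
  have "(\<lambda>t. ell2_coeff f t * F (ell2_basis t)) = (\<lambda>t. ell2_coeff f t * G (ell2_basis t))"
    using eq supp by fastforce
  then show ?thesis
    using bounded_functional_has_sum[of F C f] bounded_functional_has_sum[of G D f] assms has_sum_unique
    by metis
qed

definition matrix_entry :: "('a ell2 \<Rightarrow>\<^sub>L 'a ell2) \<Rightarrow> 'a \<Rightarrow> 'a \<Rightarrow> complex" where
  "matrix_entry x u t = ell2_coeff (x (ell2_basis t)) u"

lemma matrix_entry_has_sum:
  assumes "x \<in> bounded_ops"
  shows "((\<lambda>t. ell2_coeff f t * matrix_entry x u t) has_sum ell2_coeff (x f) u) UNIV"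
  unfolding matrix_entry_def
  by (rule bounded_functional_has_sum[where F = "\<lambda>f. ell2_coeff (x f) u" and C = "norm x"])
    (use norm_cinner_blinfun_le[of "ell2_basis u" x] in
      \<open>auto simp: blinfun.add_right plus_ell2.rep_eq bounded_opsD[OF assms] scaleC_ell2.rep_eq
        cinner_basis\<close>)

lemma bounded_ops_eqI:
  assumes "x \<in> bounded_ops" "y \<in> bounded_ops" "\<And>u t. matrix_entry x u t = matrix_entry y u t"
  shows "x = y"
proof (rule blinfun_eqI, rule ell2_eqI)
  fix f u
  show "ell2_coeff (x f) u = ell2_coeff (y f) u"
    using matrix_entry_has_sum[OF assms(1), of f u] matrix_entry_has_sum[OF assms(2), of f u] assms(3)
    by (simp add: has_sum_unique)
qed

lemma le_square_of_le_mult_sqrt: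
  fixes q B :: real
  assumes "0 \<le> q" "0 \<le> B" "q \<le> B * sqrt q"
  shows "q \<le> B\<^sup>2"
proof (cases "q = 0")
  case False
  have "sqrt q * sqrt q \<le> B * sqrt q" using assms by simp
  then have "sqrt q \<le> B" using False assms(1) by (simp only: mult_le_cancel_right) auto
  then show ?thesis using assms(1) by (metis real_sqrt_ge_zero power_mono real_sqrt_pow2)
qed simp

text \<open>The bound on finite sections shows that the conjugated rows \<open>R u\<close> are vectors.  The required
  operator sends \<open>f\<close> to the family of the numbers \<open>\<langle>R u, f\<rangle>\<close>, which is square-summable because finite
  combinations of the rows satisfy \<open>\<parallel>\<Sum> a u R u\<parallel> \<le> C \<parallel>a\<parallel>\<close>.\<close>

lemma bounded_matrix_operator:
  fixes b :: "'a \<Rightarrow> 'a \<Rightarrow> complex"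
  assumes C: "0 \<le> C"
    and b: "\<And>F E a c. finite F \<Longrightarrow> finite E \<Longrightarrow>
      cmod (\<Sum>u\<in>F. \<Sum>t\<in>E. cnj (a u) * b u t * c t)
        \<le> C * sqrt (\<Sum>u\<in>F. (cmod (a u))\<^sup>2) * sqrt (\<Sum>t\<in>E. (cmod (c t))\<^sup>2)"
  obtains x where "x \<in> bounded_ops" "\<And>u t. matrix_entry x u t = b u t"
proof -
  have column: "(\<Sum>t\<in>E. (cmod (\<Sum>u\<in>F. cnj (a u) * b u t))\<^sup>2) \<le> C\<^sup>2 * (\<Sum>u\<in>F. (cmod (a u))\<^sup>2)"
    if "finite F" "finite E" for F E a
  proof -
    define c where "c t = cnj (\<Sum>u\<in>F. cnj (a u) * b u t)" for t
    let ?q = "\<Sum>t\<in>E. (cmod (c t))\<^sup>2"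
    have "(\<Sum>u\<in>F. \<Sum>t\<in>E. cnj (a u) * b u t * c t) = (\<Sum>t\<in>E. cnj (c t) * c t)"
      by (subst sum.swap) (simp add: c_def sum_distrib_right)
    also have "\<dots> = complex_of_real ?q"
      by (simp only: of_real_sum complex_norm_square mult.commute)
    finally have "?q \<le> C * sqrt (\<Sum>u\<in>F. (cmod (a u))\<^sup>2) * sqrt ?q"
      using b[OF that, of a c] by (simp only: norm_of_real)
    then have "?q \<le> (C * sqrt (\<Sum>u\<in>F. (cmod (a u))\<^sup>2))\<^sup>2"
      using C by (intro le_square_of_le_mult_sqrt) (simp_all add: sum_nonneg)
    then show ?thesis
      unfolding c_def complex_mod_cnj by (simp add: power_mult_distrib sum_nonneg)
  qed
  have "(\<lambda>t. (cmod (cnj (b u t)))\<^sup>2) summable_on UNIV" for u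
  proof (rule nonneg_bdd_above_summable_on)
    show "bdd_above (sum (\<lambda>t. (cmod (cnj (b u t)))\<^sup>2) ` {F. F \<subseteq> UNIV \<and> finite F})"
      using column[of "{u}" _ "\<lambda>_. 1"] by (intro bdd_aboveI[where M = "C\<^sup>2"]) auto
  qed simp
  moreover define R where "R u = Abs_ell2 (\<lambda>t. cnj (b u t))" for u
  ultimately have R: "ell2_coeff (R u) t = cnj (b u t)" for u t
    by (simp add: Abs_ell2_inverse)
  have bessel: "(\<Sum>u\<in>F. (cmod (cinner (R u) f))\<^sup>2) \<le> (C * norm f)\<^sup>2" if F: "finite F" for F f
  proof -
    define a where "a u = cinner (R u) f" for u
    let ?g = "\<Sum>u\<in>F. a u *\<^sub>C R u"
    let ?q = "\<Sum>u\<in>F. (cmod (a u))\<^sup>2"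
    have "(norm ?g)\<^sup>2 \<le> C\<^sup>2 * ?q"
      unfolding norm_ell2_sq
    proof (rule infsum_le_finite_sums[OF ell2_coeff_summable])
      fix E :: "'a set" assume "finite E"
      have "cmod (ell2_coeff ?g t) = cmod (\<Sum>u\<in>F. cnj (a u) * b u t)" for t
      proof -
        have "ell2_coeff ?g t = cnj (\<Sum>u\<in>F. cnj (a u) * b u t)"
          by (simp add: ell2_coeff_sum scaleC_ell2.rep_eq R)
        then show ?thesis by (simp only: complex_mod_cnj)
      qed
      then show "(\<Sum>t\<in>E. (cmod (ell2_coeff ?g t))\<^sup>2) \<le> C\<^sup>2 * ?q"
        using column[OF F \<open>finite E\<close>, of a] by simp
    qed
    also have "\<dots> = (C * sqrt ?q)\<^sup>2" by (simp add: power_mult_distrib sum_nonneg)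
    finally have g: "norm ?g \<le> C * sqrt ?q"
      by (rule power2_le_imp_le) (use C in \<open>simp add: sum_nonneg\<close>)
    have "cinner ?g f = (\<Sum>u\<in>F. cnj (a u) * a u)"
      by (simp add: cinner_sum_left cinner_scaleC_left a_def)
    also have "\<dots> = complex_of_real ?q"
      by (simp only: of_real_sum complex_norm_square mult.commute)
    finally have "cmod (cinner ?g f) = ?q"
      by (simp only: norm_of_real) (simp add: sum_nonneg)
    then have "?q \<le> norm ?g * norm f"
      using norm_cinner_le[of ?g f] by simp
    also have "\<dots> \<le> C * sqrt ?q * norm f"
      by (rule mult_right_mono[OF g]) simp
    finally have "?q \<le> (C * norm f)\<^sup>2"
      using C by (intro le_square_of_le_mult_sqrt) (simp_all add: sum_nonneg mult_ac)
    then show ?thesis by (simp add: a_def)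
  qed
  have summable: "(\<lambda>u. (cmod (cinner (R u) f))\<^sup>2) summable_on UNIV" for f
  proof (rule nonneg_bdd_above_summable_on)
    show "bdd_above (sum (\<lambda>u. (cmod (cinner (R u) f))\<^sup>2) ` {F. F \<subseteq> UNIV \<and> finite F})"
      using bessel[of _ f] by (intro bdd_aboveI[where M = "(C * norm f)\<^sup>2"]) auto
  qed simp
  define X where "X f = Abs_ell2 (\<lambda>u. cinner (R u) f)" for f
  have X: "ell2_coeff (X f) u = cinner (R u) f" for f u
    using summable by (simp add: X_def Abs_ell2_inverse)
  have "bounded_linear X"
  proof (rule bounded_linear_intro[where K = C])
    show "X (f + g) = X f + X g" for f g
      by (rule ell2_eqI) (simp add: X cinner_add_right plus_ell2.rep_eq)
    show "X (r *\<^sub>R f) = r *\<^sub>R X f" for r f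
      by (rule ell2_eqI) (simp add: X scaleC_of_real[symmetric] cinner_scaleC_right scaleC_ell2.rep_eq)
    show "norm (X f) \<le> norm f * C" for f
    proof -
      have "(norm (X f))\<^sup>2 \<le> (C * norm f)\<^sup>2"
        unfolding norm_ell2_sq X
        by (rule infsum_le_finite_sums[OF summable]) (use bessel in auto)
      then show ?thesis
        by (metis C mult.commute mult_nonneg_nonneg norm_ge_zero power2_le_imp_le)
    qed
  qed
  then have apply_X: "blinfun_apply (Blinfun X) = X" by (rule bounded_linear_Blinfun_apply)
  show ?thesis
  proof (rule that[of "Blinfun X"])
    show "Blinfun X \<in> bounded_ops"
      by (auto simp: bounded_ops_def apply_X X cinner_scaleC_right scaleC_ell2.rep_eq intro!: ell2_eqI)
    show "matrix_entry (Blinfun X) u t = b u t" for u t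
    proof -
      have "matrix_entry (Blinfun X) u t = cnj (cinner (ell2_basis t) (R u))"
        by (simp add: matrix_entry_def apply_X X cinner_commute[symmetric])
      then show ?thesis by (simp add: cinner_basis R)
    qed
  qed
qed

lemma cinner_finite_combinations:
  assumes "x \<in> bounded_ops"
  shows "cinner (\<Sum>u\<in>F. a u *\<^sub>C ell2_basis u) (x (\<Sum>t\<in>E. c t *\<^sub>C ell2_basis t))
    = (\<Sum>u\<in>F. \<Sum>t\<in>E. cnj (a u) * matrix_entry x u t * c t)"
  by (simp add: blinfun.sum_right cinner_sum_left cinner_sum_right cinner_scaleC_left
      cinner_scaleC_right bounded_opsD[OF assms] cinner_basis matrix_entry_def mult_ac sum_distrib_left
      sum.swap[of _ E F])

text \<open>The conjugate transpose of the matrix of \<open>x\<close> has the same finite sections up to conjugation, so it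
is the matrix of a bounded operator.\<close>

lemma ell2_adjoint_exists:
  fixes x :: "'a ell2 \<Rightarrow>\<^sub>L 'a ell2"
  assumes x: "x \<in> bounded_ops"
  obtains y where "y \<in> bounded_ops" "\<And>\<xi> \<eta>. cinner (y \<xi>) \<eta> = cinner \<xi> (x \<eta>)"
proof -
  have "cmod (\<Sum>u\<in>F. \<Sum>t\<in>E. cnj (a u) * cnj (matrix_entry x t u) * c t)
        \<le> norm x * sqrt (\<Sum>u\<in>F. (cmod (a u))\<^sup>2) * sqrt (\<Sum>t\<in>E. (cmod (c t))\<^sup>2)"
    if FE: "finite F" "finite E" for F E a c
  proof -
    let ?f = "\<Sum>u\<in>F. a u *\<^sub>C ell2_basis u" and ?g = "\<Sum>t\<in>E. c t *\<^sub>C ell2_basis t"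
    have "(\<Sum>u\<in>F. \<Sum>t\<in>E. cnj (a u) * cnj (matrix_entry x t u) * c t) = cnj (cinner ?g (x ?f))"
      unfolding cinner_finite_combinations[OF x]
      by (subst sum.swap) (simp add: mult_ac)
    moreover have "norm ?f = sqrt (\<Sum>u\<in>F. (cmod (a u))\<^sup>2)" "norm ?g = sqrt (\<Sum>t\<in>E. (cmod (c t))\<^sup>2)"
      using FE by (simp_all add: norm_sq_finite_combination[symmetric])
    ultimately show ?thesis
      using norm_cinner_blinfun_le[of ?g x ?f] by (simp only: complex_mod_cnj) (simp add: mult_ac)
  qed
  then obtain y where y: "y \<in> bounded_ops" "\<And>u t. matrix_entry y u t = cnj (matrix_entry x t u)"
    by (rule bounded_matrix_operator[of "norm x" "\<lambda>u t. cnj (matrix_entry x t u)", rotated]) auto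
  have basis: "cinner (y (ell2_basis t :: 'a ell2)) \<eta> = cinner (ell2_basis t) (x \<eta>)" for t \<eta>
  proof (rule bounded_functional_eq_on_support[where S = UNIV and F = "\<lambda>f. cinner (y (ell2_basis t)) f"
        and G = "\<lambda>f. cinner (ell2_basis t) (x f)" and C = "norm (y (ell2_basis t))" and D = "norm x"])
    show "cinner (y (ell2_basis t)) (ell2_basis s) = cinner (ell2_basis t) (x (ell2_basis s))" for s
      using y(2)[of s t] cinner_commute[of "y (ell2_basis t)" "ell2_basis s"]
      by (simp add: cinner_basis matrix_entry_def)
    show "cmod (cinner (y (ell2_basis t)) f) \<le> norm (y (ell2_basis t)) * norm f" for f
      by (rule norm_cinner_le)
    show "cmod (cinner (ell2_basis t) (x f)) \<le> norm x * norm f" for f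
      using norm_cinner_blinfun_le[of "ell2_basis t" x f] by simp
  qed (auto simp: cinner_add_right cinner_scaleC_right blinfun.add_right bounded_opsD[OF x])
  have "cnj (cinner (y \<xi>) \<eta>) = cnj (cinner \<xi> (x \<eta>))" for \<xi> \<eta>
    unfolding cinner_commute[symmetric]
  proof (rule bounded_functional_eq_on_support[where S = UNIV and F = "\<lambda>f. cinner \<eta> (y f)"
        and G = "\<lambda>f. cinner (x \<eta>) f" and C = "norm y * norm \<eta>" and D = "norm (x \<eta>)"])
    show "cinner \<eta> (y (ell2_basis t)) = cinner (x \<eta>) (ell2_basis t)" for t
      using basis[of t \<eta>] by (metis cinner_commute)
    show "cmod (cinner \<eta> (y f)) \<le> norm y * norm \<eta> * norm f" for f
      by (rule norm_cinner_blinfun_le)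
    show "cmod (cinner (x \<eta>) f) \<le> norm (x \<eta>) * norm f" for f
      by (rule norm_cinner_le)
  qed (auto simp: cinner_add_right cinner_scaleC_right blinfun.add_right bounded_opsD[OF y(1)])
  then have "cinner (y \<xi>) \<eta> = cinner \<xi> (x \<eta>)" for \<xi> \<eta>
    by (simp only: complex_cnj_cancel_iff)
  with y(1) show ?thesis by (rule that)
qed

lemma adj_op_ell2:
  fixes x :: "'a ell2 \<Rightarrow>\<^sub>L 'a ell2"
  assumes x: "x \<in> bounded_ops"
  shows "cinner (adj_op x \<xi>) \<eta> = cinner \<xi> (x \<eta>)" and "adj_op x \<in> bounded_ops"
    and "matrix_entry (adj_op x) u t = cnj (matrix_entry x t u)"
proof -
  obtain y where y: "y \<in> bounded_ops" "\<And>\<xi> \<eta>. cinner (y \<xi>) \<eta> = cinner \<xi> (x \<eta>)"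
    using ell2_adjoint_exists[OF x] by blast
  then have eq: "adj_op x = y" by (intro adj_op_eqI)
  show *: "cinner (adj_op x \<xi>) \<eta> = cinner \<xi> (x \<eta>)" for \<xi> \<eta> using y eq by simp
  show "adj_op x \<in> bounded_ops" using y eq by simp
  show "matrix_entry (adj_op x) u t = cnj (matrix_entry x t u)"
    using *[of "ell2_basis t" "ell2_basis u"]
    by (simp add: matrix_entry_def cinner_basis[symmetric] cinner_commute[of _ "ell2_basis u"])
      (metis cinner_commute)
qed

section \<open>Positive semidefinite kernels\<close>

text \<open>Positivity is tested on finite sequences of points, possibly with repetitions; this is the form in
which complete positivity delivers it.\<close>

definition psd_kernel :: "('i \<Rightarrow> 'i \<Rightarrow> complex) \<Rightarrow> bool" where
  "psd_kernel K \<longleftrightarrow> (\<forall>n (p :: nat \<Rightarrow> 'i) a.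
    (\<Sum>k<n. \<Sum>l<n. cnj (a k) * K (p k) (p l) * a l) \<in> \<real>\<^sub>\<ge>\<^sub>0)"

lemma psd_kernelD:
  fixes n :: nat
  shows "psd_kernel K \<Longrightarrow> (\<Sum>k<n. \<Sum>l<n. cnj (a k) * K (p k) (p l) * a l) \<in> \<real>\<^sub>\<ge>\<^sub>0"
  unfolding psd_kernel_def by (drule spec[of _ n], drule spec[of _ p], drule spec[of _ a])

lemma psd_kernel_diag: "psd_kernel K \<Longrightarrow> K p p \<in> \<real>\<^sub>\<ge>\<^sub>0"
  using psd_kernelD[of K "\<lambda>_. 1" "\<lambda>_. p" 1] by simp

lemma psd_kernel_pair:
  assumes "psd_kernel K"
  shows "cnj a * K p p * a + cnj a * K p q * b + cnj b * K q p * a + cnj b * K q q * b \<in> \<real>\<^sub>\<ge>\<^sub>0"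
proof -
  have 2: "{..<2::nat} = {0, 1}" by auto
  show ?thesis
    using psd_kernelD[OF assms, where n = 2 and a = "\<lambda>k. if k = 0 then a else b" and p = "\<lambda>k. if k = 0 then p else q"]
    by (simp add: 2 add_ac)
qed

text \<open>The quadratic form is real at \<open>(1, 1)\<close> and at \<open>(1, \<i>)\<close>; this makes the imaginary and the real part of
\<open>K q p - cnj (K p q)\<close> vanish.\<close>

lemma psd_kernel_hermitian:
  assumes "psd_kernel K"
  shows "K q p = cnj (K p q)"
proof -
  have "Im (K p p) = 0" "Im (K q q) = 0"
    using psd_kernel_diag[OF assms] by (auto simp: complex_nonneg_Reals_iff)
  moreover have "Im (K p p + K p q + K q p + K q q) = 0"
    using psd_kernel_pair[OF assms, of 1 p q 1] by (simp add: complex_nonneg_Reals_iff)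
  moreover have "Im (K p p + K p q * \<i> - \<i> * K q p + K q q) = 0"
    using psd_kernel_pair[OF assms, of 1 p q \<i>]
    by (simp add: complex_nonneg_Reals_iff algebra_simps)
  ultimately show ?thesis by (intro complex_eqI) auto
qed

lemma psd_kernel_zero_row:
  assumes K: "psd_kernel K" and "K w w = 0"
  shows "K w q = 0"
proof (rule ccontr)
  assume ne: "K w q \<noteq> 0"
  \<comment> \<open>With this \<open>r\<close> the form at \<open>(- r K w q, 1)\<close> takes the value \<open>- Re (K q q) - 2\<close>, which is negative.\<close>
  define r where "r = (Re (K q q) + 1) / (cmod (K w q))\<^sup>2"
  have r: "0 \<le> Re (K q q)" using psd_kernel_diag[OF K, of q] by (simp add: complex_nonneg_Reals_iff)
  define a where "a = - of_real r * K w q"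
  have "Re (cnj a * K w q + K q w * a + K q q) \<ge> 0"
    using psd_kernel_pair[OF K, of a w q 1] assms(2) by (simp add: complex_nonneg_Reals_iff)
  moreover have "cnj a * K w q + K q w * a = - of_real (2 * (r * (cmod (K w q))\<^sup>2))"
    by (simp only: a_def psd_kernel_hermitian[OF K, of q w] of_real_mult complex_norm_square)
      (simp add: algebra_simps)
  ultimately show False
    using ne r by (simp add: r_def)
qed


text \<open>One step of symmetric elimination.  If the pivot \<open>K w w\<close> vanishes, then so does its row, and the
convention \<open>x / 0 = 0\<close> makes the step trivial.\<close>

lemma psd_kernel_schur_complement:
  assumes K: "psd_kernel K"
  shows "psd_kernel (\<lambda>p q. K p q - K p w * K w q / K w w)"
proof (cases "K w w = 0")
  case True
  then show ?thesis using K by simp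
next
  case False
  have real_w: "cnj (K w w) = K w w"
    using psd_kernel_hermitian[OF K, of w w] by simp
  show ?thesis
    unfolding psd_kernel_def
  proof (intro allI)
    fix n :: nat and p :: "nat \<Rightarrow> 'a" and a :: "nat \<Rightarrow> complex"
    define c where "c = (\<Sum>l<n. K w (p l) * a l)"
    \<comment> \<open>The coefficient at \<open>w\<close> minimises the quadratic form of \<open>K\<close>.\<close>
    define a' where "a' k = (if k < n then a k else - c / K w w)" for k
    define p' where "p' k = (if k < n then p k else w)" for k
    let ?Q = "\<Sum>k<n. \<Sum>l<n. cnj (a k) * K (p k) (p l) * a l"
    have c': "(\<Sum>k<n. cnj (a k) * K (p k) w) = cnj c"
      by (simp add: c_def psd_kernel_hermitian[OF K, of w] mult.commute)
    have "(\<Sum>k<Suc n. \<Sum>l<Suc n. cnj (a' k) * K (p' k) (p' l) * a' l)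
        = ?Q + (\<Sum>k<n. cnj (a k) * K (p k) w) * (- c / K w w)
          + cnj (- c / K w w) * (\<Sum>l<n. K w (p l) * a l) + cnj (- c / K w w) * K w w * (- c / K w w)"
      by (simp add: a'_def p'_def sum.distrib sum_subtractf sum_negf sum_distrib_left sum_distrib_right mult_ac)
    also have "\<dots> = ?Q - cnj c * c / K w w"
      using False by (simp only: c' c_def[symmetric]) (simp add: real_w)
    also have "cnj c * c / K w w = (\<Sum>k<n. cnj (a k) * K (p k) w) * (\<Sum>l<n. K w (p l) * a l) / K w w"
      by (simp only: c' c_def[symmetric])
    also have "\<dots> = (\<Sum>k<n. \<Sum>l<n. cnj (a k) * (K (p k) w * K w (p l) / K w w) * a l)"
      by (simp only: sum_product) (simp add: sum_divide_distrib mult_ac)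
    finally have "(\<Sum>k<Suc n. \<Sum>l<Suc n. cnj (a' k) * K (p' k) (p' l) * a' l)
        = (\<Sum>k<n. \<Sum>l<n. cnj (a k) * (K (p k) (p l) - K (p k) w * K w (p l) / K w w) * a l)"
      by (simp only: sum_subtractf[symmetric] left_diff_distrib right_diff_distrib)
    then show "(\<Sum>k<n. \<Sum>l<n. cnj (a k) * (K (p k) (p l) - K (p k) w * K w (p l) / K w w) * a l) \<in> \<real>\<^sub>\<ge>\<^sub>0"
      using psd_kernelD[OF K, where n = "Suc n" and a = a' and p = p'] by simp
  qed
qed

text \<open>What remains of \<open>K\<close> after the rows \<open>w 0, \<dots>, w (n - 1)\<close> have been eliminated.\<close>

primrec residual_kernel :: "('i \<Rightarrow> 'i \<Rightarrow> complex) \<Rightarrow> (nat \<Rightarrow> 'i) \<Rightarrow> nat \<Rightarrow> 'i \<Rightarrow> 'i \<Rightarrow> complex" where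
  "residual_kernel K w 0 = K"
| "residual_kernel K w (Suc n) = (\<lambda>p q. residual_kernel K w n p q
    - residual_kernel K w n p (w n) * residual_kernel K w n (w n) q / residual_kernel K w n (w n) (w n))"

lemma psd_residual_kernel: "psd_kernel K \<Longrightarrow> psd_kernel (residual_kernel K w n)"
  by (induction n) (auto intro: psd_kernel_schur_complement)

text \<open>An eliminated row is zero and stays zero, even if \<open>w\<close> repeats it later.\<close>

lemma residual_kernel_zero_row:
  assumes K: "psd_kernel K" and "m < n"
  shows "residual_kernel K w n (w m) q = 0"
  using \<open>m < n\<close>
proof (induction n arbitrary: q)
  case (Suc n)
  show ?case
  proof (cases "m = n")
    case True
    then show ?thesis
      using psd_kernel_zero_row[OF psd_residual_kernel[OF K, of w n], of "w n"] by simp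
  next
    case False
    with Suc show ?thesis by simp
  qed
qed simp

definition cholesky_factor :: "('i \<Rightarrow> 'i \<Rightarrow> complex) \<Rightarrow> (nat \<Rightarrow> 'i) \<Rightarrow> nat \<Rightarrow> 'i \<Rightarrow> complex" where
  "cholesky_factor K w n q = residual_kernel K w n (w n) q /
    complex_of_real (sqrt (Re (residual_kernel K w n (w n) (w n))))"

lemma cholesky_decomposition:
  assumes K: "psd_kernel K"
  shows "K p q = (\<Sum>m<n. cnj (cholesky_factor K w m p) * cholesky_factor K w m q) + residual_kernel K w n p q"
proof (induction n)
  case (Suc n)
  let ?R = "residual_kernel K w n"
  have R: "psd_kernel ?R" by (rule psd_residual_kernel[OF K])
  have "Re (?R (w n) (w n)) \<ge> 0" "?R (w n) (w n) = of_real (Re (?R (w n) (w n)))"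
    using psd_kernel_diag[OF R, of "w n"] by (auto simp: complex_nonneg_Reals_iff complex_eq_iff)
  then have "complex_of_real (sqrt (Re (?R (w n) (w n)))) * complex_of_real (sqrt (Re (?R (w n) (w n))))
      = ?R (w n) (w n)"
    by (simp flip: of_real_mult)
  then have "cnj (cholesky_factor K w n p) * cholesky_factor K w n q = ?R p (w n) * ?R (w n) q / ?R (w n) (w n)"
    by (simp add: cholesky_factor_def psd_kernel_hermitian[OF R, of p "w n"])
  then show ?case using Suc by simp
qed simp

text \<open>Every positive semidefinite kernel is a sum of rank-one kernels as far as its entries in
  countably many rows are concerned: eliminate these rows one after the other.  The diagonal bounds
  the factors at all points, also at those outside the chosen rows.\<close>

lemma psd_kernel_countable_decomposition:
  fixes K :: "'i \<Rightarrow> 'i \<Rightarrow> complex"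
  assumes K: "psd_kernel K" and "countable S"
  obtains c :: "nat \<Rightarrow> 'i \<Rightarrow> complex"
  where "\<forall>N p. (\<Sum>m<N. (cmod (c m p))\<^sup>2) \<le> Re (K p p)"
    and "\<forall>p\<in>S. \<forall>q. (\<lambda>m. cnj (c m p) * c m q) sums K p q"
proof -
  obtain w :: "nat \<Rightarrow> 'i" where w: "S \<subseteq> range w"
    using from_nat_into_surj[OF \<open>countable S\<close>] by (intro that[of "from_nat_into S"]) (metis rangeI subsetI)
  define c where "c = cholesky_factor K w"
  show ?thesis
  proof (rule that[of c]; intro allI ballI)
    fix N p
    have "Re (K p p) = (\<Sum>m<N. (cmod (c m p))\<^sup>2) + Re (residual_kernel K w N p p)"
      unfolding c_def
      by (subst cholesky_decomposition[OF K, of p p w N])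
        (simp only: plus_complex.simps Re_sum Re_cnj_mult_self)
    then show "(\<Sum>m<N. (cmod (c m p))\<^sup>2) \<le> Re (K p p)"
      using psd_kernel_diag[OF psd_residual_kernel[OF K], of w N p]
      by (simp add: complex_nonneg_Reals_iff)
  next
    fix p q assume "p \<in> S"
    then obtain m where m: "p = w m" using w by blast
    have zero: "cnj (c k p) * c k q = 0" if "k \<notin> {..<Suc m}" for k
    proof -
      have "residual_kernel K w k p (w k) = 0"
        unfolding m by (rule residual_kernel_zero_row[OF K]) (use that in simp)
      then show ?thesis
        using psd_kernel_hermitian[OF psd_residual_kernel[OF K], of w k "w k" p]
        by (simp add: c_def cholesky_factor_def)
    qed
    have "K p q = (\<Sum>k<Suc m. cnj (c k p) * c k q)"
      using cholesky_decomposition[OF K, of p q w "Suc m"] residual_kernel_zero_row[OF K, of m "Suc m" w q]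
      by (simp add: c_def m)
    then show "(\<lambda>k. cnj (c k p) * c k q) sums K p q"
      using sums_finite[of "{..<Suc m}" "\<lambda>k. cnj (c k p) * c k q"] zero by simp
  qed
qed

lemma psd_kernel_cnj:
  assumes "psd_kernel K"
  shows "psd_kernel (\<lambda>p q. cnj (K p q))"
  unfolding psd_kernel_def
proof (intro allI)
  fix n and p :: "nat \<Rightarrow> 'a" and a
  have "cnj z \<in> \<real>\<^sub>\<ge>\<^sub>0" if "z \<in> \<real>\<^sub>\<ge>\<^sub>0" for z
    using that by (auto simp: complex_nonneg_Reals_iff)
  then have "cnj (\<Sum>k<n. \<Sum>l<n. cnj (cnj (a k)) * K (p k) (p l) * cnj (a l)) \<in> \<real>\<^sub>\<ge>\<^sub>0"
    using psd_kernelD[OF assms, where n = n and a = "\<lambda>k. cnj (a k)" and p = p] by blast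
  then show "(\<Sum>k<n. \<Sum>l<n. cnj (a k) * cnj (K (p k) (p l)) * a l) \<in> \<real>\<^sub>\<ge>\<^sub>0"
    by simp
qed

lemma psd_kernel_add:
  assumes "psd_kernel K" "psd_kernel L"
  shows "psd_kernel (\<lambda>p q. K p q + L p q)"
  unfolding psd_kernel_def
proof (intro allI)
  fix n and p :: "nat \<Rightarrow> 'a" and a
  show "(\<Sum>k<n. \<Sum>l<n. cnj (a k) * (K (p k) (p l) + L (p k) (p l)) * a l) \<in> \<real>\<^sub>\<ge>\<^sub>0"
    using nonneg_Reals_add_I[OF psd_kernelD[OF assms(1), where n = n and a = a and p = p] psd_kernelD[OF assms(2), where n = n and a = a and p = p]]
    by (simp add: distrib_left distrib_right sum.distrib)
qed

lemma psd_kernel_scale: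
  assumes "psd_kernel K" "0 \<le> r"
  shows "psd_kernel (\<lambda>p q. complex_of_real r * K p q)"
  unfolding psd_kernel_def
proof (intro allI)
  fix n and p :: "nat \<Rightarrow> 'a" and a
  show "(\<Sum>k<n. \<Sum>l<n. cnj (a k) * (complex_of_real r * K (p k) (p l)) * a l) \<in> \<real>\<^sub>\<ge>\<^sub>0"
    using nonneg_Reals_mult_I[OF nonneg_Reals_of_real_iff[THEN iffD2, OF assms(2)] psd_kernelD[OF assms(1), where n = n and a = a and p = p]]
    by (simp add: sum_distrib_left mult_ac)
qed

text \<open>The kernel is the Gram matrix of the vectors \<open>sqrt (d p) \<epsilon>\<^sub>p\<close>.\<close>

lemma psd_kernel_diagonal:
  fixes d :: "'i \<Rightarrow> real"
  assumes d: "\<And>p. 0 \<le> d p"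
  shows "psd_kernel (\<lambda>p q. if p = q then complex_of_real (d p) else 0)"
  unfolding psd_kernel_def
proof (intro allI)
  fix n and p :: "nat \<Rightarrow> 'i" and a
  define v where "v l = (a l * complex_of_real (sqrt (d (p l)))) *\<^sub>C ell2_basis (p l)" for l
  have "cinner (v k) (v l) = cnj (a k) * (if p k = p l then complex_of_real (d (p k)) else 0) * a l" for k l
    using d by (simp add: v_def cinner_scaleC_left cinner_scaleC_right cinner_basis ell2_coeff_basis
        flip: of_real_mult)
  then have "cinner (\<Sum>l<n. v l) (\<Sum>l<n. v l)
      = (\<Sum>k<n. \<Sum>l<n. cnj (a k) * (if p k = p l then complex_of_real (d (p k)) else 0) * a l)"
    by (simp only: cinner_sum_left) (simp only: cinner_sum_right)
  then show "(\<Sum>k<n. \<Sum>l<n. cnj (a k) * (if p k = p l then complex_of_real (d (p k)) else 0) * a l) \<in> \<real>\<^sub>\<ge>\<^sub>0"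
    by (metis cinner_self nonneg_Reals_of_real_iff zero_le_power2)
qed

section \<open>Column contractions\<close>

text \<open>The operators \<open>D 0, D 1, \<dots>\<close> stacked in a column form a contraction from \<open>H\<close> into the countable
Hilbert sum of copies of \<open>H\<close>.\<close>

definition column_contraction :: "(nat \<Rightarrow> 'h::complex_hilbert_space \<Rightarrow> 'h) \<Rightarrow> bool" where
  "column_contraction D \<longleftrightarrow> (\<forall>N \<xi>. (\<Sum>m<N. (norm (D m \<xi>))\<^sup>2) \<le> (norm \<xi>)\<^sup>2)"

lemma column_contractionD:
  "column_contraction D \<Longrightarrow> (\<Sum>m<N. (norm (D m \<xi>))\<^sup>2) \<le> (norm \<xi>)\<^sup>2"
  by (simp add: column_contraction_def)

lemma column_contraction_sqrt:
  assumes "column_contraction D"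
  shows "L2_set (\<lambda>m. norm (D m \<xi>)) {..<N} \<le> norm \<xi>"
  unfolding L2_set_def
  using real_sqrt_le_mono[OF column_contractionD[OF assms, of \<xi> N]] by simp

lemma column_contraction_partial_sum:
  fixes x :: "'h::complex_hilbert_space \<Rightarrow>\<^sub>L 'h"
  assumes D: "column_contraction D" and E: "column_contraction E"
  shows "(\<Sum>m<N. cmod (cinner (D m \<xi>) (x (E m \<eta>)))) \<le> norm x * norm \<xi> * norm \<eta>"
proof -
  have "(\<Sum>m<N. cmod (cinner (D m \<xi>) (x (E m \<eta>)))) \<le> (\<Sum>m<N. norm x * (\<bar>norm (D m \<xi>)\<bar> * \<bar>norm (E m \<eta>)\<bar>))"
    by (rule sum_mono) (use norm_cinner_blinfun_le in \<open>simp add: mult.assoc[symmetric]\<close>)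
  also have "\<dots> = norm x * (\<Sum>m<N. \<bar>norm (D m \<xi>)\<bar> * \<bar>norm (E m \<eta>)\<bar>)"
    by (rule sum_distrib_left[symmetric])
  also have "\<dots> \<le> norm x * (L2_set (\<lambda>m. norm (D m \<xi>)) {..<N} * L2_set (\<lambda>m. norm (E m \<eta>)) {..<N})"
    by (intro mult_left_mono L2_set_mult_ineq) auto
  also have "\<dots> \<le> norm x * (norm \<xi> * norm \<eta>)"
    by (intro mult_left_mono mult_mono column_contraction_sqrt D E) (auto simp: L2_set_nonneg)
  finally show ?thesis by (simp add: mult.assoc)
qed

lemma column_contraction_summable:
  fixes x :: "'h::complex_hilbert_space \<Rightarrow>\<^sub>L 'h"
  assumes D: "column_contraction D" and E: "column_contraction E"
  shows "summable (\<lambda>m. cmod (cinner (D m \<xi>) (x (E m \<eta>))))"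
    and "summable (\<lambda>m. cinner (D m \<xi>) (x (E m \<eta>)))"
    and "cmod (\<Sum>m. cinner (D m \<xi>) (x (E m \<eta>))) \<le> norm x * norm \<xi> * norm \<eta>"
proof -
  show *: "summable (\<lambda>m. cmod (cinner (D m \<xi>) (x (E m \<eta>))))"
    by (rule bounded_imp_summable[OF _ column_contraction_partial_sum[OF D E, where N = "Suc _", unfolded lessThan_Suc_atMost]]) simp
  show "summable (\<lambda>m. cinner (D m \<xi>) (x (E m \<eta>)))"
    by (rule summable_norm_cancel[OF *])
  have "cmod (\<Sum>m. cinner (D m \<xi>) (x (E m \<eta>))) \<le> (\<Sum>m. cmod (cinner (D m \<xi>) (x (E m \<eta>))))"
    by (rule summable_norm[OF *])
  also have "\<dots> \<le> norm x * norm \<xi> * norm \<eta>"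
    by (rule suminf_le_const[OF * column_contraction_partial_sum[OF D E]])
  finally show "cmod (\<Sum>m. cinner (D m \<xi>) (x (E m \<eta>))) \<le> norm x * norm \<xi> * norm \<eta>" .
qed

definition diagonal_op :: "('a \<Rightarrow> complex) \<Rightarrow> 'a ell2 \<Rightarrow> 'a ell2" where
  "diagonal_op f \<xi> = Abs_ell2 (\<lambda>u. f u * ell2_coeff \<xi> u)"

lemma ell2_coeff_diagonal_op:
  assumes "\<And>u. cmod (f u) \<le> 1"
  shows "ell2_coeff (diagonal_op f \<xi>) u = f u * ell2_coeff \<xi> u"
proof -
  have "(\<lambda>u. (cmod (f u * ell2_coeff \<xi> u))\<^sup>2) summable_on UNIV"
    by (rule summable_on_comparison_test[OF ell2_coeff_summable[of \<xi>]])
      (use assms in \<open>auto simp: norm_mult intro!: power_mono mult_left_le_one_le\<close>)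
  then show ?thesis by (simp add: diagonal_op_def Abs_ell2_inverse)
qed

lemma diagonal_op_linear:
  assumes f: "\<And>u. cmod (f u) \<le> 1"
  shows "diagonal_op f (\<xi> + \<eta>) = diagonal_op f \<xi> + diagonal_op f \<eta>"
    and "diagonal_op f (a *\<^sub>C \<xi>) = a *\<^sub>C diagonal_op f \<xi>"
    and "diagonal_op f (ell2_basis t) = f t *\<^sub>C ell2_basis t"
  by (rule ell2_eqI, simp add: ell2_coeff_diagonal_op[of f, OF f] plus_ell2.rep_eq scaleC_ell2.rep_eq
      distrib_left mult_ac ell2_coeff_basis)+

text \<open>Interchange the finite sum over \<open>m\<close> with the sum over the coordinates.\<close>

lemma column_contraction_diagonal_op:
  fixes c :: "nat \<Rightarrow> 'a \<Rightarrow> complex"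
  assumes c: "\<And>N u. (\<Sum>m<N. (cmod (c m u))\<^sup>2) \<le> 1"
  shows "cmod (c m u) \<le> 1" and "column_contraction (\<lambda>m. diagonal_op (c m))"
proof -
  show c1: "cmod (c m u) \<le> 1" for m u
  proof -
    have "(cmod (c m u))\<^sup>2 \<le> (\<Sum>m<Suc m. (cmod (c m u))\<^sup>2)"
      by (rule member_le_sum) auto
    with c[of u "Suc m"] have "(cmod (c m u))\<^sup>2 \<le> 1\<^sup>2" by simp
    then show ?thesis by (rule power2_le_imp_le) simp
  qed
  show "column_contraction (\<lambda>m. diagonal_op (c m))"
    unfolding column_contraction_def
  proof (intro allI)
    fix N and \<xi> :: "'a ell2"
    let ?x = "ell2_coeff \<xi>"
    have norm_diag: "((\<lambda>u. (cmod (c m u))\<^sup>2 * (cmod (?x u))\<^sup>2) has_sum (norm (diagonal_op (c m) \<xi>))\<^sup>2) UNIV" for m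
      using has_sum_infsum[OF ell2_coeff_summable[of "diagonal_op (c m) \<xi>"]]
      by (simp add: norm_ell2_sq ell2_coeff_diagonal_op[of "c m", OF c1] norm_mult power_mult_distrib)
    have "((\<lambda>u. \<Sum>m<N. (cmod (c m u))\<^sup>2 * (cmod (?x u))\<^sup>2) has_sum
        (\<Sum>m<N. (norm (diagonal_op (c m) \<xi>))\<^sup>2)) UNIV"
      by (induction N) (auto intro: has_sum_add norm_diag)
    moreover have "((\<lambda>u. (cmod (?x u))\<^sup>2) has_sum (norm \<xi>)\<^sup>2) UNIV"
      unfolding norm_ell2_sq by (rule has_sum_infsum[OF ell2_coeff_summable])
    moreover have "(\<Sum>m<N. (cmod (c m u))\<^sup>2 * (cmod (?x u))\<^sup>2) \<le> (cmod (?x u))\<^sup>2" for u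
      using mult_right_mono[OF c[of u N], of "(cmod (?x u))\<^sup>2"] by (simp add: sum_distrib_right)
    ultimately show "(\<Sum>m<N. (norm (diagonal_op (c m) \<xi>))\<^sup>2) \<le> (norm \<xi>)\<^sup>2"
      by (rule has_sum_mono)
  qed
qed

section \<open>Schur multipliers\<close>

definition schur_multiplier :: "('a \<Rightarrow> 'a \<Rightarrow> complex) \<Rightarrow> bool" where
  "schur_multiplier b \<longleftrightarrow>
    (\<forall>x\<in>bounded_ops. \<exists>y\<in>bounded_ops. \<forall>u t. matrix_entry y u t = b u t * matrix_entry x u t)"

text \<open>The matrix entries determine the operator, so the choice is unique for a Schur multiplier.\<close>

definition schur_product ::
  "('a \<Rightarrow> 'a \<Rightarrow> complex) \<Rightarrow> ('a ell2 \<Rightarrow>\<^sub>L 'a ell2) \<Rightarrow> ('a ell2 \<Rightarrow>\<^sub>L 'a ell2)" where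
  "schur_product b x = (SOME y. y \<in> bounded_ops \<and> (\<forall>u t. matrix_entry y u t = b u t * matrix_entry x u t))"

lemma schur_product:
  assumes "schur_multiplier b" "x \<in> bounded_ops"
  shows "schur_product b x \<in> bounded_ops" and "matrix_entry (schur_product b x) u t = b u t * matrix_entry x u t"
proof -
  have "\<exists>y. y \<in> bounded_ops \<and> (\<forall>u t. matrix_entry y u t = b u t * matrix_entry x u t)"
    using assms by (auto simp: schur_multiplier_def)
  from someI_ex[OF this]
  show "schur_product b x \<in> bounded_ops" "matrix_entry (schur_product b x) u t = b u t * matrix_entry x u t"
    unfolding schur_product_def by auto
qed

text \<open>For finitely supported vectors \<open>f\<close> and \<open>g\<close> only the finitely many rows in the support of \<open>f\<close>
matter; with the factors \<open>c\<close> for these rows, the entrywise product has the quadratic form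
\<open>\<Sum>\<^sub>m \<langle>D\<^sub>m f, x D\<^sub>m g\<rangle>\<close>, which the Cauchy-Schwarz inequality bounds by \<open>\<parallel>x\<parallel> \<parallel>f\<parallel> \<parallel>g\<parallel>\<close>.  The blocks
off the diagonal are not positive themselves; their factorization uses the two families \<open>D i\<close> and
\<open>D j\<close> that come from one decomposition of the full kernel.\<close>

lemma psd_block_schur_multiplier:
  fixes K :: "'i \<times> 'g \<Rightarrow> 'i \<times> 'g \<Rightarrow> complex"
  assumes K: "psd_kernel K" and diag: "\<And>p. Re (K p p) \<le> 1"
  shows "schur_multiplier (\<lambda>u t. K (i, u) (j, t))"
  unfolding schur_multiplier_def
proof (intro ballI)
  fix x :: "'g ell2 \<Rightarrow>\<^sub>L 'g ell2" assume x: "x \<in> bounded_ops"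
  have "cmod (\<Sum>u\<in>F. \<Sum>t\<in>E. cnj (a u) * (K (i, u) (j, t) * matrix_entry x u t) * b t)
      \<le> norm x * sqrt (\<Sum>u\<in>F. (cmod (a u))\<^sup>2) * sqrt (\<Sum>t\<in>E. (cmod (b t))\<^sup>2)"
    if FE: "finite F" "finite E" for F E a b
  proof -
    have countable: "countable (Pair i ` F)" using FE by (intro countable_finite) auto
    obtain c where c: "\<forall>N p. (\<Sum>m<N. (cmod (c m p))\<^sup>2) \<le> Re (K p p)"
      and sums: "\<forall>p\<in>Pair i ` F. \<forall>q. (\<lambda>m. cnj (c m p) * c m q) sums K p q"
      by (rule psd_kernel_countable_decomposition[OF K countable])
    define f where "f = (\<Sum>u\<in>F. a u *\<^sub>C ell2_basis u)"
    define g where "g = (\<Sum>t\<in>E. b t *\<^sub>C ell2_basis t)"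
    define D where "D k m = diagonal_op (\<lambda>u. c m (k, u))" for k m
    have c1: "(\<Sum>m<N. (cmod (c m p))\<^sup>2) \<le> 1" for N p
      using c diag[of p] order_trans by blast
    have le1: "cmod (c m p) \<le> 1" for m p
    using column_contraction_diagonal_op(1)[of c, OF c1] .
    have D: "column_contraction (D k)" for k
      unfolding D_def by (rule column_contraction_diagonal_op(2)) (rule c1)
    have Df: "D k m (\<Sum>u\<in>G. a u *\<^sub>C ell2_basis u) = (\<Sum>u\<in>G. (c m (k, u) * a u) *\<^sub>C ell2_basis u)"
      if "finite G" for k m a G
      unfolding D_def using that
      by (intro ell2_eqI) (simp add: ell2_coeff_diagonal_op le1 ell2_coeff_finite_combination)
    have "(\<lambda>m. cnj (a u) * (cnj (c m (i, u)) * c m (j, t)) * (matrix_entry x u t * b t))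
        sums (cnj (a u) * K (i, u) (j, t) * (matrix_entry x u t * b t))" if "u \<in> F" for u t
      using that sums by (intro sums_mult sums_mult2) auto
    then have "(\<lambda>m. \<Sum>u\<in>F. \<Sum>t\<in>E. cnj (a u) * (cnj (c m (i, u)) * c m (j, t)) * (matrix_entry x u t * b t))
        sums (\<Sum>u\<in>F. \<Sum>t\<in>E. cnj (a u) * K (i, u) (j, t) * (matrix_entry x u t * b t))"
      by (intro sums_sum)
    also have "(\<lambda>m. \<Sum>u\<in>F. \<Sum>t\<in>E. cnj (a u) * (cnj (c m (i, u)) * c m (j, t)) * (matrix_entry x u t * b t))
        = (\<lambda>m. cinner (D i m f) (x (D j m g)))"
      unfolding f_def g_def by (simp add: Df FE cinner_finite_combinations[OF x] mult_ac)
    finally have "(\<Sum>u\<in>F. \<Sum>t\<in>E. cnj (a u) * (K (i, u) (j, t) * matrix_entry x u t) * b t)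
        = (\<Sum>m. cinner (D i m f) (x (D j m g)))"
      by (simp add: sums_iff mult_ac)
    moreover have "norm f = sqrt (\<Sum>u\<in>F. (cmod (a u))\<^sup>2)" "norm g = sqrt (\<Sum>t\<in>E. (cmod (b t))\<^sup>2)"
      unfolding f_def g_def using FE by (simp_all add: norm_sq_finite_combination[symmetric])
    ultimately show ?thesis
      using column_contraction_summable(3)[OF D D, of i f x j g] by simp
  qed
  then show "\<exists>y\<in>bounded_ops. \<forall>u t. matrix_entry y u t = K (i, u) (j, t) * matrix_entry x u t"
    by (rule bounded_matrix_operator[of "norm x" "\<lambda>u t. K (i, u) (j, t) * matrix_entry x u t", rotated]) auto
qed

text \<open>Both sides are bounded and sesquilinear in \<open>\<xi>\<close> and \<open>\<eta>\<close>, so that they agree as soon as they agree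
on basis vectors.  The support condition falls on \<open>\<xi>\<close> because the decomposition of the kernel is
exact in the chosen rows, for all columns.  The index set must be countable for \<open>UNIV \<times> S\<close> to be so.\<close>

lemma psd_block_factorization:
  fixes K :: "'i::countable \<times> 'g \<Rightarrow> 'i \<times> 'g \<Rightarrow> complex"
  assumes K: "psd_kernel K" and diag: "\<And>p. Re (K p p) \<le> 1" and S: "countable S"
  obtains D :: "'i \<Rightarrow> nat \<Rightarrow> 'g ell2 \<Rightarrow> 'g ell2"
  where "\<forall>i. column_contraction (D i)"
    and "\<forall>x\<in>bounded_ops. \<forall>\<xi>. (\<forall>t. t \<notin> S \<longrightarrow> ell2_coeff \<xi> t = 0) \<longrightarrow>
      (\<forall>\<eta> i j. (\<lambda>m. cinner (D i m \<xi>) (blinfun_apply x (D j m \<eta>))) sums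
        cinner \<xi> (schur_product (\<lambda>u t. K (i, u) (j, t)) x \<eta>))"
proof -
  have countable: "countable ((UNIV :: 'i set) \<times> S)" using S by auto
  obtain c where c: "\<forall>N p. (\<Sum>m<N. (cmod (c m p))\<^sup>2) \<le> Re (K p p)"
    and sums: "\<forall>p\<in>UNIV \<times> S. \<forall>q. (\<lambda>m. cnj (c m p) * c m q) sums K p q"
    by (rule psd_kernel_countable_decomposition[OF K countable])
  define D where "D k m = diagonal_op (\<lambda>u. c m (k, u))" for k m
  have c1: "(\<Sum>m<N. (cmod (c m p))\<^sup>2) \<le> 1" for N p
    using c diag[of p] order_trans by blast
  have le1: "cmod (c m p) \<le> 1" for m p
    using column_contraction_diagonal_op(1)[of c, OF c1] .
  have D: "column_contraction (D k)" for k
    unfolding D_def by (rule column_contraction_diagonal_op(2)) (rule c1)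
  note D_linear = diagonal_op_linear[of "\<lambda>u. c _ (_, u)", OF le1, folded D_def]
  show ?thesis
  proof (rule that[of D]; intro allI ballI impI)
    show "column_contraction (D i)" for i by (rule D)
  next
    fix x :: "'g ell2 \<Rightarrow>\<^sub>L 'g ell2" and \<xi> \<eta> i j
    assume x: "x \<in> bounded_ops" and \<xi>: "\<forall>t. t \<notin> S \<longrightarrow> ell2_coeff \<xi> t = 0"
    let ?y = "schur_product (\<lambda>u t. K (i, u) (j, t)) x"
    note y = schur_product[OF psd_block_schur_multiplier[OF K diag, of i j] x]
    define L where "L \<xi> \<eta> = (\<Sum>m. cinner (D i m \<xi>) (x (D j m \<eta>)))" for \<xi> \<eta>
    note summ = column_contraction_summable(2)[OF D[of i] D[of j], where x = x]
    note bound = column_contraction_summable(3)[OF D[of i] D[of j], where x = x, folded L_def]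
    have L_right: "L \<xi> (\<eta> + \<eta>') = L \<xi> \<eta> + L \<xi> \<eta>'" "L \<xi> (a *\<^sub>C \<eta>) = a * L \<xi> \<eta>" for \<xi> \<eta> \<eta>' a
      unfolding L_def
      by (simp_all add: D_linear blinfun.add_right bounded_opsD[OF x] cinner_add_right cinner_scaleC_right
          suminf_add suminf_mult summ)
    have L_left: "L (\<xi> + \<xi>') \<eta> = L \<xi> \<eta> + L \<xi>' \<eta>" "L (a *\<^sub>C \<xi>) \<eta> = cnj a * L \<xi> \<eta>" for \<xi> \<eta> \<xi>' a
      unfolding L_def
      by (simp_all add: D_linear cinner_add_left cinner_scaleC_left suminf_add suminf_mult summ)
    have basis: "L (ell2_basis u) \<eta> = cinner (ell2_basis u) (?y \<eta>)" if "u \<in> S" for u \<eta>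
    proof (rule bounded_functional_eq_on_support[where S = UNIV and F = "L (ell2_basis u)"
        and G = "\<lambda>\<eta>. cinner (ell2_basis u) (?y \<eta>)" and C = "norm x" and D = "norm ?y"])
      fix t
      have "(\<lambda>m. cnj (c m (i, u)) * c m (j, t) * matrix_entry x u t) sums (K (i, u) (j, t) * matrix_entry x u t)"
        using that sums by (intro sums_mult2) auto
      then show "L (ell2_basis u) (ell2_basis t) = cinner (ell2_basis u) (?y (ell2_basis t))"
        unfolding L_def
        by (simp add: D_linear cinner_scaleC_left cinner_scaleC_right bounded_opsD[OF x] cinner_basis
            matrix_entry_def[symmetric] y(2) sums_iff mult_ac)
    next
      show "cmod (L (ell2_basis u) f) \<le> norm x * norm f" for f
        using bound[of "ell2_basis u" f] by simp
      show "cmod (cinner (ell2_basis u) (?y f)) \<le> norm ?y * norm f" for f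
        using norm_cinner_blinfun_le[of "ell2_basis u" ?y f] by simp
    qed (auto simp: L_right cinner_add_right cinner_scaleC_right blinfun.add_right bounded_opsD[OF y(1)])
    have "cnj (L \<xi> \<eta>) = cnj (cinner \<xi> (?y \<eta>))"
    proof (rule bounded_functional_eq_on_support[where S = S and F = "\<lambda>\<xi>. cnj (L \<xi> \<eta>)"
        and G = "\<lambda>\<xi>. cnj (cinner \<xi> (?y \<eta>))" and C = "norm x * norm \<eta>" and D = "norm (?y \<eta>)"])
      show "cmod (cnj (L f \<eta>)) \<le> norm x * norm \<eta> * norm f" for f
        using bound[of f \<eta>] by (simp add: mult_ac)
      show "cmod (cnj (cinner f (?y \<eta>))) \<le> norm (?y \<eta>) * norm f" for f
        using norm_cinner_le[of f "?y \<eta>"] by (simp add: mult_ac)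
    qed (use \<xi> in \<open>auto simp: L_left cinner_add_left cinner_scaleC_left basis\<close>)
    then have "L \<xi> \<eta> = cinner \<xi> (?y \<eta>)" by simp
    then show "(\<lambda>m. cinner (D i m \<xi>) (x (D j m \<eta>))) sums cinner \<xi> (?y \<eta>)"
      using summ[of \<xi> \<eta>] by (simp add: L_def sums_iff)
  qed
qed

section \<open>Twisted translations\<close>

lemma blinfun_apply_scaleC_op [simp]: "blinfun_apply (scaleC_op c a) \<xi> = c *\<^sub>C a \<xi>"
  by (simp add: scaleC_op.rep_eq)

lemma bounded_opsI:
  fixes a :: "'h::complex_hilbert_space \<Rightarrow>\<^sub>L 'h"
  shows "(\<And>c \<xi>. a (c *\<^sub>C \<xi>) = c *\<^sub>C a \<xi>) \<Longrightarrow> a \<in> bounded_ops"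
  by (simp add: bounded_ops_def)

lemma bounded_ops_intros [intro]:
  "0 \<in> bounded_ops" "id_blinfun \<in> bounded_ops"
  "a \<in> bounded_ops \<Longrightarrow> b \<in> bounded_ops \<Longrightarrow> a + b \<in> bounded_ops"
  "a \<in> bounded_ops \<Longrightarrow> scaleC_op c a \<in> bounded_ops"
  "a \<in> bounded_ops \<Longrightarrow> b \<in> bounded_ops \<Longrightarrow> a o\<^sub>L b \<in> bounded_ops"
  by (auto simp: bounded_ops_def blinfun.add_left scaleC_add_right scaleC_scaleC mult.commute)

lemma matrix_entry_simps [simp]:
  "matrix_entry (a + b) u t = matrix_entry a u t + matrix_entry b u t" "matrix_entry (scaleC_op c a) u t = c * matrix_entry a u t"
  "matrix_entry 0 u t = 0" "matrix_entry id_blinfun u t = (if u = t then 1 else 0)"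
  by (auto simp: matrix_entry_def blinfun.add_left plus_ell2.rep_eq scaleC_ell2.rep_eq zero_ell2.rep_eq ell2_coeff_basis)

lemma two_cocycleD:
  assumes "two_cocycle \<sigma>"
  shows "cmod (\<sigma> s t) = 1" "\<sigma> s t * \<sigma> (s + t) r = \<sigma> t r * \<sigma> s (t + r)" "\<sigma> s 0 = 1" "\<sigma> 0 s = 1"
  using assms by (auto simp: two_cocycle_def)

lemma two_cocycle_cnj_mult:
  assumes "two_cocycle \<sigma>"
  shows "cnj (\<sigma> s t) * \<sigma> s t = 1" "\<sigma> s t * cnj (\<sigma> s t) = 1"
  using two_cocycleD(1)[OF assms, of s t] complex_norm_square[of "\<sigma> s t"] by (simp_all add: mult.commute)

lemma twisted_translation_bounded_op:
  assumes "two_cocycle \<sigma>"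
  shows "twisted_translation \<sigma> s \<in> bounded_ops"
  by (intro bounded_opsI ell2_eqI) (simp add: twisted_translation_coeff[OF assms] scaleC_ell2.rep_eq mult_ac)

lemma matrix_entry_twisted_translation:
  assumes "two_cocycle \<sigma>"
  shows "matrix_entry (twisted_translation \<sigma> s) u t = (if u = s + t then \<sigma> s t else 0)"
  by (simp add: matrix_entry_def twisted_translation_basis[OF assms] scaleC_ell2.rep_eq ell2_coeff_basis)

section \<open>The commutation theorem\<close>

text \<open>The operator \<open>\<epsilon>\<^sub>t \<mapsto> \<sigma>(t, r) \<epsilon>\<^sub>t\<^sub>r\<close>; the cocycle identity says exactly that it commutes with all twisted
left translations.\<close>

definition right_translation :: "('g::group_add \<Rightarrow> 'g \<Rightarrow> complex) \<Rightarrow> 'g \<Rightarrow> ('g ell2 \<Rightarrow>\<^sub>L 'g ell2)" where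
  "right_translation \<sigma> r =
    (SOME x. x \<in> bounded_ops \<and> (\<forall>u t. matrix_entry x u t = (if u = t + r then \<sigma> t r else 0)))"

text \<open>In each row and each column the matrix has one nonzero entry, of modulus one, so the
Cauchy-Schwarz inequality bounds its finite sections by \<open>1\<close>.\<close>

lemma right_translation:
  fixes \<sigma> :: "'g::group_add \<Rightarrow> 'g \<Rightarrow> complex"
  assumes \<sigma>: "two_cocycle \<sigma>"
  shows "right_translation \<sigma> r \<in> bounded_ops"
    and "matrix_entry (right_translation \<sigma> r) u t = (if u = t + r then \<sigma> t r else 0)"
proof -
  have "cmod (\<Sum>u\<in>F. \<Sum>t\<in>E. cnj (a u) * (if u = t + r then \<sigma> t r else 0) * c t)
      \<le> 1 * sqrt (\<Sum>u\<in>F. (cmod (a u))\<^sup>2) * sqrt (\<Sum>t\<in>E. (cmod (c t))\<^sup>2)"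
    if FE: "finite F" "finite E" for F E :: "'g set" and a c
  proof -
    define A where "A t = (if t + r \<in> F then cmod (a (t + r)) else 0)" for t
    have "(\<Sum>u\<in>F. \<Sum>t\<in>E. cnj (a u) * (if u = t + r then \<sigma> t r else 0) * c t)
        = (\<Sum>t\<in>E. \<Sum>u\<in>F. if u = t + r then cnj (a u) * \<sigma> t r * c t else 0)"
      by (subst sum.swap) (auto intro!: sum.cong)
    also have "\<dots> = (\<Sum>t\<in>E. if t + r \<in> F then cnj (a (t + r)) * \<sigma> t r * c t else 0)"
      using FE by simp
    finally have "cmod (\<Sum>u\<in>F. \<Sum>t\<in>E. cnj (a u) * (if u = t + r then \<sigma> t r else 0) * c t)
        \<le> (\<Sum>t\<in>E. \<bar>A t\<bar> * \<bar>cmod (c t)\<bar>)"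
      by (simp only:) (rule order_trans[OF norm_sum sum_mono],
          simp add: A_def norm_mult two_cocycleD(1)[OF \<sigma>])
    also have "\<dots> \<le> L2_set A E * L2_set (\<lambda>t. cmod (c t)) E"
      by (rule L2_set_mult_ineq)
    also have "\<dots> \<le> L2_set (\<lambda>u. cmod (a u)) F * L2_set (\<lambda>t. cmod (c t)) E"
    proof (rule mult_right_mono[OF _ L2_set_nonneg])
      have "(\<Sum>t\<in>E. (A t)\<^sup>2) = (\<Sum>t\<in>{t\<in>E. t + r \<in> F}. (cmod (a (t + r)))\<^sup>2)"
        by (subst sum.inter_filter[OF FE(2)]) (auto simp: A_def intro!: sum.cong)
      also have "\<dots> = (\<Sum>u\<in>(\<lambda>t. t + r) ` {t\<in>E. t + r \<in> F}. (cmod (a u))\<^sup>2)"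
        by (subst sum.reindex) (auto simp: inj_on_def)
      also have "\<dots> \<le> (\<Sum>u\<in>F. (cmod (a u))\<^sup>2)"
        using FE by (intro sum_mono2) auto
      finally show "L2_set A E \<le> L2_set (\<lambda>u. cmod (a u)) F"
        by (simp add: L2_set_def)
    qed
    finally show ?thesis by (simp add: L2_set_def)
  qed
  then obtain x where "x \<in> bounded_ops" "\<And>u t. matrix_entry x u t = (if u = t + r then \<sigma> t r else 0)"
    by (rule bounded_matrix_operator[of 1 "\<lambda>u t. if u = t + r then \<sigma> t r else 0", rotated]) auto
  then have "\<exists>x. x \<in> bounded_ops \<and> (\<forall>u t. matrix_entry x u t = (if u = t + r then \<sigma> t r else 0))"
    by blast
  from someI_ex[OF this]
  show "right_translation \<sigma> r \<in> bounded_ops"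
    "matrix_entry (right_translation \<sigma> r) u t = (if u = t + r then \<sigma> t r else 0)"
    unfolding right_translation_def by blast+
qed

lemma right_translation_apply:
  assumes \<sigma>: "two_cocycle \<sigma>"
  shows "right_translation \<sigma> r (ell2_basis t) = \<sigma> t r *\<^sub>C ell2_basis (t + r)"
    and "ell2_coeff (right_translation \<sigma> r f) u = \<sigma> (u - r) r * ell2_coeff f (u - r)"
proof -
  note \<rho> = right_translation[OF \<sigma>, of r]
  show "right_translation \<sigma> r (ell2_basis t) = \<sigma> t r *\<^sub>C ell2_basis (t + r)"
    by (rule ell2_eqI) (simp add: matrix_entry_def[symmetric] \<rho> scaleC_ell2.rep_eq ell2_coeff_basis)
  have "u = t + r \<longleftrightarrow> t = u - r" for t by (auto simp: algebra_simps)
  then have "((\<lambda>t. if t = u - r then ell2_coeff f t * \<sigma> t r else 0) has_sum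
      ell2_coeff (right_translation \<sigma> r f) u) UNIV"
    using matrix_entry_has_sum[OF \<rho>(1), of f u] by (simp add: \<rho>(2) if_distrib cong: if_cong)
  moreover have "((\<lambda>t. if t = u - r then ell2_coeff f t * \<sigma> t r else 0) has_sum
      (ell2_coeff f (u - r) * \<sigma> (u - r) r)) UNIV"
    by (rule has_sum_finite_neutralI[where B = "{u - r}"]) auto
  ultimately show "ell2_coeff (right_translation \<sigma> r f) u = \<sigma> (u - r) r * ell2_coeff f (u - r)"
    by (simp add: has_sum_unique mult.commute)
qed

text \<open>The operators whose matrix is that of a twisted convolution \<open>\<Sum> f(s) \<lambda>\<^sub>s\<close>, where \<open>f\<close> is the column at
the unit.\<close>

definition twisted_convolutions :: "('g::group_add \<Rightarrow> 'g \<Rightarrow> complex) \<Rightarrow> ('g ell2 \<Rightarrow>\<^sub>L 'g ell2) set" where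
  "twisted_convolutions \<sigma> =
    {x \<in> bounded_ops. \<forall>u t. matrix_entry x u t = \<sigma> (u - t) t * matrix_entry x (u - t) 0}"

lemma twisted_convolutionsI:
  assumes "x \<in> bounded_ops" "\<And>u t. matrix_entry x u t = \<sigma> (u - t) t * matrix_entry x (u - t) 0"
  shows "x \<in> twisted_convolutions \<sigma>"
  using assms unfolding twisted_convolutions_def by blast

lemma twisted_convolutionsD:
  assumes "x \<in> twisted_convolutions \<sigma>"
  shows "x \<in> bounded_ops" "matrix_entry x u t = \<sigma> (u - t) t * matrix_entry x (u - t) 0"
  using assms unfolding twisted_convolutions_def by blast+

text \<open>Comparing matrix entries, \<open>x\<close> commutes with the translation by \<open>r\<close> if and only if
\<open>\<sigma>(u r\<inverse>, r) x(u r\<inverse>, t) = \<sigma>(t, r) x(u, t r)\<close> for all \<open>u\<close> and \<open>t\<close>.  For \<open>t = e\<close> this is the defining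
equation of a twisted convolution; conversely that equation implies the general case by the
cocycle identity.\<close>

lemma twisted_convolutions_eq_commutant:
  assumes \<sigma>: "two_cocycle \<sigma>"
  shows "twisted_convolutions \<sigma> = commutant (range (right_translation \<sigma>))"
proof -
  note \<rho> = right_translation[OF \<sigma>] right_translation_apply[OF \<sigma>]
  have commute_iff: "right_translation \<sigma> r o\<^sub>L x = x o\<^sub>L right_translation \<sigma> r \<longleftrightarrow>
      (\<forall>u t. \<sigma> (u - r) r * matrix_entry x (u - r) t = \<sigma> t r * matrix_entry x u (t + r))"
    if x: "x \<in> bounded_ops" for x r
  proof -
    have "right_translation \<sigma> r o\<^sub>L x = x o\<^sub>L right_translation \<sigma> r \<longleftrightarrow>
        (\<forall>u t. matrix_entry (right_translation \<sigma> r o\<^sub>L x) u t = matrix_entry (x o\<^sub>L right_translation \<sigma> r) u t)"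
      using bounded_ops_eqI[of "right_translation \<sigma> r o\<^sub>L x" "x o\<^sub>L right_translation \<sigma> r"] x \<rho>(1)
      by auto
    then show ?thesis
      by (simp add: matrix_entry_def \<rho> bounded_opsD[OF x] scaleC_ell2.rep_eq)
  qed
  show ?thesis
  proof (intro equalityI subsetI)
    fix x assume "x \<in> twisted_convolutions \<sigma>"
    note x = twisted_convolutionsD(1)[OF this] and conv = twisted_convolutionsD(2)[OF this]
    have "\<sigma> (u - r) r * matrix_entry x (u - r) t = \<sigma> t r * matrix_entry x u (t + r)" for r u t
    proof -
      let ?s = "u - r - t"
      have "u - (t + r) = ?s" by (simp add: diff_add_eq_diff_diff_swap)
      then have "matrix_entry x (u - r) t = \<sigma> ?s t * matrix_entry x ?s 0" "matrix_entry x u (t + r) = \<sigma> ?s (t + r) * matrix_entry x ?s 0"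
        using conv[of "u - r" t] conv[of u "t + r"] by simp_all
      then show ?thesis
        using two_cocycleD(2)[OF \<sigma>, of ?s t r] by (simp add: mult_ac)
    qed
    then show "x \<in> commutant (range (right_translation \<sigma>))"
      using x commute_iff by (auto simp: commutant_def)
  next
    fix x assume "x \<in> commutant (range (right_translation \<sigma>))"
    then have x: "x \<in> bounded_ops" and "\<And>r. right_translation \<sigma> r o\<^sub>L x = x o\<^sub>L right_translation \<sigma> r"
      by (auto simp: commutant_def)
    then have "\<sigma> (u - r) r * matrix_entry x (u - r) 0 = \<sigma> 0 r * matrix_entry x u (0 + r)" for u r
      using commute_iff by blast
    then show "x \<in> twisted_convolutions \<sigma>"
      using x by (intro twisted_convolutionsI) (simp_all add: two_cocycleD(3,4)[OF \<sigma>])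
  qed
qed

text \<open>The phases match by the cocycle identity for \<open>t u\<inverse>, u t\<inverse>, t\<close>.\<close>

lemma adj_op_twisted_convolution:
  assumes \<sigma>: "two_cocycle \<sigma>" and x: "x \<in> twisted_convolutions \<sigma>"
  shows "adj_op x \<in> twisted_convolutions \<sigma>"
proof -
  note bx = twisted_convolutionsD(1)[OF x] and conv = twisted_convolutionsD(2)[OF x]
  note adj = adj_op_ell2[OF bx]
  have "matrix_entry (adj_op x) u t = \<sigma> (u - t) t * matrix_entry (adj_op x) (u - t) 0" for u t
  proof -
    let ?s = "t - u"
    have s: "?s + (u - t) = 0" "u - t + t = u"
      using right_minus[of ?s] by simp_all
    have "\<sigma> ?s (u - t) = \<sigma> (u - t) t * \<sigma> ?s u"
      using two_cocycleD(2)[OF \<sigma>, of ?s "u - t" t] unfolding s by (simp add: two_cocycleD(4)[OF \<sigma>])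
    then have "\<sigma> (u - t) t * cnj (\<sigma> ?s (u - t)) = cnj (\<sigma> ?s u)"
      using two_cocycle_cnj_mult[OF \<sigma>, of "u - t" t] by (simp add: mult.assoc[symmetric])
    moreover have "matrix_entry (adj_op x) (u - t) 0 = cnj (\<sigma> ?s (u - t)) * cnj (matrix_entry x ?s 0)"
      using conv[of 0 "u - t"] by (simp add: adj)
    ultimately show ?thesis
      by (simp only: adj conv[of t u] complex_cnj_mult mult.assoc[symmetric])
  qed
  with adj(2) show ?thesis by (rule twisted_convolutionsI)
qed

lemma twisted_translation_convolution:
  assumes \<sigma>: "two_cocycle \<sigma>"
  shows "twisted_translation \<sigma> s \<in> twisted_convolutions \<sigma>"
proof -
  have "u = s + t \<longleftrightarrow> u - t = s" for u t by (auto simp: diff_eq_eq)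
  then show ?thesis
    by (auto simp: twisted_convolutions_def twisted_translation_bounded_op[OF \<sigma>]
        matrix_entry_twisted_translation[OF \<sigma>] two_cocycleD(3,4)[OF \<sigma>])
qed

text \<open>This is the heart of the commutation theorem.  The matrix of \<open>y\<close> has the form
\<open>\<sigma>(t, t\<inverse> u) g(t\<inverse> u)\<close>, since \<open>y\<close> commutes with left translations and \<open>\<epsilon>\<^sub>t\<close> is the translate of the unit
vector.  Both products have entries that are sums over the group, and the substitution of
\<open>u r\<inverse> t\<close> for \<open>r\<close> takes one sum to the other, term by term.\<close>

lemma twisted_convolution_commutes:
  fixes \<sigma> :: "'g::group_add \<Rightarrow> 'g \<Rightarrow> complex"
  assumes \<sigma>: "two_cocycle \<sigma>" and x: "x \<in> twisted_convolutions \<sigma>"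
    and y: "y \<in> commutant (range (twisted_translation \<sigma>))"
  shows "x o\<^sub>L y = y o\<^sub>L x"
proof -
  note bx = twisted_convolutionsD(1)[OF x] and conv = twisted_convolutionsD(2)[OF x]
  have y': "y \<in> bounded_ops" and "\<And>s. twisted_translation \<sigma> s o\<^sub>L y = y o\<^sub>L twisted_translation \<sigma> s"
    using y by (auto simp: commutant_def)
  then have "twisted_translation \<sigma> t (y (ell2_basis 0)) = y (twisted_translation \<sigma> t (ell2_basis 0))" for t
    by (metis blinfun_apply_blinfun_compose)
  moreover have "twisted_translation \<sigma> t (ell2_basis 0) = ell2_basis t" for t
    by (simp add: twisted_translation_basis[OF \<sigma>] two_cocycleD(3,4)[OF \<sigma>])
  ultimately have conv_y: "matrix_entry y u t = \<sigma> t (- t + u) * matrix_entry y (- t + u) 0" for u t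
    unfolding matrix_entry_def by (metis twisted_translation_coeff[OF \<sigma>])
  have "matrix_entry (x o\<^sub>L y) u t = matrix_entry (y o\<^sub>L x) u t" for u t
  proof -
    have xy: "((\<lambda>r. matrix_entry y r t * matrix_entry x u r) has_sum matrix_entry (x o\<^sub>L y) u t) UNIV"
      using matrix_entry_has_sum[OF bx, of "y (ell2_basis t)" u] by (simp add: matrix_entry_def)
    have yx: "((\<lambda>r. matrix_entry x r t * matrix_entry y u r) has_sum matrix_entry (y o\<^sub>L x) u t) UNIV"
      using matrix_entry_has_sum[OF y', of "x (ell2_basis t)" u] by (simp add: matrix_entry_def)
    have summand: "matrix_entry x (u - r + t) t * matrix_entry y u (u - r + t) = matrix_entry y r t * matrix_entry x u r" for r
    proof -
      have e: "u - r + t - t = u - r" "- (u - r + t) + u = - t + r" "t + (- t + r) = r"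
        by (simp_all add: minus_add add.assoc)
      have "matrix_entry x (u - r + t) t = \<sigma> (u - r) t * matrix_entry x (u - r) 0"
        using conv[of "u - r + t" t] by (simp only: e)
      moreover have "matrix_entry y u (u - r + t) = \<sigma> (u - r + t) (- t + r) * matrix_entry y (- t + r) 0"
        using conv_y[of u "u - r + t"] by (simp only: e)
      moreover have "\<sigma> (u - r) t * \<sigma> (u - r + t) (- t + r) = \<sigma> t (- t + r) * \<sigma> (u - r) r"
        using two_cocycleD(2)[OF \<sigma>, of "u - r" t "- t + r"] by (simp only: e)
      ultimately show ?thesis
        by (subst conv[of u r], subst conv_y[of r t]) algebra
    qed
    have bij: "bij_betw (\<lambda>r. u - r + t) UNIV UNIV"
      by (rule bij_betwI[where g = "\<lambda>r. t - r + u"]) (auto simp: diff_add_eq_diff_diff_swap)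
    have "((\<lambda>r. matrix_entry y r t * matrix_entry x u r) has_sum matrix_entry (y o\<^sub>L x) u t) UNIV"
      using yx has_sum_reindex_bij_betw[OF bij, of "\<lambda>r. matrix_entry x r t * matrix_entry y u r"] by (simp add: summand)
    with xy show ?thesis by (rule has_sum_unique)
  qed
  then show ?thesis
    using bx y' by (intro bounded_ops_eqI) auto
qed

lemma commutant_antimono: "S \<subseteq> T \<Longrightarrow> commutant T \<subseteq> commutant S"
  by (auto simp: commutant_def)

lemma double_commutant_superset: "S \<subseteq> bounded_ops \<Longrightarrow> S \<subseteq> commutant (commutant S)"
  by (auto simp: commutant_def)

lemma von_neumann_algebra_twisted_convolutions:
  assumes \<sigma>: "two_cocycle \<sigma>"
  shows "von_neumann_algebra (twisted_convolutions \<sigma>)"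
proof -
  let ?A = "twisted_convolutions \<sigma>" and ?R = "range (right_translation \<sigma>)"
  have A: "?A \<subseteq> bounded_ops" by (auto simp: twisted_convolutions_def)
  have "?R \<subseteq> commutant ?A"
    using double_commutant_superset[of ?R] right_translation(1)[OF \<sigma>]
    by (auto simp: twisted_convolutions_eq_commutant[OF \<sigma>])
  then have "commutant (commutant ?A) \<subseteq> ?A"
    using commutant_antimono[of ?R "commutant ?A"] twisted_convolutions_eq_commutant[OF \<sigma>] by simp
  with A double_commutant_superset[OF A] show ?thesis
    using adj_op_twisted_convolution[OF \<sigma>] by (auto simp: von_neumann_algebra_def)
qed

text \<open>Twisted convolutions form a von Neumann algebra, being a selfadjoint commutant, and they contain the
translations.  Conversely they commute with everything that commutes with the translations, so they
lie in the double commutant of any set containing the translations.\<close>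

theorem VN_eq_twisted_convolutions:
  assumes \<sigma>: "two_cocycle \<sigma>"
  shows "VN \<sigma> = twisted_convolutions \<sigma>"
proof
  show "VN \<sigma> \<subseteq> twisted_convolutions \<sigma>"
    unfolding VN_def
    by (rule hull_minimal)
      (use twisted_translation_convolution[OF \<sigma>] von_neumann_algebra_twisted_convolutions[OF \<sigma>] in auto)
  show "twisted_convolutions \<sigma> \<subseteq> VN \<sigma>"
    unfolding VN_def hull_def
  proof (intro subsetI InterI, clarify)
    fix x N assume x: "x \<in> twisted_convolutions \<sigma>" and N: "von_neumann_algebra N"
      and sub: "range (twisted_translation \<sigma>) \<subseteq> N"
    have "x \<in> commutant (commutant N)"
      using x commutant_antimono[OF sub] twisted_convolution_commutes[OF \<sigma> x]
      by (auto simp: commutant_def[of "commutant N"] twisted_convolutions_def)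
    with N show "x \<in> N" by (simp add: von_neumann_algebra_def)
  qed
qed

lemma VN_I:
  assumes "two_cocycle \<sigma>" "x \<in> bounded_ops" "\<And>u t. matrix_entry x u t = \<sigma> (u - t) t * matrix_entry x (u - t) 0"
  shows "x \<in> VN \<sigma>"
  using twisted_convolutionsI[OF assms(2,3)] by (simp add: VN_eq_twisted_convolutions[OF assms(1)])

lemma VN_matrix_entry:
  assumes "two_cocycle \<sigma>" "x \<in> VN \<sigma>"
  shows "matrix_entry x u t = \<sigma> (u - t) t * matrix_entry x (u - t) 0"
  using assms(2) by (intro twisted_convolutionsD) (simp add: VN_eq_twisted_convolutions[OF assms(1)])

lemma VN_closed:
  assumes \<sigma>: "two_cocycle \<sigma>"
  shows "twisted_translation \<sigma> s \<in> VN \<sigma>" "0 \<in> VN \<sigma>" "id_blinfun \<in> VN \<sigma>"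
    and "x \<in> VN \<sigma> \<Longrightarrow> y \<in> VN \<sigma> \<Longrightarrow> x + y \<in> VN \<sigma>"
    and "x \<in> VN \<sigma> \<Longrightarrow> scaleC_op c x \<in> VN \<sigma>"
    and "x \<in> VN \<sigma> \<Longrightarrow> adj_op x \<in> VN \<sigma>"
    and "x \<in> VN \<sigma> \<Longrightarrow> x \<in> bounded_ops"
proof -
  show "twisted_translation \<sigma> s \<in> VN \<sigma>"
    using twisted_translation_convolution[OF \<sigma>] by (simp add: VN_eq_twisted_convolutions[OF \<sigma>])
  show "x \<in> VN \<sigma> \<Longrightarrow> adj_op x \<in> VN \<sigma>"
    using adj_op_twisted_convolution[OF \<sigma>] by (simp add: VN_eq_twisted_convolutions[OF \<sigma>])
  show bounded: "x \<in> VN \<sigma> \<Longrightarrow> x \<in> bounded_ops" for x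
    using twisted_convolutionsD(1) by (auto simp: VN_eq_twisted_convolutions[OF \<sigma>])
  show "id_blinfun \<in> VN \<sigma>" by (rule VN_I[OF \<sigma>]) (auto simp: two_cocycleD(3,4)[OF \<sigma>])
  show "0 \<in> VN \<sigma>" by (rule VN_I[OF \<sigma>]) auto
  show "x + y \<in> VN \<sigma>" if xy: "x \<in> VN \<sigma>" "y \<in> VN \<sigma>"
  proof (rule VN_I[OF \<sigma>])
    show "x + y \<in> bounded_ops" using xy[THEN bounded] by (rule bounded_ops_intros)
    show "matrix_entry (x + y) u t = \<sigma> (u - t) t * matrix_entry (x + y) (u - t) 0" for u t
      unfolding matrix_entry_simps distrib_left
      by (rule arg_cong2[where f = "(+)"]; rule VN_matrix_entry[OF \<sigma>]) (fact xy)+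
  qed
  show "scaleC_op c x \<in> VN \<sigma>" if x: "x \<in> VN \<sigma>"
  proof (rule VN_I[OF \<sigma>])
    show "scaleC_op c x \<in> bounded_ops" using bounded[OF x] by (rule bounded_ops_intros)
    show "matrix_entry (scaleC_op c x) u t = \<sigma> (u - t) t * matrix_entry (scaleC_op c x) (u - t) 0" for u t
      unfolding matrix_entry_simps by (subst VN_matrix_entry[OF \<sigma> x, of u t]) (rule mult.left_commute)
  qed
qed

text \<open>A factor that depends on \<open>u t\<inverse>\<close> only is absorbed by the function \<open>f\<close> in
  \<open>x\<^sub>u\<^sub>t = \<sigma>(u t\<inverse>, t) f(u t\<inverse>)\<close>.\<close>

lemma schur_product_VN:
  assumes \<sigma>: "two_cocycle \<sigma>" and \<kappa>: "schur_multiplier (\<lambda>u t. \<kappa> (u - t))" and x: "x \<in> VN \<sigma>"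
  shows "schur_product (\<lambda>u t. \<kappa> (u - t)) x \<in> VN \<sigma>"
proof -
  note bx = VN_closed(7)[OF \<sigma> x] and conv = VN_matrix_entry[OF \<sigma> x]
  note S = schur_product[OF \<kappa> bx]
  show ?thesis
  proof (rule VN_I[OF \<sigma> S(1)])
    show "matrix_entry (schur_product (\<lambda>u t. \<kappa> (u - t)) x) u t
        = \<sigma> (u - t) t * matrix_entry (schur_product (\<lambda>u t. \<kappa> (u - t)) x) (u - t) 0" for u t
      unfolding S(2) by (subst conv[of u t]) (simp only: diff_0_right mult.left_commute)
  qed
qed

lemma schur_product_twisted_translation:
  assumes \<sigma>: "two_cocycle \<sigma>" and \<kappa>: "schur_multiplier (\<lambda>u t. \<kappa> (u - t))"
  shows "schur_product (\<lambda>u t. \<kappa> (u - t)) (twisted_translation \<sigma> s) = scaleC_op (\<kappa> s) (twisted_translation \<sigma> s)"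
proof (rule bounded_ops_eqI)
  note S = schur_product[OF \<kappa> twisted_translation_bounded_op[OF \<sigma>]]
  show "schur_product (\<lambda>u t. \<kappa> (u - t)) (twisted_translation \<sigma> s) \<in> bounded_ops" by (rule S)
  show "scaleC_op (\<kappa> s) (twisted_translation \<sigma> s) \<in> bounded_ops"
    by (intro bounded_ops_intros twisted_translation_bounded_op \<sigma>)
  show "matrix_entry (schur_product (\<lambda>u t. \<kappa> (u - t)) (twisted_translation \<sigma> s)) u t =
      matrix_entry (scaleC_op (\<kappa> s) (twisted_translation \<sigma> s)) u t" for u t
    by (simp add: S matrix_entry_twisted_translation[OF \<sigma>])
qed

lemma linear_map_schur_product:
  assumes \<sigma>: "two_cocycle \<sigma>" and \<kappa>: "schur_multiplier (\<lambda>u t. \<kappa> (u - t))"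
  shows "linear_map (VN \<sigma>) (schur_product (\<lambda>u t. \<kappa> (u - t)))"
proof -
  note S = schur_product[OF \<kappa>]
  show ?thesis
    unfolding linear_map_def
  proof (intro conjI ballI allI)
    fix x y c assume xy: "x \<in> VN \<sigma>" "y \<in> VN \<sigma>"
    note b = xy[THEN VN_closed(7)[OF \<sigma>]]
    show "schur_product (\<lambda>u t. \<kappa> (u - t)) (x + y)
        = schur_product (\<lambda>u t. \<kappa> (u - t)) x + schur_product (\<lambda>u t. \<kappa> (u - t)) y"
      by (rule bounded_ops_eqI) (simp_all add: S b bounded_ops_intros distrib_left)
  next
    fix c x assume x: "x \<in> VN \<sigma>"
    note b = VN_closed(7)[OF \<sigma> x]
    show "schur_product (\<lambda>u t. \<kappa> (u - t)) (scaleC_op c x) = scaleC_op c (schur_product (\<lambda>u t. \<kappa> (u - t)) x)"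
      by (rule bounded_ops_eqI) (simp_all add: S b bounded_ops_intros)
  qed (rule schur_product_VN[OF \<sigma> \<kappa>])
qed

section \<open>Maps that factor through column contractions\<close>

text \<open>A local form of a Kraus decomposition \<open>T x = \<Sum>\<^sub>m D\<^sub>m\<^sup>* x E\<^sub>m\<close>: the operators may depend on a set \<open>X\<close>
of vectors.  For an uncountable group a single sequence need not serve all vectors, but each of the
properties below involves countably many vectors only.\<close>

definition factors_through ::
  "('h \<Rightarrow>\<^sub>L 'h) set \<Rightarrow> (('h \<Rightarrow>\<^sub>L 'h) \<Rightarrow> ('h \<Rightarrow>\<^sub>L 'h)) \<Rightarrow> 'h set \<Rightarrow>
    (nat \<Rightarrow> 'h::complex_hilbert_space \<Rightarrow> 'h) \<Rightarrow> (nat \<Rightarrow> 'h \<Rightarrow> 'h) \<Rightarrow> bool" where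
  "factors_through M T X D E \<longleftrightarrow> column_contraction D \<and> column_contraction E \<and>
    (\<forall>x\<in>M. \<forall>\<xi>\<in>X. \<forall>\<eta>. (\<lambda>m. cinner (D m \<xi>) (blinfun_apply x (E m \<eta>))) sums cinner \<xi> (T x \<eta>))"

lemma factors_throughD:
  assumes "factors_through M T X D E"
  shows "column_contraction D" "column_contraction E"
    and "x \<in> M \<Longrightarrow> \<xi> \<in> X \<Longrightarrow> (\<lambda>m. cinner (D m \<xi>) (x (E m \<eta>))) sums cinner \<xi> (T x \<eta>)"
  using assms by (auto simp: factors_through_def)

lemma norm_le_of_factors_through:
  assumes T: "\<And>\<xi>. \<exists>D E. factors_through M T {\<xi>} D E" and x: "x \<in> M"
  shows "norm (T x) \<le> norm x"
proof (rule norm_blinfun_le_of_cinner)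
  fix \<xi> \<eta>
  obtain D E where f: "factors_through M T {\<xi>} D E" using T by blast
  show "cmod (cinner \<xi> (T x \<eta>)) \<le> norm x * norm \<xi> * norm \<eta>"
    using factors_throughD(3)[OF f x, of \<xi> \<eta>]
      column_contraction_summable(3)[OF factors_throughD(1,2)[OF f], of \<xi> x \<eta>]
    by (simp add: sums_iff)
qed simp

definition weak_star_subbasis :: "('h::complex_hilbert_space \<Rightarrow>\<^sub>L 'h) set \<Rightarrow> ('h \<Rightarrow>\<^sub>L 'h) set set" where
  "weak_star_subbasis M = {{a \<in> M. (\<Sum>n. cinner (\<xi> n) (blinfun_apply a (\<eta> n))) \<in> U} | \<xi> \<eta> U.
      square_summable_seq \<xi> \<and> square_summable_seq \<eta> \<and> open U}"

lemma weak_star_subbasisI: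
  "square_summable_seq \<xi> \<Longrightarrow> square_summable_seq \<eta> \<Longrightarrow> open U \<Longrightarrow>
    {a \<in> M. (\<Sum>n. cinner (\<xi> n) (blinfun_apply a (\<eta> n))) \<in> U} \<in> weak_star_subbasis M"
  unfolding weak_star_subbasis_def by blast

lemma weak_star_topology_eq: "weak_star_topology M = topology_generated_by (weak_star_subbasis M)"
  unfolding weak_star_topology_def weak_star_subbasis_def ..

lemma Union_weak_star_subbasis: "\<Union>(weak_star_subbasis M) = M"
proof
  show "\<Union>(weak_star_subbasis M) \<subseteq> M" unfolding weak_star_subbasis_def by blast
  have "square_summable_seq (\<lambda>_. 0)" by (simp add: square_summable_seq_def)
  from weak_star_subbasisI[OF this this open_UNIV, of M]
  show "M \<subseteq> \<Union>(weak_star_subbasis M)" by auto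
qed

text \<open>The pairs \<open>(n, m)\<close> are enumerated by \<^const>\<open>prod_decode\<close>, because the functionals that define the
weak* topology are indexed by natural numbers.\<close>

lemma square_summable_column:
  assumes D: "column_contraction D" and \<xi>: "square_summable_seq \<xi>"
  shows "square_summable_seq (\<lambda>k. D (snd (prod_decode k)) (\<xi> (fst (prod_decode k))))"
  unfolding square_summable_seq_def
proof (rule bounded_imp_summable)
  fix N
  define f where "f p = (norm (D (snd p) (\<xi> (fst p))))\<^sup>2" for p
  obtain A where A: "prod_decode ` {..N} \<subseteq> {..<A} \<times> {..<A}"
  proof -
    have "finite (fst ` prod_decode ` {..N} \<union> snd ` prod_decode ` {..N})" by simp
    then obtain A where "\<forall>i\<in>fst ` prod_decode ` {..N} \<union> snd ` prod_decode ` {..N}. i < A"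
      by (metis finite_nat_set_iff_bounded)
    then have "prod_decode k \<in> {..<A} \<times> {..<A}" if "k \<le> N" for k
      using that by (simp add: mem_Times_iff)
    then show ?thesis by (intro that[of A]) (metis atMost_iff image_subsetI)
  qed
  have "(\<Sum>k\<le>N. f (prod_decode k)) = (\<Sum>p\<in>prod_decode ` {..N}. f p)"
    by (subst sum.reindex) (auto intro: inj_prod_decode)
  also have "\<dots> \<le> (\<Sum>p\<in>{..<A} \<times> {..<A}. f p)"
    by (rule sum_mono2[OF _ A]) (auto simp: f_def)
  also have "\<dots> = (\<Sum>n<A. \<Sum>m<A. f (n, m))"
    by (simp add: sum.cartesian_product)
  also have "\<dots> \<le> (\<Sum>n<A. (norm (\<xi> n))\<^sup>2)"
    by (rule sum_mono) (simp add: f_def column_contractionD[OF D])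
  also have "\<dots> \<le> (\<Sum>n. (norm (\<xi> n))\<^sup>2)"
    using \<xi> by (intro sum_le_suminf) (auto simp: square_summable_seq_def)
  finally show "(\<Sum>k\<le>N. (norm (D (snd (prod_decode k)) (\<xi> (fst (prod_decode k)))))\<^sup>2)
      \<le> (\<Sum>n. (norm (\<xi> n))\<^sup>2)"
    by (simp add: f_def)
qed simp

text \<open>The functional \<open>x \<mapsto> \<Sum>\<^sub>n \<langle>\<xi>\<^sub>n, T x \<eta>\<^sub>n\<rangle>\<close> equals \<open>x \<mapsto> \<Sum>\<^sub>n \<Sum>\<^sub>m \<langle>D\<^sub>m \<xi>\<^sub>n, x E\<^sub>m \<eta>\<^sub>n\<rangle>\<close>.  The double sequences
\<open>D\<^sub>m \<xi>\<^sub>n\<close> and \<open>E\<^sub>m \<eta>\<^sub>n\<close> are square-summable, so this is again one of the functionals defining the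
topology, and preimages of subbasic sets are subbasic.\<close>

lemma weak_star_continuous_of_factors_through:
  fixes T :: "('h::complex_hilbert_space \<Rightarrow>\<^sub>L 'h) \<Rightarrow> ('h \<Rightarrow>\<^sub>L 'h)"
  assumes T: "\<And>X. countable X \<Longrightarrow> \<exists>D E. factors_through M T X D E" and into: "\<And>x. x \<in> M \<Longrightarrow> T x \<in> M"
  shows "weak_star_continuous M T"
proof -
  have normal: "\<exists>\<xi>' \<eta>'. square_summable_seq \<xi>' \<and> square_summable_seq \<eta>' \<and>
      (\<forall>x\<in>M. (\<Sum>n. cinner (\<xi> n) (T x (\<eta> n))) = (\<Sum>n. cinner (\<xi>' n) (x (\<eta>' n))))"
    if \<xi>: "square_summable_seq \<xi>" and \<eta>: "square_summable_seq \<eta>" for \<xi> \<eta> :: "nat \<Rightarrow> 'h"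
  proof -
    obtain D E where f: "factors_through M T (range \<xi>) D E" using T[of "range \<xi>"] by auto
    note D = factors_throughD(1)[OF f] and E = factors_throughD(2)[OF f]
    define \<xi>' where "\<xi>' k = D (snd (prod_decode k)) (\<xi> (fst (prod_decode k)))" for k
    define \<eta>' where "\<eta>' k = E (snd (prod_decode k)) (\<eta> (fst (prod_decode k)))" for k
    have sq: "square_summable_seq \<xi>'" "square_summable_seq \<eta>'"
      unfolding \<xi>'_def \<eta>'_def using square_summable_column[OF D \<xi>] square_summable_column[OF E \<eta>] .
    have "(\<Sum>n. cinner (\<xi> n) (T x (\<eta> n))) = (\<Sum>n. cinner (\<xi>' n) (x (\<eta>' n)))" if x: "x \<in> M" for x
    proof -
      define g where "g p = cinner (D (snd p) (\<xi> (fst p))) (x (E (snd p) (\<eta> (fst p))))" for p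
      have g: "cinner (\<xi>' k) (x (\<eta>' k)) = g (prod_decode k)" for k
        by (simp add: g_def \<xi>'_def \<eta>'_def)
      have "summable (\<lambda>k. norm x * ((norm (\<xi>' k))\<^sup>2 + (norm (\<eta>' k))\<^sup>2))"
        using sq by (intro summable_mult summable_add) (auto simp: square_summable_seq_def)
      then have abs: "summable (\<lambda>k. norm (g (prod_decode k)))"
      proof (rule summable_comparison_test')
        fix k
        have "norm (\<xi>' k) * norm (\<eta>' k) \<le> (norm (\<xi>' k))\<^sup>2 + (norm (\<eta>' k))\<^sup>2"
          using sum_squares_bound[of "norm (\<xi>' k)" "norm (\<eta>' k)"]
            mult_nonneg_nonneg[OF norm_ge_zero[of "\<xi>' k"] norm_ge_zero[of "\<eta>' k"]] by linarith
        then have "norm x * (norm (\<xi>' k) * norm (\<eta>' k)) \<le> norm x * ((norm (\<xi>' k))\<^sup>2 + (norm (\<eta>' k))\<^sup>2)"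
          by (intro mult_left_mono) auto
        then show "norm (norm (g (prod_decode k))) \<le> norm x * ((norm (\<xi>' k))\<^sup>2 + (norm (\<eta>' k))\<^sup>2)"
          using norm_cinner_blinfun_le[of "\<xi>' k" x "\<eta>' k"] unfolding g[symmetric] mult.assoc by simp
      qed
      have "((\<lambda>k. g (prod_decode k)) has_sum (\<Sum>k. g (prod_decode k))) UNIV"
        by (rule norm_summable_imp_has_sum[OF abs summable_sums[OF summable_norm_cancel[OF abs]]])
      then have "(g has_sum (\<Sum>k. g (prod_decode k))) (UNIV \<times> UNIV)"
        using has_sum_reindex_bij_betw[OF bij_prod_decode, of g] by simp
      moreover have "((\<lambda>m. g (n, m)) has_sum cinner (\<xi> n) (T x (\<eta> n))) UNIV" for n
        unfolding g_def fst_conv snd_conv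
        by (rule norm_summable_imp_has_sum[OF column_contraction_summable(1)[OF D E]
              factors_throughD(3)[OF f x]]) simp
      ultimately have "((\<lambda>n. cinner (\<xi> n) (T x (\<eta> n))) has_sum (\<Sum>k. g (prod_decode k))) UNIV"
        by (rule has_sum_SigmaD)
      then show ?thesis
        unfolding g by (rule sums_unique[OF has_sum_imp_sums, symmetric])
    qed
    with sq show ?thesis by blast
  qed
  show ?thesis
    unfolding weak_star_continuous_def weak_star_topology_eq
  proof (rule continuous_on_generated_topo)
    fix V
    assume "V \<in> weak_star_subbasis M"
    then obtain \<xi> \<eta> U where V: "V = {a \<in> M. (\<Sum>n. cinner (\<xi> n) (blinfun_apply a (\<eta> n))) \<in> U}"
      and sq: "square_summable_seq \<xi>" "square_summable_seq \<eta>" "open U"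
      unfolding weak_star_subbasis_def by blast
    obtain \<xi>' \<eta>' where sq': "square_summable_seq \<xi>'" "square_summable_seq \<eta>'"
      and eq: "\<forall>x\<in>M. (\<Sum>n. cinner (\<xi> n) (T x (\<eta> n))) = (\<Sum>n. cinner (\<xi>' n) (x (\<eta>' n)))"
      using normal[OF sq(1,2)] by blast
    have "T -` V \<inter> M = {a \<in> M. (\<Sum>n. cinner (\<xi>' n) (blinfun_apply a (\<eta>' n))) \<in> U}"
      using eq into by (auto simp: V)
    then have "T -` V \<inter> M \<in> weak_star_subbasis M"
      using weak_star_subbasisI[OF sq' sq(3)] by simp
    then show "openin (topology_generated_by (weak_star_subbasis M))
        (T -` V \<inter> topspace (topology_generated_by (weak_star_subbasis M)))"
      unfolding topology_generated_by_topspace Union_weak_star_subbasis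
      by (rule topology_generated_by_Basis)
  next
    show "T ` topspace (topology_generated_by (weak_star_subbasis M)) \<subseteq> \<Union>(weak_star_subbasis M)"
      using into by (auto simp: topology_generated_by_topspace Union_weak_star_subbasis)
  qed
qed

text \<open>With \<open>D = E\<close> the quadratic form of the image matrix at \<open>\<xi>\<close> is a convergent sum over \<open>m\<close> of the
quadratic form of the original matrix at \<open>D\<^sub>m \<xi>\<close>.\<close>

lemma completely_positive_of_factors_through:
  fixes T :: "('h::complex_hilbert_space \<Rightarrow>\<^sub>L 'h) \<Rightarrow> ('h \<Rightarrow>\<^sub>L 'h)"
  assumes T: "\<And>X. countable X \<Longrightarrow> \<exists>D. factors_through M T X D D" and lin: "linear_map M T"
  shows "completely_positive M T"
  unfolding completely_positive_def
proof (intro conjI allI impI lin)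
  fix n a
  assume "matrix_over n M a \<and> matrix_positive n a"
  then have a: "\<And>i j. i < n \<Longrightarrow> j < n \<Longrightarrow> a i j \<in> M" and pos: "matrix_positive n a"
    by (auto simp: matrix_over_def)
  show "matrix_positive n (\<lambda>i j. T (a i j))"
    unfolding matrix_positive_def
  proof
    fix \<xi> :: "nat \<Rightarrow> 'h"
    obtain D where f: "factors_through M T (range \<xi>) D D" using T[of "range \<xi>"] by auto
    have "(\<lambda>m. \<Sum>i<n. \<Sum>j<n. cinner (D m (\<xi> i)) (a i j (D m (\<xi> j)))) sums
        (\<Sum>i<n. \<Sum>j<n. cinner (\<xi> i) (T (a i j) (\<xi> j)))"
      by (intro sums_sum factors_throughD(3)[OF f] a) auto
    then have "(\<lambda>N. \<Sum>m<N. \<Sum>i<n. \<Sum>j<n. cinner (D m (\<xi> i)) (a i j (D m (\<xi> j))))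
        \<longlonglongrightarrow> (\<Sum>i<n. \<Sum>j<n. cinner (\<xi> i) (T (a i j) (\<xi> j)))"
      by (simp add: sums_def)
    moreover have "(\<Sum>m<N. \<Sum>i<n. \<Sum>j<n. cinner (D m (\<xi> i)) (a i j (D m (\<xi> j)))) \<in> \<real>\<^sub>\<ge>\<^sub>0" for N
    proof (induction N)
      case (Suc N)
      have "(\<Sum>i<n. \<Sum>j<n. cinner (D N (\<xi> i)) (a i j (D N (\<xi> j)))) \<in> \<real>\<^sub>\<ge>\<^sub>0"
        using pos[unfolded matrix_positive_def, rule_format, of "\<lambda>i. D N (\<xi> i)"]
        by (simp add: cinner_sum_right)
      with Suc show ?case by simp
    qed simp
    ultimately show "(\<Sum>i<n. cinner (\<xi> i) (\<Sum>j<n. T (a i j) (\<xi> j))) \<in> \<real>\<^sub>\<ge>\<^sub>0"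
      unfolding cinner_sum_right
      by (rule closed_sequentially[OF closed_nonneg_Reals_complex, rotated])
  qed
qed

section \<open>Unital completely positive maps\<close>

text \<open>This is nonnegativity of the diagonal after elimination of the row \<open>p\<close>.\<close>

lemma psd_kernel_cauchy_schwarz:
  assumes K: "psd_kernel K"
  shows "(cmod (K p q))\<^sup>2 \<le> Re (K p p) * Re (K q q)"
proof (cases "K p p = 0")
  case True
  then show ?thesis using psd_kernel_zero_row[OF K True, of q] by simp
next
  case False
  define r where "r = Re (K p p)"
  have r: "K p p = of_real r" "0 \<le> r"
    using psd_kernel_diag[OF K, of p] by (auto simp: r_def complex_nonneg_Reals_iff complex_eq_iff)
  have "0 \<le> Re (K q q - K q p * K p q / K p p)"
    using psd_kernel_diag[OF psd_kernel_schur_complement[OF K, of p], of q]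
    by (simp add: complex_nonneg_Reals_iff)
  also have "K q p * K p q = of_real ((cmod (K p q))\<^sup>2)"
    unfolding psd_kernel_hermitian[OF K, of q p] complex_norm_square by (rule mult.commute)
  also have "Re (K q q - of_real ((cmod (K p q))\<^sup>2) / K p p) = Re (K q q) - (cmod (K p q))\<^sup>2 / r"
    by (simp add: r flip: of_real_divide)
  finally have "(cmod (K p q))\<^sup>2 / r \<le> Re (K q q)" by simp
  then show ?thesis
    using False r by (simp add: field_simps)
qed

definition matrix_form ::
  "nat \<Rightarrow> (nat \<Rightarrow> nat \<Rightarrow> ('h::complex_hilbert_space \<Rightarrow>\<^sub>L 'h)) \<Rightarrow> (nat \<Rightarrow> 'h) \<Rightarrow> (nat \<Rightarrow> 'h) \<Rightarrow> complex" where
  "matrix_form n b \<xi> \<eta> = (\<Sum>i<n. \<Sum>j<n. cinner (\<xi> i) (b i j (\<eta> j)))"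

lemma matrix_positive_iff: "matrix_positive n b \<longleftrightarrow> (\<forall>\<xi>. matrix_form n b \<xi> \<xi> \<in> \<real>\<^sub>\<ge>\<^sub>0)"
  by (simp add: matrix_positive_def matrix_form_def cinner_sum_right)

text \<open>The sesquilinear form of a positive operator matrix is itself a positive semidefinite kernel, whose
points are the vectors; this gives access to hermitian symmetry and the Cauchy-Schwarz inequality.\<close>

lemma psd_kernel_matrix_form:
  fixes b :: "nat \<Rightarrow> nat \<Rightarrow> ('h::complex_hilbert_space \<Rightarrow>\<^sub>L 'h)"
  assumes pos: "matrix_positive n b" and b: "\<And>i j. i < n \<Longrightarrow> j < n \<Longrightarrow> b i j \<in> bounded_ops"
  shows "psd_kernel (matrix_form n b)"
  unfolding psd_kernel_def
proof (intro allI)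
  fix N and p :: "nat \<Rightarrow> nat \<Rightarrow> 'h" and a :: "nat \<Rightarrow> complex"
  have "matrix_form n b (\<lambda>i. \<Sum>k<N. a k *\<^sub>C p k i) (\<lambda>i. \<Sum>k<N. a k *\<^sub>C p k i)
      = (\<Sum>i<n. \<Sum>j<n. \<Sum>k<N. \<Sum>l<N. cnj (a k) * cinner (p k i) (b i j (p l j)) * a l)"
    unfolding matrix_form_def
  proof (intro sum.cong refl)
    fix i j assume "i \<in> {..<n}" "j \<in> {..<n}"
    then have "b i j \<in> bounded_ops" using b by simp
    then show "cinner (\<Sum>k<N. a k *\<^sub>C p k i) (b i j (\<Sum>k<N. a k *\<^sub>C p k j))
        = (\<Sum>k<N. \<Sum>l<N. cnj (a k) * cinner (p k i) (b i j (p l j)) * a l)"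
      by (simp only: cinner_sum_left)
        (simp only: blinfun.sum_right cinner_sum_right cinner_scaleC_left cinner_scaleC_right
          bounded_opsD mult_ac)
  qed
  also have "\<dots> = (\<Sum>k<N. \<Sum>l<N. cnj (a k) * matrix_form n b (p k) (p l) * a l)"
  proof -
    have swap: "(\<Sum>j\<in>A. \<Sum>k<N. \<Sum>l<N. h j k l) = (\<Sum>k<N. \<Sum>l<N. \<Sum>j\<in>A. h j k l)"
      for h :: "nat \<Rightarrow> nat \<Rightarrow> nat \<Rightarrow> complex" and A
      by (rule trans[OF sum.swap sum.cong[OF refl sum.swap]])
    have "(\<Sum>i<n. \<Sum>j<n. \<Sum>k<N. \<Sum>l<N. g i j k l) = (\<Sum>k<N. \<Sum>l<N. \<Sum>i<n. \<Sum>j<n. g i j k l)"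
      for g :: "nat \<Rightarrow> nat \<Rightarrow> nat \<Rightarrow> nat \<Rightarrow> complex"
      by (rule trans[OF sum.cong[OF refl swap] swap])
    then show ?thesis
      by (simp only: matrix_form_def sum_distrib_left sum_distrib_right)
  qed
  finally show "(\<Sum>k<N. \<Sum>l<N. cnj (a k) * matrix_form n b (p k) (p l) * a l) \<in> \<real>\<^sub>\<ge>\<^sub>0"
    using pos unfolding matrix_positive_iff by metis
qed

lemma sum_lessThan_add: "(\<Sum>i<m + (n::nat). f i) = (\<Sum>i<m. f i) + (\<Sum>i<n. f (m + i))"
  for f :: "nat \<Rightarrow> 'a::comm_monoid_add"
  by (induction n) (simp_all add: add.assoc)

lemma matrix_norm_bound:
  fixes a :: "nat \<Rightarrow> nat \<Rightarrow> ('h::complex_hilbert_space \<Rightarrow>\<^sub>L 'h)"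
  shows "0 \<le> matrix_norm n a"
    and "L2_set (\<lambda>i. norm (\<Sum>j<n. a i j (\<xi> j))) {..<n} \<le> matrix_norm n a * L2_set (\<lambda>j. norm (\<xi> j)) {..<n}"
proof -
  define V where "V \<xi> = L2_set (\<lambda>i. norm (\<Sum>j<n. a i j (\<xi> j))) {..<n}" for \<xi> :: "nat \<Rightarrow> 'h"
  define L where "L \<xi> = L2_set (\<lambda>j. norm (\<xi> j)) {..<n}" for \<xi> :: "nat \<Rightarrow> 'h"
  define B where "B = {\<xi> :: nat \<Rightarrow> 'h. (\<Sum>j<n. (norm (\<xi> j))\<^sup>2) \<le> 1}"
  have norm_eq: "matrix_norm n a = (SUP \<xi>\<in>B. V \<xi>)"
    by (simp add: matrix_norm_def B_def V_def L2_set_def)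
  have bdd: "bdd_above (V ` B)"
  proof (rule bdd_aboveI2)
    fix \<xi> assume "\<xi> \<in> B"
    then have "L \<xi> \<le> 1" by (simp add: B_def L_def L2_set_def)
    then have le: "norm (\<xi> j) \<le> 1" if "j < n" for j
      using member_le_L2_set[of "{..<n}" j "\<lambda>j. norm (\<xi> j)"] that by (simp add: L_def)
    have "V \<xi> \<le> (\<Sum>i<n. norm (\<Sum>j<n. a i j (\<xi> j)))"
      unfolding V_def by (rule L2_set_le_sum) simp
    also have "\<dots> \<le> (\<Sum>i<n. \<Sum>j<n. norm (a i j))"
    proof (intro sum_mono order_trans[OF norm_sum])
      fix i j assume "j \<in> {..<n}"
      then show "norm (a i j (\<xi> j)) \<le> norm (a i j)"
        using norm_blinfun[of "a i j" "\<xi> j"] mult_left_mono[OF le[of j], of "norm (a i j)"] by simp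
    qed
    finally show "V \<xi> \<le> (\<Sum>i<n. \<Sum>j<n. norm (a i j))" .
  qed
  have upper: "V \<xi> \<le> matrix_norm n a" if "\<xi> \<in> B" for \<xi>
    unfolding norm_eq by (rule cSUP_upper[OF that bdd])
  have "(\<lambda>_. 0) \<in> B" by (simp add: B_def)
  from upper[OF this] show nonneg: "0 \<le> matrix_norm n a" by (simp add: V_def L2_set_nonneg order_trans[OF L2_set_nonneg])
  have "V \<xi> \<le> matrix_norm n a * L \<xi>"
  proof (cases "L \<xi> = 0")
    case True
    then have "\<xi> j = 0" if "j < n" for j using that by (simp add: L_def L2_set_eq_0_iff)
    then show ?thesis using True by (simp add: V_def L2_set_def)
  next
    case False
    define r where "r = L \<xi>"
    have r: "r > 0" using False L2_set_nonneg[of "\<lambda>j. norm (\<xi> j)" "{..<n}"] unfolding r_def L_def by linarith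
    have sq: "(\<Sum>j<n. (norm (\<xi> j))\<^sup>2) = r\<^sup>2"
      by (simp add: r_def L_def L2_set_def sum_nonneg)
    have "(\<lambda>j. inverse r *\<^sub>R \<xi> j) \<in> B"
      using r by (simp add: B_def power_mult_distrib sum_distrib_left[symmetric] sq power_inverse)
    from upper[OF this] have "V (\<lambda>j. inverse r *\<^sub>R \<xi> j) \<le> matrix_norm n a" .
    moreover have "V (\<lambda>j. inverse r *\<^sub>R \<xi> j) = inverse r * V \<xi>"
      using r by (simp add: V_def blinfun.scaleR_right scaleR_sum_right[symmetric] L2_set_right_distrib)
    ultimately show ?thesis using r by (simp add: r_def field_simps)
  qed
  then show "L2_set (\<lambda>i. norm (\<Sum>j<n. a i j (\<xi> j))) {..<n} \<le> matrix_norm n a * L2_set (\<lambda>j. norm (\<xi> j)) {..<n}"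
    by (simp add: V_def L_def)
qed

text \<open>If \<open>R\<close> is the norm of the matrix \<open>a\<close>, then the block matrix with diagonal blocks \<open>R\<close> and
  off-diagonal blocks \<open>a\<close> and \<open>a\<^sup>*\<close> is positive; its image under a unital completely positive
  map is positive, and the Cauchy-Schwarz inequality for the latter bounds the image of \<open>a\<close> by \<open>R\<close>.\<close>

lemma completely_contractive_of_unital:
  fixes T :: "('h::complex_hilbert_space \<Rightarrow>\<^sub>L 'h) \<Rightarrow> ('h \<Rightarrow>\<^sub>L 'h)"
  assumes cp: "completely_positive M T" and unital: "T id_blinfun = id_blinfun"
    and M: "M \<subseteq> bounded_ops" "id_blinfun \<in> M" "\<And>c x. x \<in> M \<Longrightarrow> scaleC_op c x \<in> M"
    and adj: "\<And>x. x \<in> M \<Longrightarrow> \<exists>y\<in>M. \<forall>\<xi> \<eta>. cinner (blinfun_apply y \<xi>) \<eta> = cinner \<xi> (x \<eta>)"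
  shows "completely_contractive M T"
  unfolding completely_contractive_def
proof (intro conjI allI impI)
  show lin: "linear_map M T" using cp by (simp add: completely_positive_def)
  fix n a
  assume a: "matrix_over n M a"
  define R where "R = matrix_norm n a"
  have R: "0 \<le> R" unfolding R_def by (rule matrix_norm_bound)
  define s where "s c = scaleC_op c (id_blinfun :: 'h \<Rightarrow>\<^sub>L 'h)" for c
  have s: "s c \<in> M" "T (s c) = s c" for c
    using M lin unital by (auto simp: s_def linear_map_def)
  have "\<forall>i j. \<exists>y. i < n \<and> j < n \<longrightarrow> y \<in> M \<and> (\<forall>\<xi> \<eta>. cinner (blinfun_apply y \<xi>) \<eta> = cinner \<xi> (a j i \<eta>))"
    using a adj unfolding matrix_over_def by blast
  then obtain a' where a': "\<And>i j. i < n \<Longrightarrow> j < n \<Longrightarrow> a' i j \<in> M"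
    "\<And>i j \<xi> \<eta>. i < n \<Longrightarrow> j < n \<Longrightarrow> cinner (blinfun_apply (a' i j) \<xi>) \<eta> = cinner \<xi> (a j i \<eta>)"
    by metis
  define b where "b k l = (if k < n then if l < n then s (if k = l then complex_of_real R else 0) else a k (l - n)
      else if l < n then a' (k - n) l else s (if k = l then complex_of_real R else 0))" for k l
  have b: "b k l \<in> M" if "k < n + n" "l < n + n" for k l
    using that a a' s by (auto simp: b_def matrix_over_def)
  have form: "matrix_form (n + n) (\<lambda>k l. T' (b k l)) \<xi> \<eta> =
      (\<Sum>i<n. complex_of_real R * cinner (\<xi> i) (\<eta> i)) + (\<Sum>i<n. \<Sum>j<n. cinner (\<xi> i) (T' (a i j) (\<eta> (n + j))))
      + (\<Sum>i<n. \<Sum>j<n. cinner (\<xi> (n + i)) (T' (a' i j) (\<eta> j))) + (\<Sum>i<n. complex_of_real R * cinner (\<xi> (n + i)) (\<eta> (n + i)))"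
    if T': "\<And>c. T' (s c) = s c" for T' :: "('h \<Rightarrow>\<^sub>L 'h) \<Rightarrow> ('h \<Rightarrow>\<^sub>L 'h)" and \<xi> \<eta>
  proof -
    have diag: "cinner v (s (if i = j then complex_of_real R else 0) w) = (if i = j then complex_of_real R * cinner v w else 0)"
      for v w and i j :: nat
      by (simp add: s_def cinner_scaleC_right)
    show ?thesis
      by (simp add: matrix_form_def sum_lessThan_add b_def T' diag sum.distrib)
  qed
  have "matrix_positive (n + n) b"
    unfolding matrix_positive_iff
  proof
    fix \<xi> :: "nat \<Rightarrow> 'h"
    define P where "P = L2_set (\<lambda>i. norm (\<xi> i)) {..<n}"
    define Q where "Q = L2_set (\<lambda>i. norm (\<xi> (n + i))) {..<n}"
    define S where "S = (\<Sum>i<n. \<Sum>j<n. cinner (\<xi> i) (a i j (\<xi> (n + j))))"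
    have "cmod S \<le> (\<Sum>i<n. \<bar>norm (\<xi> i)\<bar> * \<bar>norm (\<Sum>j<n. a i j (\<xi> (n + j)))\<bar>)"
      unfolding S_def cinner_sum_right[symmetric]
      by (rule order_trans[OF norm_sum sum_mono]) (simp add: norm_cinner_le)
    also have "\<dots> \<le> P * L2_set (\<lambda>i. norm (\<Sum>j<n. a i j (\<xi> (n + j)))) {..<n}"
      unfolding P_def by (rule L2_set_mult_ineq)
    also have "\<dots> \<le> P * (R * Q)"
      unfolding R_def P_def Q_def by (intro mult_left_mono matrix_norm_bound L2_set_nonneg)
    finally have S: "cmod S \<le> P * (R * Q)" .
    have "(\<Sum>i<n. \<Sum>j<n. cinner (\<xi> (n + i)) (a' i j (\<xi> j))) = (\<Sum>i<n. \<Sum>j<n. cnj (cinner (\<xi> j) (a j i (\<xi> (n + i)))))"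
    proof (intro sum.cong refl)
      fix i j assume "i \<in> {..<n}" "j \<in> {..<n}"
      then have "cinner (a' i j (\<xi> j)) (\<xi> (n + i)) = cinner (\<xi> j) (a j i (\<xi> (n + i)))"
        by (intro a'(2)) auto
      then show "cinner (\<xi> (n + i)) (a' i j (\<xi> j)) = cnj (cinner (\<xi> j) (a j i (\<xi> (n + i))))"
        by (metis cinner_commute)
    qed
    also have "\<dots> = cnj S"
      by (subst sum.swap) (simp add: S_def)
    finally have S': "(\<Sum>i<n. \<Sum>j<n. cinner (\<xi> (n + i)) (a' i j (\<xi> j))) = cnj S" .
    have sq: "(\<Sum>i<n. complex_of_real R * cinner (\<zeta> i) (\<zeta> i)) = of_real (R * (L2_set (\<lambda>i. norm (\<zeta> i)) {..<n})\<^sup>2)"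
      for \<zeta> :: "nat \<Rightarrow> 'h"
      by (simp add: cinner_self L2_set_def sum_nonneg sum_distrib_left)
    have "matrix_form (n + n) b \<xi> \<xi> = of_real (R * P\<^sup>2) + S + cnj S + of_real (R * Q\<^sup>2)"
      using form[of id \<xi> \<xi>]
      unfolding id_apply S' S_def[symmetric] sq[of \<xi>] sq[of "\<lambda>i. \<xi> (n + i)"] P_def[symmetric] Q_def[symmetric]
      by blast
    also have "\<dots> = of_real (R * P\<^sup>2 + 2 * Re S + R * Q\<^sup>2)"
      using complex_add_cnj[of S] by (simp add: add.assoc)
    finally have "matrix_form (n + n) b \<xi> \<xi> = of_real (R * P\<^sup>2 + 2 * Re S + R * Q\<^sup>2)" .
    moreover have "0 \<le> R * P\<^sup>2 + 2 * Re S + R * Q\<^sup>2"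
    proof -
      have "- Re S \<le> P * (R * Q)" using S abs_Re_le_cmod[of S] by linarith
      moreover have "0 \<le> R * (P - Q)\<^sup>2" using R by simp
      ultimately show ?thesis by (simp add: power2_diff algebra_simps)
    qed
    ultimately show "matrix_form (n + n) b \<xi> \<xi> \<in> \<real>\<^sub>\<ge>\<^sub>0"
      by (simp only: nonneg_Reals_of_real_iff)
  qed
  moreover have "matrix_over (n + n) M b" using b by (simp add: matrix_over_def)
  ultimately have pos: "matrix_positive (n + n) (\<lambda>k l. T (b k l))"
    using cp by (simp add: completely_positive_def)
  have "T (b k l) \<in> bounded_ops" if "k < n + n" "l < n + n" for k l
    using b[OF that] lin M(1) by (auto simp: linear_map_def)
  from psd_kernel_matrix_form[OF pos this] have K: "psd_kernel (matrix_form (n + n) (\<lambda>k l. T (b k l)))" .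
  have bound: "L2_set (\<lambda>i. norm (\<Sum>j<n. T (a i j) (\<eta> j))) {..<n} \<le> R * L2_set (\<lambda>j. norm (\<eta> j)) {..<n}" for \<eta>
  proof -
    define v where "v i = (\<Sum>j<n. T (a i j) (\<eta> j))" for i
    \<comment> \<open>The Cauchy-Schwarz inequality for \<open>(v, 0)\<close> and \<open>(0, \<eta>)\<close>, where \<open>v\<close> is the image of \<open>\<eta>\<close>, reads
      \<open>\<parallel>v\<parallel>\<^sup>4 \<le> R \<parallel>v\<parallel>\<^sup>2 R \<parallel>\<eta>\<parallel>\<^sup>2\<close>.\<close>
    define p where "p i = (if i < n then v i else 0)" for i
    define q where "q i = (if i < n then 0 else \<eta> (i - n))" for i
    define P where "P = L2_set (\<lambda>i. norm (v i)) {..<n}"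
    define Q where "Q = L2_set (\<lambda>i. norm (\<eta> i)) {..<n}"
    have sq: "(\<Sum>i<n. complex_of_real R * cinner (\<zeta> i) (\<zeta> i)) = of_real (R * (L2_set (\<lambda>i. norm (\<zeta> i)) {..<n})\<^sup>2)"
      for \<zeta> :: "nat \<Rightarrow> 'h"
      by (simp add: cinner_self L2_set_def sum_nonneg sum_distrib_left)
    have "matrix_form (n + n) (\<lambda>k l. T (b k l)) p q = (\<Sum>i<n. cinner (v i) (v i))"
      by (simp add: form s p_def q_def cinner_sum_right[symmetric] v_def[symmetric])
    also have "\<dots> = of_real (P\<^sup>2)"
      by (simp add: cinner_self P_def L2_set_def sum_nonneg)
    finally have "matrix_form (n + n) (\<lambda>k l. T (b k l)) p q = of_real (P\<^sup>2)" .
    moreover have "matrix_form (n + n) (\<lambda>k l. T (b k l)) p p = of_real (R * P\<^sup>2)"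
      using sq[of v] by (simp add: form s p_def P_def)
    moreover have "matrix_form (n + n) (\<lambda>k l. T (b k l)) q q = of_real (R * Q\<^sup>2)"
      using sq[of \<eta>] by (simp add: form s q_def Q_def)
    ultimately have "(P\<^sup>2)\<^sup>2 \<le> (R * P\<^sup>2) * (R * Q\<^sup>2)"
      using psd_kernel_cauchy_schwarz[OF K, of p q] by (simp add: norm_power)
    then have "P\<^sup>2 * P\<^sup>2 \<le> P\<^sup>2 * (R * Q)\<^sup>2"
      by (simp add: power2_eq_square mult_ac)
    then have "P\<^sup>2 \<le> (R * Q)\<^sup>2" if "P \<noteq> 0"
      using that by (metis mult_le_cancel_left_pos zero_less_power2)
    moreover have "0 \<le> R * Q" using R by (simp add: Q_def L2_set_nonneg)
    ultimately have "P \<le> R * Q"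
      using power2_le_imp_le[of P "R * Q"] by fastforce
    then show ?thesis by (simp add: P_def Q_def v_def)
  qed
  show "matrix_norm n (\<lambda>i j. T (a i j)) \<le> matrix_norm n a"
    unfolding matrix_norm_def[of n "\<lambda>i j. T (a i j)"]
  proof (rule cSUP_least)
    show "{\<xi> :: nat \<Rightarrow> 'h. (\<Sum>j<n. (norm (\<xi> j))\<^sup>2) \<le> 1} \<noteq> {}"
      by (rule notI, drule equals0D[of _ "\<lambda>_. 0"]) simp
  next
    fix \<xi> assume "\<xi> \<in> {\<xi> :: nat \<Rightarrow> 'h. (\<Sum>j<n. (norm (\<xi> j))\<^sup>2) \<le> 1}"
    then have "R * L2_set (\<lambda>j. norm (\<xi> j)) {..<n} \<le> R * 1"
      using R by (intro mult_left_mono) (auto simp: L2_set_def)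
    with bound[of \<xi>] show "sqrt (\<Sum>i<n. (norm (\<Sum>j<n. T (a i j) (\<xi> j)))\<^sup>2) \<le> matrix_norm n a"
      by (simp add: L2_set_def R_def)
  qed
qed

section \<open>Operator matrices\<close>

lemma mat2_apply_pair: "blinfun_apply (mat2 a b c d) v = (a (fst v) + b (snd v), c (fst v) + d (snd v))"
  by (cases v) (simp add: mat2_apply)

lemma mat2_add: "mat2 a b c d + mat2 a' b' c' d' = mat2 (a + a') (b + b') (c + c') (d + d')"
  by (rule blinfun_eqI) (simp add: mat2_apply_pair blinfun.add_left algebra_simps)

lemma mat2_scaleC: "scaleC_op k (mat2 a b c d) = mat2 (scaleC_op k a) (scaleC_op k b) (scaleC_op k c) (scaleC_op k d)"
  by (rule blinfun_eqI) (simp add: mat2_apply_pair scaleC_prod_def scaleC_add_right)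

lemma mat2_compose:
  "mat2 a b c d o\<^sub>L mat2 a' b' c' d' =
    mat2 ((a o\<^sub>L a') + (b o\<^sub>L c')) ((a o\<^sub>L b') + (b o\<^sub>L d')) ((c o\<^sub>L a') + (d o\<^sub>L c')) ((c o\<^sub>L b') + (d o\<^sub>L d'))"
  by (rule blinfun_eqI) (simp add: mat2_apply_pair blinfun.add_left blinfun.add_right algebra_simps)

lemma mat2_id: "mat2 id_blinfun 0 0 id_blinfun = id_blinfun"
  by (rule blinfun_eqI) (simp add: mat2_apply_pair)

lemma entry_id [simp]:
  "entry11 id_blinfun = id_blinfun" "entry12 id_blinfun = 0" "entry21 id_blinfun = 0" "entry22 id_blinfun = id_blinfun"
  using entry_mat2[of id_blinfun 0 0 id_blinfun] by (simp_all add: mat2_id)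

lemma cinner_mat2:
  "cinner \<xi> (mat2 a b c d \<eta>) = cinner (fst \<xi>) (a (fst \<eta>)) + cinner (fst \<xi>) (b (snd \<eta>))
    + cinner (snd \<xi>) (c (fst \<eta>)) + cinner (snd \<xi>) (d (snd \<eta>))"
  by (simp add: mat2_apply_pair cinner_prod_def cinner_add_right)

lemma mat2_bounded_ops:
  "a \<in> bounded_ops \<Longrightarrow> b \<in> bounded_ops \<Longrightarrow> c \<in> bounded_ops \<Longrightarrow> d \<in> bounded_ops \<Longrightarrow> mat2 a b c d \<in> bounded_ops"
  by (rule bounded_opsI) (simp add: mat2_apply_pair scaleC_prod_def scaleC_add_right bounded_opsD)

lemma norm_entry_le:
  "norm a \<le> norm (mat2 a b c d)" "norm b \<le> norm (mat2 a b c d)"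
  "norm c \<le> norm (mat2 a b c d)" "norm d \<le> norm (mat2 a b c d)"
proof -
  note le = norm_cinner_blinfun_le[where a = "mat2 a b c d", unfolded cinner_mat2]
  show "norm a \<le> norm (mat2 a b c d)"
    by (rule norm_blinfun_le_of_cinner) (use le[of "(\<xi>, 0)" "(\<eta>, 0)" for \<xi> \<eta>] in simp_all)
  show "norm b \<le> norm (mat2 a b c d)"
    by (rule norm_blinfun_le_of_cinner) (use le[of "(\<xi>, 0)" "(0, \<eta>)" for \<xi> \<eta>] in simp_all)
  show "norm c \<le> norm (mat2 a b c d)"
    by (rule norm_blinfun_le_of_cinner) (use le[of "(0, \<xi>)" "(\<eta>, 0)" for \<xi> \<eta>] in simp_all)
  show "norm d \<le> norm (mat2 a b c d)"
    by (rule norm_blinfun_le_of_cinner) (use le[of "(0, \<xi>)" "(0, \<eta>)" for \<xi> \<eta>] in simp_all)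
qed

lemma norm_mat2_single:
  "norm (mat2 a 0 0 0) = norm a" "norm (mat2 0 a 0 0) = norm a" "norm (mat2 0 0 0 a) = norm a"
proof -
  have *: "cmod (cinner (P \<xi>) (a (Q \<eta>))) \<le> norm a * norm \<xi> * norm \<eta>"
    if "\<And>v. norm (P v) \<le> norm v" "\<And>v. norm (Q v) \<le> norm v" for P Q :: "'a \<times> 'a \<Rightarrow> 'a" and \<xi> \<eta>
  proof -
    have "norm a * norm (P \<xi>) * norm (Q \<eta>) \<le> norm a * norm \<xi> * norm \<eta>"
      using that by (intro mult_mono) auto
    with norm_cinner_blinfun_le[of "P \<xi>" a "Q \<eta>"] show ?thesis by linarith
  qed
  have le: "norm (fst v) \<le> norm v" "norm (snd v) \<le> norm v" for v :: "'a \<times> 'a"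
    by (cases v; simp add: norm_fst_le norm_snd_le)+
  have "norm (mat2 a 0 0 0) \<le> norm a" "norm (mat2 0 a 0 0) \<le> norm a" "norm (mat2 0 0 0 a) \<le> norm a"
    using *[OF le(1) le(1)] *[OF le(1) le(2)] *[OF le(2) le(2)]
    by (auto intro!: norm_blinfun_le_of_cinner simp: cinner_mat2)
  then show "norm (mat2 a 0 0 0) = norm a" "norm (mat2 0 a 0 0) = norm a" "norm (mat2 0 0 0 a) = norm a"
    using norm_entry_le(1)[of a 0 0 0] norm_entry_le(2)[of a 0 0 0] norm_entry_le(4)[of a 0 0 0] by linarith+
qed

lemma mat2_algebra_iff [simp]:
  "mat2 a b c d \<in> mat2_algebra M \<longleftrightarrow> a \<in> M \<and> b \<in> M \<and> c \<in> M \<and> d \<in> M"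
proof
  assume "mat2 a b c d \<in> mat2_algebra M"
  then obtain a' b' c' d' where "mat2 a b c d = mat2 a' b' c' d'" "a' \<in> M" "b' \<in> M" "c' \<in> M" "d' \<in> M"
    by (auto simp: mat2_algebra_def)
  then show "a \<in> M \<and> b \<in> M \<and> c \<in> M \<and> d \<in> M" by (metis entry_mat2)
qed (auto simp: mat2_algebra_def)

lemma mat2_algebraE:
  assumes "x \<in> mat2_algebra M"
  obtains a b c d where "x = mat2 a b c d" "a \<in> M" "b \<in> M" "c \<in> M" "d \<in> M"
  using assms unfolding mat2_algebra_def by blast

lemma block_map_mat2: "block_map v\<^sub>1 T S v\<^sub>2 (mat2 a b c d) = mat2 (v\<^sub>1 a) (T b) (S c) (v\<^sub>2 d)"
  by (simp add: block_map_def)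

lemma linear_mapD:
  assumes "linear_map M T"
  shows "x \<in> M \<Longrightarrow> T x \<in> M" "x \<in> M \<Longrightarrow> y \<in> M \<Longrightarrow> T (x + y) = T x + T y"
    "x \<in> M \<Longrightarrow> T (scaleC_op c x) = scaleC_op c (T x)"
  using assms by (auto simp: linear_map_def)

lemma linear_map_zero:
  assumes "linear_map M T" "0 \<in> M"
  shows "T 0 = 0"
proof -
  have "scaleC_op 0 x = 0" for x :: "'a \<Rightarrow>\<^sub>L 'a" by (rule blinfun_eqI) simp
  then show ?thesis using linear_mapD(3)[OF assms, of 0] by simp
qed

lemma linear_map_block_map:
  assumes "linear_map M v\<^sub>1" "linear_map M T" "linear_map M S" "linear_map M v\<^sub>2"
  shows "linear_map (mat2_algebra M) (block_map v\<^sub>1 T S v\<^sub>2)"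
  unfolding linear_map_def
  by (intro conjI ballI allI; elim mat2_algebraE; simp add: block_map_mat2 mat2_add mat2_scaleC linear_mapD[OF assms(1)]
      linear_mapD[OF assms(2)] linear_mapD[OF assms(3)] linear_mapD[OF assms(4)])

lemma adj_op_ell2_linear:
  fixes x y :: "'a ell2 \<Rightarrow>\<^sub>L 'a ell2"
  assumes x: "x \<in> bounded_ops"
  shows "y \<in> bounded_ops \<Longrightarrow> adj_op (x + y) = adj_op x + adj_op y"
    and "adj_op (scaleC_op c x) = scaleC_op (cnj c) (adj_op x)"
    and "adj_op (adj_op x) = x"
proof -
  show "adj_op (x + y) = adj_op x + adj_op y" if "y \<in> bounded_ops"
    by (rule adj_op_eqI)
      (simp add: blinfun.add_left cinner_add_left cinner_add_right adj_op_ell2(1)[OF x] adj_op_ell2(1)[OF that])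
  show "adj_op (scaleC_op c x) = scaleC_op (cnj c) (adj_op x)"
    by (rule adj_op_eqI) (simp add: cinner_scaleC_left cinner_scaleC_right adj_op_ell2(1)[OF x])
  show "adj_op (adj_op x) = x"
    by (rule adj_op_eqI) (metis adj_op_ell2(1)[OF x] cinner_commute)
qed

lemma cinner_adj_mat2:
  fixes a b c d :: "'a ell2 \<Rightarrow>\<^sub>L 'a ell2"
  assumes "a \<in> bounded_ops" "b \<in> bounded_ops" "c \<in> bounded_ops" "d \<in> bounded_ops"
  shows "cinner (mat2 (adj_op a) (adj_op c) (adj_op b) (adj_op d) \<xi>) \<eta> = cinner \<xi> (mat2 a b c d \<eta>)"
  using adj_op_ell2(1)[OF assms(1)] adj_op_ell2(1)[OF assms(2)] adj_op_ell2(1)[OF assms(3)] adj_op_ell2(1)[OF assms(4)]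
  by (simp add: mat2_apply_pair cinner_prod_def cinner_add_left cinner_add_right)

lemma adj_op_mat2:
  fixes a b c d :: "'a ell2 \<Rightarrow>\<^sub>L 'a ell2"
  assumes "a \<in> bounded_ops" "b \<in> bounded_ops" "c \<in> bounded_ops" "d \<in> bounded_ops"
  shows "adj_op (mat2 a b c d) = mat2 (adj_op a) (adj_op c) (adj_op b) (adj_op d)"
  by (rule adj_op_eqI) (rule cinner_adj_mat2[OF assms])

lemma linear_map_circ_map:
  assumes \<sigma>: "two_cocycle \<sigma>" and T: "linear_map (VN \<sigma>) T"
  shows "linear_map (VN \<sigma>) (circ_map T)"
proof -
  note V = VN_closed[OF \<sigma>] and T = linear_mapD[OF T]
  show ?thesis
    unfolding linear_map_def circ_map_def
    by (auto simp: V T adj_op_ell2_linear)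
qed

lemma VN_trace_eq: "VN_trace x = matrix_entry x 0 0"
  by (simp add: VN_trace_def matrix_entry_def cinner_basis)

text \<open>Schur multiplication by a real kernel is symmetric for the trace because \<open>\<tau>(x y\<^sup>*)\<close> is the inner
product of the rows of \<open>x\<close> and \<open>y\<close> at the unit.\<close>

lemma VN_trace_compose_adj:
  assumes x: "x \<in> bounded_ops" and y: "y \<in> bounded_ops"
  shows "VN_trace (x o\<^sub>L adj_op y) = (\<Sum>\<^sub>\<infinity>t. matrix_entry x 0 t * cnj (matrix_entry y 0 t))"
proof -
  have "((\<lambda>t. matrix_entry (adj_op y) t 0 * matrix_entry x 0 t) has_sum matrix_entry (x o\<^sub>L adj_op y) 0 0) UNIV"
    using matrix_entry_has_sum[OF x, of "adj_op y (ell2_basis 0)" 0] by (simp add: matrix_entry_def)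
  then have "((\<lambda>t. matrix_entry x 0 t * cnj (matrix_entry y 0 t)) has_sum VN_trace (x o\<^sub>L adj_op y)) UNIV"
    by (simp add: adj_op_ell2(3)[OF y] VN_trace_eq mult.commute)
  then show ?thesis by (rule infsumI[symmetric])
qed

lemma VN_trace_schur_product:
  assumes b: "schur_multiplier b" and real: "\<And>u t. cnj (b u t) = b u t"
    and x: "x \<in> bounded_ops" and y: "y \<in> bounded_ops"
  shows "VN_trace (schur_product b x o\<^sub>L adj_op y) = VN_trace (x o\<^sub>L adj_op (schur_product b y))"
  by (simp add: VN_trace_compose_adj x y schur_product[OF b x] schur_product[OF b y] real mult_ac)

lemma mat2_trace_compose_adj:
  fixes a b c d a' b' c' d' :: "'g::group_add ell2 \<Rightarrow>\<^sub>L 'g ell2"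
  assumes "a' \<in> bounded_ops" "b' \<in> bounded_ops" "c' \<in> bounded_ops" "d' \<in> bounded_ops"
  shows "mat2_trace VN_trace (mat2 a b c d o\<^sub>L adj_op (mat2 a' b' c' d')) =
    VN_trace (a o\<^sub>L adj_op a') + VN_trace (b o\<^sub>L adj_op b') + VN_trace (c o\<^sub>L adj_op c') + VN_trace (d o\<^sub>L adj_op d')"
  by (simp add: mat2_trace_def adj_op_mat2[OF assms] mat2_compose VN_trace_eq)

lemma map_norm_le_one:
  assumes "\<And>x. x \<in> M \<Longrightarrow> norm (T x) \<le> norm x"
  shows "map_norm M T \<le> 1"
  unfolding map_norm_def
proof (rule SUP_least)
  fix x assume "x \<in> {x \<in> M. norm x \<le> 1}"
  with assms[of x] show "ennreal (norm (T x)) \<le> 1" by (simp add: ennreal_le_1)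
qed

section \<open>Fourier multipliers with a positive definite symbol\<close>

text \<open>\<^const>\<open>False\<close> stands for the first and \<^const>\<open>True\<close> for the second index of a two by two matrix.  The
entry below the diagonal is the symbol of the multiplier \<open>x \<mapsto> M\<^sub>\<phi>(x\<^sup>*)\<^sup>*\<close>.\<close>

definition block_symbol ::
  "('g::group_add \<Rightarrow> complex) \<Rightarrow> ('g \<Rightarrow> complex) \<Rightarrow> ('g \<Rightarrow> complex) \<Rightarrow> bool \<Rightarrow> bool \<Rightarrow> 'g \<Rightarrow> complex" where
  "block_symbol \<psi>\<^sub>1 \<phi> \<psi>\<^sub>2 i j s =
    (if i then if j then \<psi>\<^sub>2 s else cnj (\<phi> (- s)) else if j then \<phi> s else \<psi>\<^sub>1 s)"

definition block_kernel ::
  "('g::group_add \<Rightarrow> complex) \<Rightarrow> ('g \<Rightarrow> complex) \<Rightarrow> ('g \<Rightarrow> complex) \<Rightarrow> bool \<times> 'g \<Rightarrow> bool \<times> 'g \<Rightarrow> complex" where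
  "block_kernel \<psi>\<^sub>1 \<phi> \<psi>\<^sub>2 p q = block_symbol \<psi>\<^sub>1 \<phi> \<psi>\<^sub>2 (fst p) (fst q) (snd p - snd q)"

lemma countable_ell2_support: "countable {t. ell2_coeff \<xi> t \<noteq> 0}"
proof -
  have "countable {t \<in> UNIV. (cmod (ell2_coeff \<xi> t))\<^sup>2 \<noteq> 0}"
    by (rule summable_countable_real[OF ell2_coeff_summable])
  then show ?thesis by simp
qed

text \<open>The four multipliers are Schur products with the blocks of one positive kernel.  A factorization of
this kernel into column contractions \<open>D False\<close> and \<open>D True\<close> combines to a factorization of the
block map through \<open>(\<xi>\<^sub>1, \<xi>\<^sub>2) \<mapsto> (D False \<xi>\<^sub>1, D True \<xi>\<^sub>2)\<close> on both sides, hence complete positivity.\<close>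

lemma psd_block_multipliers:
  fixes \<sigma> :: "'g::group_add \<Rightarrow> 'g \<Rightarrow> complex" and \<psi>\<^sub>1 \<phi> \<psi>\<^sub>2 :: "'g \<Rightarrow> complex"
  assumes \<sigma>: "two_cocycle \<sigma>" and psd: "psd_kernel (block_kernel \<psi>\<^sub>1 \<phi> \<psi>\<^sub>2)"
    and one: "\<psi>\<^sub>1 0 = 1" "\<psi>\<^sub>2 0 = 1"
    and real: "\<And>s. cnj (\<psi>\<^sub>1 s) = \<psi>\<^sub>1 s" "\<And>s. cnj (\<phi> s) = \<phi> s" "\<And>s. cnj (\<psi>\<^sub>2 s) = \<psi>\<^sub>2 s"
  obtains M\<^sub>1 M M\<^sub>2 where "fourier_multiplier \<sigma> \<psi>\<^sub>1 M\<^sub>1" "fourier_multiplier \<sigma> \<phi> M" "fourier_multiplier \<sigma> \<psi>\<^sub>2 M\<^sub>2"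
    "unital_map (block_map M\<^sub>1 M (circ_map M) M\<^sub>2)"
    "completely_positive (mat2_algebra (VN \<sigma>)) (block_map M\<^sub>1 M (circ_map M) M\<^sub>2)"
    "weak_star_continuous (mat2_algebra (VN \<sigma>)) (block_map M\<^sub>1 M (circ_map M) M\<^sub>2)"
    "selfadjoint_map (mat2_algebra (VN \<sigma>)) (mat2_trace VN_trace) (block_map M\<^sub>1 M (circ_map M) M\<^sub>2)"
proof -
  let ?V = "VN \<sigma>" and ?K = "block_kernel \<psi>\<^sub>1 \<phi> \<psi>\<^sub>2"
  note V = VN_closed[OF \<sigma>]
  define \<kappa> where "\<kappa> = block_symbol \<psi>\<^sub>1 \<phi> \<psi>\<^sub>2"
  have K: "?K (i, u) (j, t) = \<kappa> i j (u - t)" for i j u t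
    by (simp add: block_kernel_def \<kappa>_def)
  have K_diag: "Re (?K p p) \<le> 1" for p
    by (cases p) (simp add: K \<kappa>_def block_symbol_def one)
  have \<kappa>_real: "cnj (\<kappa> i j s) = \<kappa> i j s" for i j s
    by (simp add: \<kappa>_def block_symbol_def real)
  define m where "m i j = schur_product (\<lambda>u t. \<kappa> i j (u - t))" for i j
  have multiplier: "schur_multiplier (\<lambda>u t. \<kappa> i j (u - t))" for i j
    using psd_block_schur_multiplier[OF psd K_diag, of i j] by (simp add: K)
  note m = schur_product[OF multiplier, folded m_def]
  note m_lin = linear_map_schur_product[OF \<sigma> multiplier, folded m_def]
  have m_VN: "m i j x \<in> ?V" if "x \<in> ?V" for i j x
    using linear_mapD(1)[OF m_lin that] .
  have factor: "\<exists>D. (\<forall>i. column_contraction (D i)) \<and> (\<forall>i j. factors_through ?V (m i j) X (D i) (D j))"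
    if X: "countable X" for X
  proof -
    define S where "S = (\<Union>\<xi>\<in>X. {t. ell2_coeff \<xi> t \<noteq> 0})"
    have "countable S" unfolding S_def by (intro countable_UN X countable_ell2_support)
    from psd_block_factorization[OF psd K_diag this, unfolded K, folded m_def]
    obtain D :: "bool \<Rightarrow> nat \<Rightarrow> 'g ell2 \<Rightarrow> 'g ell2" where D: "\<forall>i. column_contraction (D i)"
      and sums: "\<forall>x\<in>bounded_ops. \<forall>\<xi>. (\<forall>t. t \<notin> S \<longrightarrow> ell2_coeff \<xi> t = 0) \<longrightarrow>
        (\<forall>\<eta> i j. (\<lambda>k. cinner (D i k \<xi>) (blinfun_apply x (D j k \<eta>))) sums cinner \<xi> (m i j x \<eta>))"
      by blast
    have "factors_through ?V (m i j) X (D i) (D j)" for i j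
      unfolding factors_through_def
    proof (intro conjI ballI allI)
      fix x \<xi> \<eta> assume "x \<in> ?V" "\<xi> \<in> X"
      moreover have "\<forall>t. t \<notin> S \<longrightarrow> ell2_coeff \<xi> t = 0" using \<open>\<xi> \<in> X\<close> by (auto simp: S_def)
      ultimately show "(\<lambda>k. cinner (D i k \<xi>) (blinfun_apply x (D j k \<eta>))) sums cinner \<xi> (m i j x \<eta>)"
        using sums V(7) by blast
    qed (use D in auto)
    with D show ?thesis by blast
  qed
  have fourier: "fourier_multiplier \<sigma> (\<kappa> i j) (m i j)" for i j
    unfolding fourier_multiplier_def
  proof (intro conjI allI)
    show "linear_map ?V (m i j)" by (rule m_lin)
    have "\<exists>D E. factors_through ?V (m i j) {\<xi>} D E" for \<xi>
      using factor[OF countable_finite[of "{\<xi>}"]] by blast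
    from norm_le_of_factors_through[OF this] have "map_norm ?V (m i j) \<le> 1"
      by (rule map_norm_le_one)
    then show "map_norm ?V (m i j) < \<infinity>" by (auto intro: le_less_trans)
    show "weak_star_continuous ?V (m i j)"
      using factor by (intro weak_star_continuous_of_factors_through m_VN) blast+
    show "m i j (twisted_translation \<sigma> s) = scaleC_op (\<kappa> i j s) (twisted_translation \<sigma> s)" for s
      unfolding m_def by (rule schur_product_twisted_translation[OF \<sigma> multiplier])
  qed
  have circ: "circ_map (m False True) x = m True False x" if x: "x \<in> ?V" for x
  proof (rule bounded_ops_eqI)
    have adj: "adj_op x \<in> ?V" using x by (rule V)
    show "circ_map (m False True) x \<in> bounded_ops" "m True False x \<in> bounded_ops"
      unfolding circ_map_def by (intro adj_op_ell2 V(7) m_VN x adj)+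
    show "matrix_entry (circ_map (m False True) x) u t = matrix_entry (m True False x) u t" for u t
    proof -
      have "matrix_entry (circ_map (m False True) x) u t = cnj (\<kappa> False True (t - u)) * matrix_entry x u t"
        unfolding circ_map_def
        by (simp add: adj_op_ell2(3)[OF V(7)[OF m_VN[OF adj]]] m(2)[OF V(7)[OF adj]] adj_op_ell2(3)[OF V(7)[OF x]])
      also have "cnj (\<kappa> False True (t - u)) = \<kappa> True False (u - t)"
        by (simp add: \<kappa>_def block_symbol_def)
      finally show ?thesis by (simp add: m(2)[OF V(7)[OF x]])
    qed
  qed
  define \<Phi> where "\<Phi> = block_map (m False False) (m False True) (circ_map (m False True)) (m True True)"
  have \<Phi>: "\<Phi> (mat2 a b c d) = mat2 (m False False a) (m False True b) (m True False c) (m True True d)"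
    if "c \<in> ?V" for a b c d
    by (simp add: \<Phi>_def block_map_mat2 circ that)
  have lin: "linear_map (mat2_algebra ?V) \<Phi>"
    unfolding \<Phi>_def by (intro linear_map_block_map m_lin linear_map_circ_map \<sigma>)
  have \<Phi>_factor: "\<exists>D. factors_through (mat2_algebra ?V) \<Phi> X D D" if X: "countable X" for X
  proof -
    have "countable (fst ` X \<union> snd ` X)" using X by simp
    from factor[OF this] obtain D where D: "\<And>i. column_contraction (D i)"
      and f: "\<And>i j. factors_through ?V (m i j) (fst ` X \<union> snd ` X) (D i) (D j)" by blast
    define DD where "DD k \<xi> = (D False k (fst \<xi>), D True k (snd \<xi>))" for k \<xi>
    have "column_contraction DD"
      unfolding column_contraction_def
    proof (intro allI)
      fix N \<xi>
      have "(\<Sum>k<N. (norm (DD k \<xi>))\<^sup>2) = (\<Sum>k<N. (norm (D False k (fst \<xi>)))\<^sup>2) + (\<Sum>k<N. (norm (D True k (snd \<xi>)))\<^sup>2)"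
        by (simp add: DD_def norm_Pair sum.distrib)
      also have "\<dots> \<le> (norm (fst \<xi>))\<^sup>2 + (norm (snd \<xi>))\<^sup>2"
        by (intro add_mono column_contractionD D)
      also have "\<dots> = (norm \<xi>)\<^sup>2" by (cases \<xi>) (simp add: norm_Pair)
      finally show "(\<Sum>k<N. (norm (DD k \<xi>))\<^sup>2) \<le> (norm \<xi>)\<^sup>2" .
    qed
    moreover have "(\<lambda>k. cinner (DD k \<xi>) (blinfun_apply x (DD k \<eta>))) sums cinner \<xi> (\<Phi> x \<eta>)"
      if xV: "x \<in> mat2_algebra ?V" and \<xi>: "\<xi> \<in> X" for x \<xi> \<eta>
    proof -
      obtain a b c d where x: "x = mat2 a b c d" and abcd: "a \<in> ?V" "b \<in> ?V" "c \<in> ?V" "d \<in> ?V"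
        using xV by (rule mat2_algebraE)
      have "fst \<xi> \<in> fst ` X \<union> snd ` X" "snd \<xi> \<in> fst ` X \<union> snd ` X" using \<xi> by auto
      then show ?thesis
        unfolding x \<Phi>[OF abcd(3)] cinner_mat2 DD_def fst_conv snd_conv
        by (intro sums_add factors_throughD(3)[OF f] abcd)
    qed
    ultimately show ?thesis unfolding factors_through_def by blast
  qed
  have cp: "completely_positive (mat2_algebra ?V) \<Phi>"
    by (rule completely_positive_of_factors_through[OF \<Phi>_factor lin])
  have wstar: "weak_star_continuous (mat2_algebra ?V) \<Phi>"
    using \<Phi>_factor by (intro weak_star_continuous_of_factors_through linear_mapD(1)[OF lin]) blast+
  have unital: "unital_map \<Phi>"
  proof -
    have "m False False id_blinfun = id_blinfun" "m True True id_blinfun = id_blinfun"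
      by (rule bounded_ops_eqI; simp add: m V(7)[OF V(3)] bounded_ops_intros \<kappa>_def block_symbol_def one)+
    moreover have "m False True 0 = 0" "m True False 0 = 0"
      by (intro linear_map_zero[OF m_lin] V(2))+
    ultimately show ?thesis
      unfolding unital_map_def using \<Phi>[OF V(2), of id_blinfun 0 id_blinfun] by (simp add: mat2_id)
  qed
  have "selfadjoint_map (mat2_algebra ?V) (mat2_trace VN_trace) \<Phi>"
    unfolding selfadjoint_map_def
  proof (intro conjI ballI lin wstar)
    have "\<exists>D E. factors_through (mat2_algebra ?V) \<Phi> {\<xi>} D E" for \<xi>
      using \<Phi>_factor[OF countable_finite[of "{\<xi>}"]] by blast
    from norm_le_of_factors_through[OF this] show "map_norm (mat2_algebra ?V) \<Phi> \<le> 1"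
      by (rule map_norm_le_one)
  next
    fix x y assume "x \<in> mat2_algebra ?V" "y \<in> mat2_algebra ?V"
    then obtain a b c d a' b' c' d' where xy: "x = mat2 a b c d" "y = mat2 a' b' c' d'"
      and VN: "a \<in> ?V" "b \<in> ?V" "c \<in> ?V" "d \<in> ?V" "a' \<in> ?V" "b' \<in> ?V" "c' \<in> ?V" "d' \<in> ?V"
      by (elim mat2_algebraE) blast
    have trace: "VN_trace (m i j z o\<^sub>L adj_op w) = VN_trace (z o\<^sub>L adj_op (m i j w))"
      if "z \<in> ?V" "w \<in> ?V" for i j z w
      unfolding m_def by (rule VN_trace_schur_product[OF multiplier \<kappa>_real]) (use that V(7) in auto)
    show "mat2_trace VN_trace (\<Phi> x o\<^sub>L adj_op y) = mat2_trace VN_trace (x o\<^sub>L adj_op (\<Phi> y))"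
      unfolding xy \<Phi>[OF VN(3)] \<Phi>[OF VN(7)]
      using VN m_VN[THEN V(7)] V(7) by (simp add: mat2_trace_compose_adj trace)
  qed
  with cp wstar unital show ?thesis
    using fourier[of False False] fourier[of False True] fourier[of True True]
    by (intro that[of "m False False" "m False True" "m True True"])
      (simp_all add: \<Phi>_def \<kappa>_def block_symbol_def[abs_def])
qed

section \<open>From decompositions to positive definite symbols\<close>

lemma twisted_translation_zero:
  assumes \<sigma>: "two_cocycle \<sigma>"
  shows "twisted_translation \<sigma> 0 = id_blinfun"
  by (rule bounded_ops_eqI)
    (auto simp: twisted_translation_bounded_op[OF \<sigma>] matrix_entry_twisted_translation[OF \<sigma>] two_cocycleD(4)[OF \<sigma>])

lemma twisted_translation_compose_adj:
  assumes \<sigma>: "two_cocycle \<sigma>"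
  shows "twisted_translation \<sigma> k o\<^sub>L adj_op (twisted_translation \<sigma> l) =
    scaleC_op (cnj (\<sigma> (k - l) l)) (twisted_translation \<sigma> (k - l))"
proof (rule bounded_ops_eqI)
  note b = twisted_translation_bounded_op[OF \<sigma>] and adj = adj_op_ell2[OF twisted_translation_bounded_op[OF \<sigma>]]
  show "twisted_translation \<sigma> k o\<^sub>L adj_op (twisted_translation \<sigma> l) \<in> bounded_ops"
    "scaleC_op (cnj (\<sigma> (k - l) l)) (twisted_translation \<sigma> (k - l)) \<in> bounded_ops"
    by (intro bounded_ops_intros b adj(2))+
  fix u t
  define v where "v = - k + u"
  have u: "u = k + v" by (simp add: v_def)
  have "matrix_entry (twisted_translation \<sigma> k o\<^sub>L adj_op (twisted_translation \<sigma> l)) u t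
      = \<sigma> k v * matrix_entry (adj_op (twisted_translation \<sigma> l)) v t"
    by (simp add: matrix_entry_def twisted_translation_coeff[OF \<sigma>] v_def)
  also have "\<dots> = (if t = l + v then \<sigma> k v * cnj (\<sigma> l v) else 0)"
    by (simp add: adj(3) matrix_entry_twisted_translation[OF \<sigma>])
  also have "\<dots> = (if u = k - l + t then cnj (\<sigma> (k - l) l) * \<sigma> (k - l) t else 0)"
  proof -
    have "t = l + v \<longleftrightarrow> u = k - l + t"
      unfolding u by (metis add.assoc add_left_cancel diff_add_cancel)
    moreover have "\<sigma> k v * cnj (\<sigma> l v) = cnj (\<sigma> (k - l) l) * \<sigma> (k - l) (l + v)"
    proof -
      have "\<sigma> (k - l) l * \<sigma> k v = \<sigma> l v * \<sigma> (k - l) (l + v)"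
        using two_cocycleD(2)[OF \<sigma>, of "k - l" l v] by simp
      then show ?thesis
        using two_cocycle_cnj_mult[OF \<sigma>, of "k - l" l] two_cocycle_cnj_mult[OF \<sigma>, of l v] by algebra
    qed
    ultimately show ?thesis by (cases "t = l + v") auto
  qed
  also have "\<dots> = matrix_entry (scaleC_op (cnj (\<sigma> (k - l) l)) (twisted_translation \<sigma> (k - l))) u t"
    by (simp add: matrix_entry_twisted_translation[OF \<sigma>])
  finally show "matrix_entry (twisted_translation \<sigma> k o\<^sub>L adj_op (twisted_translation \<sigma> l)) u t =
    matrix_entry (scaleC_op (cnj (\<sigma> (k - l) l)) (twisted_translation \<sigma> (k - l))) u t" .
qed

lemma circ_map_twisted_translation:
  assumes \<sigma>: "two_cocycle \<sigma>" and T: "linear_map (VN \<sigma>) T"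
    and \<phi>: "\<And>s. T (twisted_translation \<sigma> s) = scaleC_op (\<phi> s) (twisted_translation \<sigma> s)"
  shows "circ_map T (twisted_translation \<sigma> s) = scaleC_op (cnj (\<phi> (- s))) (twisted_translation \<sigma> s)"
proof -
  let ?W = "twisted_translation \<sigma>"
  note b = twisted_translation_bounded_op[OF \<sigma>, of s]
  have commute: "scaleC_op c (scaleC_op d x) = scaleC_op d (scaleC_op c x)" for c d and x :: "'a ell2 \<Rightarrow>\<^sub>L 'a ell2"
    by (rule blinfun_eqI) (simp add: scaleC_scaleC mult.commute)
  have id: "id_blinfun o\<^sub>L x = x" for x :: "'a ell2 \<Rightarrow>\<^sub>L 'a ell2"
    by (rule blinfun_eqI) simp
  have adj: "adj_op (?W s) = scaleC_op (cnj (\<sigma> (- s) s)) (?W (- s))"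
    using twisted_translation_compose_adj[OF \<sigma>, of 0 s] by (simp add: twisted_translation_zero[OF \<sigma>] id)
  have "T (adj_op (?W s)) = scaleC_op (cnj (\<sigma> (- s) s)) (scaleC_op (\<phi> (- s)) (?W (- s)))"
    unfolding adj using linear_mapD(3)[OF T VN_closed(1)[OF \<sigma>]] \<phi> by simp
  also have "\<dots> = scaleC_op (\<phi> (- s)) (adj_op (?W s))"
    unfolding adj by (rule commute)
  finally show ?thesis
    unfolding circ_map_def using adj_op_ell2_linear(2)[OF adj_op_ell2(2)[OF b]] adj_op_ell2_linear(3)[OF b] by simp
qed

text \<open>The operator matrix with all four corners equal to \<open>\<lambda>\<^sub>k \<lambda>\<^sub>l\<^sup>*\<close> is positive, being a product \<open>w w\<^sup>*\<close>.
Its image is tested on multiples of \<open>\<epsilon>\<^sub>k\<close> placed in the first or second component.  With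
\<open>r = k l\<inverse>\<close> the operator \<open>\<lambda>\<^sub>k \<lambda>\<^sub>l\<^sup>*\<close> is \<open>\<lambda>\<^sub>r\<close> times the conjugate of the phase \<open>\<sigma>(r, l)\<close>, and the entry in
row \<open>k\<close> and column \<open>l\<close> of an element of the algebra is its entry in row \<open>r\<close> and column \<open>e\<close> times
\<open>\<sigma>(r, l)\<close>.  The phases cancel and the kernel remains.  Here \<open>\<tau>(v(\<lambda>\<^sub>s) \<lambda>\<^sub>s\<^sup>*)\<close> is
written as the matrix entry of \<open>v(\<lambda>\<^sub>s)\<close> in row \<open>s\<close> and column \<open>e\<close>.\<close>

lemma psd_kernel_of_completely_positive:
  fixes \<sigma> :: "'g::group_add \<Rightarrow> 'g \<Rightarrow> complex"
  assumes \<sigma>: "two_cocycle \<sigma>" and T: "linear_map (VN \<sigma>) T"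
    and \<phi>: "\<And>s. T (twisted_translation \<sigma> s) = scaleC_op (\<phi> s) (twisted_translation \<sigma> s)"
    and v: "linear_map (VN \<sigma>) v\<^sub>1" "linear_map (VN \<sigma>) v\<^sub>2"
    and cp: "completely_positive (mat2_algebra (VN \<sigma>)) (block_map v\<^sub>1 T (circ_map T) v\<^sub>2)"
  shows "psd_kernel (block_kernel (\<lambda>s. matrix_entry (v\<^sub>1 (twisted_translation \<sigma> s)) s 0) \<phi>
    (\<lambda>s. matrix_entry (v\<^sub>2 (twisted_translation \<sigma> s)) s 0))" (is "psd_kernel ?K")
proof -
  let ?V = "VN \<sigma>" and ?W = "twisted_translation \<sigma>"
  note V = VN_closed[OF \<sigma>]
  define e where "e i j = (if i then if j then v\<^sub>2 else circ_map T else if j then T else v\<^sub>1)" for i j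
  have e_lin: "linear_map ?V (e i j)" for i j
    using v T linear_map_circ_map[OF \<sigma> T] by (simp add: e_def)
  have e_coeff: "matrix_entry (e i j (?W s)) s 0
      = block_symbol (\<lambda>s. matrix_entry (v\<^sub>1 (?W s)) s 0) \<phi> (\<lambda>s. matrix_entry (v\<^sub>2 (?W s)) s 0) i j s" for i j s
    by (simp add: e_def block_symbol_def \<phi> circ_map_twisted_translation[OF \<sigma> T \<phi>]
        matrix_entry_twisted_translation[OF \<sigma>] two_cocycleD(3)[OF \<sigma>])
  define L where "L k l = ?W k o\<^sub>L adj_op (?W l)" for k l
  have L: "L k l = scaleC_op (cnj (\<sigma> (k - l) l)) (?W (k - l))" for k l
    unfolding L_def by (rule twisted_translation_compose_adj[OF \<sigma>])
  have L_VN: "L k l \<in> ?V" for k l unfolding L by (intro V)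
  have entry: "matrix_entry (e i j (L k l)) k l = ?K (i, k) (j, l)" for i j k l
  proof -
    have "matrix_entry (e i j (L k l)) k l = cnj (\<sigma> (k - l) l) * matrix_entry (e i j (?W (k - l))) k l"
      unfolding L by (simp add: linear_mapD(3)[OF e_lin V(1)])
    also have "\<dots> = cnj (\<sigma> (k - l) l) * \<sigma> (k - l) l * matrix_entry (e i j (?W (k - l))) (k - l) 0"
      by (subst VN_matrix_entry[OF \<sigma> linear_mapD(1)[OF e_lin V(1)]]) simp
    finally show ?thesis
      by (simp add: two_cocycle_cnj_mult[OF \<sigma>] e_coeff block_kernel_def)
  qed
  show ?thesis
    unfolding psd_kernel_def
  proof (intro allI)
    fix n and p :: "nat \<Rightarrow> bool \<times> 'g" and a :: "nat \<Rightarrow> complex"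
    let ?s = "\<lambda>k. snd (p k)"
    define A where "A k l = (let x = L (?s k) (?s l) in mat2 x x x x)" for k l
    have "matrix_over n (mat2_algebra ?V) A"
      by (simp add: matrix_over_def A_def Let_def L_VN)
    moreover have "matrix_positive n A"
      unfolding matrix_positive_iff
    proof
      fix \<xi> :: "nat \<Rightarrow> 'g ell2 \<times> 'g ell2"
      define z where "z k = adj_op (?W (?s k)) (fst (\<xi> k) + snd (\<xi> k))" for k
      have "cinner (\<xi> k) (A k l (\<xi> l)) = cinner (z k) (z l)" for k l
      proof -
        have "cinner (\<xi> k) (A k l (\<xi> l)) = cinner (fst (\<xi> k) + snd (\<xi> k)) (L (?s k) (?s l) (fst (\<xi> l) + snd (\<xi> l)))"
          by (simp add: A_def Let_def cinner_mat2 cinner_add_left cinner_add_right blinfun.add_right)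
        also have "\<dots> = cinner (z k) (z l)"
          by (simp add: L_def z_def adj_op_ell2(1)[OF twisted_translation_bounded_op[OF \<sigma>]])
        finally show ?thesis .
      qed
      then have "matrix_form n A \<xi> \<xi> = cinner (\<Sum>k<n. z k) (\<Sum>l<n. z l)"
        unfolding matrix_form_def cinner_sum_left by (simp only: cinner_sum_right)
      then show "matrix_form n A \<xi> \<xi> \<in> \<real>\<^sub>\<ge>\<^sub>0"
        by (simp only: cinner_self nonneg_Reals_of_real_iff zero_le_power2)
    qed
    ultimately have pos: "matrix_positive n (\<lambda>k l. block_map v\<^sub>1 T (circ_map T) v\<^sub>2 (A k l))"
      using cp by (simp add: completely_positive_def)
    define \<zeta> where "\<zeta> k = (if fst (p k) then (0, a k *\<^sub>C ell2_basis (?s k)) else (a k *\<^sub>C ell2_basis (?s k), 0))" for k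
    have "cinner (\<zeta> k) (block_map v\<^sub>1 T (circ_map T) v\<^sub>2 (A k l) (\<zeta> l)) = cnj (a k) * ?K (p k) (p l) * a l" for k l
    proof -
      let ?x = "L (?s k) (?s l)"
      have "e i j ?x \<in> bounded_ops" for i j
        by (intro V(7) linear_mapD(1)[OF e_lin] L_VN)
      then have "cinner (\<zeta> k) (mat2 (e False False ?x) (e False True ?x) (e True False ?x) (e True True ?x) (\<zeta> l))
          = cnj (a k) * matrix_entry (e (fst (p k)) (fst (p l)) ?x) (?s k) (?s l) * a l"
        by (cases "fst (p k)"; cases "fst (p l)")
          (simp_all add: \<zeta>_def cinner_mat2 cinner_scaleC_left cinner_scaleC_right bounded_opsD cinner_basis matrix_entry_def)
      then show ?thesis
        by (simp add: entry) (simp add: A_def Let_def block_map_mat2 e_def)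
    qed
    with pos show "(\<Sum>k<n. \<Sum>l<n. cnj (a k) * ?K (p k) (p l) * a l) \<in> \<real>\<^sub>\<ge>\<^sub>0"
      unfolding matrix_positive_iff matrix_form_def by (metis (no_types, lifting) sum.cong)
  qed
qed

lemma norm_twisted_translation_le:
  assumes \<sigma>: "two_cocycle \<sigma>"
  shows "norm (twisted_translation \<sigma> s) \<le> 1"
proof (rule norm_blinfun_bound)
  fix f
  have "(norm (twisted_translation \<sigma> s f))\<^sup>2 = (norm f)\<^sup>2"
    unfolding norm_ell2_sq[of "twisted_translation \<sigma> s f"] twisted_translation_coeff[OF \<sigma>]
    by (rule twisted_translation_square_sum(2)[OF \<sigma>])
  then show "norm (twisted_translation \<sigma> s f) \<le> 1 * norm f" by (simp add: power2_eq_iff_nonneg)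
qed simp

lemma cmod_matrix_entry_le: "cmod (matrix_entry x u t) \<le> norm x"
  using norm_cinner_blinfun_le[of "ell2_basis u" x "ell2_basis t"] by (simp add: matrix_entry_def cinner_basis)

lemma norm_le_of_map_norm:
  assumes "map_norm M T \<le> ennreal r" "x \<in> M" "norm x \<le> 1" "0 \<le> r"
  shows "norm (T x) \<le> r"
proof -
  have "ennreal (norm (T x)) \<le> map_norm M T"
    unfolding map_norm_def by (rule SUP_upper) (use assms in auto)
  from order_trans[OF this assms(1)] have "ennreal (norm (T x)) \<le> ennreal r" .
  then show ?thesis using assms(4) by (simp add: ennreal_le_iff)
qed

lemma compact_bounded_functions: "compact {\<Psi> :: 'i \<Rightarrow> complex. \<forall>p. cmod (\<Psi> p) \<le> r}"
proof -
  have "compactin (product_topology (\<lambda>_. euclidean) UNIV) (PiE (UNIV :: 'i set) (\<lambda>_. cball (0::complex) r))"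
    by (simp add: compactin_PiE)
  moreover have "PiE UNIV (\<lambda>_. cball (0::complex) r) = {\<Psi> :: 'i \<Rightarrow> complex. \<forall>p. cmod (\<Psi> p) \<le> r}"
    by (auto simp: PiE_def Pi_def)
  ultimately show ?thesis by (simp add: euclidean_product_topology)
qed

text \<open>The definition of the dec-norm provides decompositions only for each bound above \<open>1\<close>.  Positivity of
the kernel and bounds on its entries are closed conditions on finitely many coordinates at a time,
so the symbols allowed at stage \<open>n\<close> form closed sets that decrease with \<open>n\<close> and lie in a compact
product of discs.\<close>

lemma psd_block_kernel_limit:
  fixes \<phi> :: "'g::group_add \<Rightarrow> complex"
  assumes approx: "\<And>n. \<exists>\<psi>\<^sub>1 \<psi>\<^sub>2. psd_kernel (block_kernel \<psi>\<^sub>1 \<phi> \<psi>\<^sub>2) \<and>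
    (\<forall>s. cmod (\<psi>\<^sub>1 s) \<le> 1 + inverse (Suc n)) \<and> (\<forall>s. cmod (\<psi>\<^sub>2 s) \<le> 1 + inverse (Suc n))"
  obtains \<psi>\<^sub>1 \<psi>\<^sub>2 where "psd_kernel (block_kernel \<psi>\<^sub>1 \<phi> \<psi>\<^sub>2)" "\<forall>s. cmod (\<psi>\<^sub>1 s) \<le> 1" "\<forall>s. cmod (\<psi>\<^sub>2 s) \<le> 1"
proof -
  \<comment> \<open>Both symbols are packed into one function, so that a single product space carries them.\<close>
  define \<K> where "\<K> \<Psi> = block_kernel (\<lambda>s. \<Psi> (False, s)) \<phi> (\<lambda>s. \<Psi> (True, s))" for \<Psi> :: "bool \<times> 'g \<Rightarrow> complex"
  define C where "C n = {\<Psi>. psd_kernel (\<K> \<Psi>) \<and> (\<forall>p. cmod (\<Psi> p) \<le> 1 + inverse (real (Suc n)))}" for n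
  have coordinate: "continuous_on UNIV (\<lambda>\<Psi> :: bool \<times> 'g \<Rightarrow> complex. \<Psi> p)" for p
    by (rule continuous_on_product_coordinates)
  have entry: "continuous_on UNIV (\<lambda>\<Psi>. \<K> \<Psi> p q)" for p q
    unfolding \<K>_def block_kernel_def block_symbol_def
    by (cases "fst p"; cases "fst q") (auto intro!: continuous_intros coordinate)
  have closed: "closed (C n)" for n
    unfolding C_def psd_kernel_def Collect_conj_eq
  proof (intro closed_Int closed_Collect_all)
    fix N and p :: "nat \<Rightarrow> bool \<times> 'g" and a :: "nat \<Rightarrow> complex"
    have "continuous_on UNIV (\<lambda>\<Psi>. \<Sum>k<N. \<Sum>l<N. cnj (a k) * \<K> \<Psi> (p k) (p l) * a l)"
      by (intro continuous_intros entry)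
    from closed_vimage[OF closed_nonneg_Reals_complex this]
    show "closed {\<Psi>. (\<Sum>k<N. \<Sum>l<N. cnj (a k) * \<K> \<Psi> (p k) (p l) * a l) \<in> \<real>\<^sub>\<ge>\<^sub>0}"
      by (simp add: vimage_def)
  next
    fix p
    show "closed {\<Psi> :: bool \<times> 'g \<Rightarrow> complex. cmod (\<Psi> p) \<le> 1 + inverse (real (Suc n))}"
      by (intro closed_Collect_le continuous_intros coordinate)
  qed
  have mono: "C n \<subseteq> C m" if "m \<le> n" for m n
  proof -
    have "inverse (real (Suc n)) \<le> inverse (real (Suc m))" using that by (intro le_imp_inverse_le) auto
    then have "1 + inverse (real (Suc n)) \<le> 1 + inverse (real (Suc m))" by simp
    then show ?thesis unfolding C_def by (blast intro: order_trans)
  qed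
  have nonempty: "C n \<noteq> {}" for n
  proof -
    obtain \<psi>\<^sub>1 \<psi>\<^sub>2 where \<psi>: "psd_kernel (block_kernel \<psi>\<^sub>1 \<phi> \<psi>\<^sub>2)"
      "\<forall>s. cmod (\<psi>\<^sub>1 s) \<le> 1 + inverse (Suc n)" "\<forall>s. cmod (\<psi>\<^sub>2 s) \<le> 1 + inverse (Suc n)"
      using approx[of n] by blast
    then have "(\<lambda>p. if fst p then \<psi>\<^sub>2 (snd p) else \<psi>\<^sub>1 (snd p)) \<in> C n"
      by (simp add: C_def \<K>_def)
    then show ?thesis by blast
  qed
  let ?U = "{\<Psi> :: bool \<times> 'g \<Rightarrow> complex. \<forall>p. cmod (\<Psi> p) \<le> 2}"
  have CU: "C n \<subseteq> ?U" for n
  proof -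
    have "inverse (real (Suc n)) \<le> 1" by (simp add: inverse_eq_divide)
    then have "1 + inverse (real (Suc n)) \<le> 2" by linarith
    then show ?thesis unfolding C_def by (blast intro: order_trans)
  qed
  have "?U \<inter> (\<Inter>n. C n) \<noteq> {}"
  proof (rule compact_imp_fip_image[OF compact_bounded_functions closed])
    fix I :: "nat set" assume "finite I"
    then obtain N where "\<forall>i\<in>I. i < N" by (metis finite_nat_set_iff_bounded)
    then have "C N \<subseteq> ?U \<inter> (\<Inter>i\<in>I. C i)" using mono CU by (meson INT_greatest Int_greatest less_imp_le)
    then show "?U \<inter> (\<Inter>i\<in>I. C i) \<noteq> {}" using nonempty[of N] by blast
  qed
  then obtain \<Psi> where \<Psi>: "\<And>n. \<Psi> \<in> C n" by blast
  have "cmod (\<Psi> p) \<le> 1" for p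
  proof (rule field_le_epsilon)
    fix \<epsilon> :: real assume "0 < \<epsilon>"
    then obtain n where "inverse (real (Suc n)) < \<epsilon>" using reals_Archimedean by blast
    moreover have "cmod (\<Psi> p) \<le> 1 + inverse (real (Suc n))" using \<Psi>[of n] unfolding C_def by blast
    ultimately show "cmod (\<Psi> p) \<le> 1 + \<epsilon>" by linarith
  qed
  moreover have "psd_kernel (\<K> \<Psi>)" using \<Psi>[of 0] by (simp add: C_def)
  ultimately show ?thesis unfolding \<K>_def by (intro that) auto
qed

text \<open>The average of the kernel and its conjugate has real symbols and the same \<open>\<phi>\<close>.  Adding a
nonnegative diagonal kernel changes the symbols at the unit only.\<close>

lemma psd_block_kernel_normalize:
  fixes \<phi> :: "'g::group_add \<Rightarrow> complex"
  assumes psd: "psd_kernel (block_kernel \<psi>\<^sub>1 \<phi> \<psi>\<^sub>2)" and le: "cmod (\<psi>\<^sub>1 0) \<le> 1" "cmod (\<psi>\<^sub>2 0) \<le> 1"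
    and real: "\<And>s. cnj (\<phi> s) = \<phi> s"
  obtains \<phi>\<^sub>1 \<phi>\<^sub>2 :: "'g \<Rightarrow> real"
  where "psd_kernel (block_kernel (\<lambda>s. complex_of_real (\<phi>\<^sub>1 s)) \<phi> (\<lambda>s. complex_of_real (\<phi>\<^sub>2 s)))"
    "\<phi>\<^sub>1 0 = 1" "\<phi>\<^sub>2 0 = 1"
proof -
  define \<phi>\<^sub>1 where "\<phi>\<^sub>1 s = (if s = 0 then 1 else Re (\<psi>\<^sub>1 s))" for s
  define \<phi>\<^sub>2 where "\<phi>\<^sub>2 s = (if s = 0 then 1 else Re (\<psi>\<^sub>2 s))" for s
  define d where "d p = (if fst p then 1 - Re (\<psi>\<^sub>2 0) else 1 - Re (\<psi>\<^sub>1 0))" for p :: "bool \<times> 'g"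
  let ?K = "block_kernel \<psi>\<^sub>1 \<phi> \<psi>\<^sub>2"
  have d: "0 \<le> d p" for p
    using le complex_Re_le_cmod[of "\<psi>\<^sub>1 0"] complex_Re_le_cmod[of "\<psi>\<^sub>2 0"] by (simp add: d_def)
  have half: "complex_of_real (1/2) * (z + cnj z) = complex_of_real (Re z)" for z
    by (simp add: complex_eq_iff)
  have "block_kernel (\<lambda>s. complex_of_real (\<phi>\<^sub>1 s)) \<phi> (\<lambda>s. complex_of_real (\<phi>\<^sub>2 s)) p q
      = complex_of_real (1/2) * (?K p q + cnj (?K p q)) + (if p = q then complex_of_real (d p) else 0)" for p q
  proof -
    obtain i u j t where pq: "p = (i, u)" "q = (j, t)" by (cases p, cases q)
    have "complex_of_real (Re (\<phi> s)) = \<phi> s" for s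
      using real[of s] by (simp add: complex_eq_iff)
    moreover have "Re (cnj (\<phi> s)) = Re (\<phi> s)" for s by simp
    ultimately show ?thesis
      unfolding half pq
      by (cases i; cases j) (auto simp: block_kernel_def block_symbol_def \<phi>\<^sub>1_def \<phi>\<^sub>2_def d_def real)
  qed
  then have eq: "block_kernel (\<lambda>s. complex_of_real (\<phi>\<^sub>1 s)) \<phi> (\<lambda>s. complex_of_real (\<phi>\<^sub>2 s)) =
    (\<lambda>p q. complex_of_real (1/2) * (?K p q + cnj (?K p q)) + (if p = q then complex_of_real (d p) else 0))"
    by (intro ext)
  have "psd_kernel (block_kernel (\<lambda>s. complex_of_real (\<phi>\<^sub>1 s)) \<phi> (\<lambda>s. complex_of_real (\<phi>\<^sub>2 s)))"
    unfolding eq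
    by (intro psd_kernel_add psd_kernel_scale psd_kernel_cnj psd_kernel_diagonal psd d) simp
  then show ?thesis by (rule that) (simp_all add: \<phi>\<^sub>1_def \<phi>\<^sub>2_def)
qed

section \<open>The equivalence\<close>

text \<open>Both sides of the trace identity for \<open>x = y = \<lambda>\<^sub>s\<close> are evaluated with \<open>\<tau>(\<lambda>\<^sub>s \<lambda>\<^sub>s\<^sup>*) = 1\<close>.\<close>

lemma real_symbol_of_selfadjoint:
  assumes \<sigma>: "two_cocycle \<sigma>" and T: "selfadjoint_map (VN \<sigma>) VN_trace T"
    and \<phi>: "T (twisted_translation \<sigma> s) = scaleC_op (\<phi> s) (twisted_translation \<sigma> s)"
  shows "cnj (\<phi> s) = \<phi> s"
proof -
  let ?W = "twisted_translation \<sigma> s"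
  note b = twisted_translation_bounded_op[OF \<sigma>, of s]
  have "?W o\<^sub>L adj_op ?W = scaleC_op 1 id_blinfun"
    using twisted_translation_compose_adj[OF \<sigma>, of s s]
    by (simp add: twisted_translation_zero[OF \<sigma>] two_cocycleD(4)[OF \<sigma>])
  then have one: "VN_trace (?W o\<^sub>L adj_op ?W) = 1" by (simp add: VN_trace_eq)
  have left: "scaleC_op c x o\<^sub>L y = scaleC_op c (x o\<^sub>L y)" for c and x y :: "'a ell2 \<Rightarrow>\<^sub>L 'a ell2"
    by (rule blinfun_eqI) simp
  have right: "?W o\<^sub>L scaleC_op c y = scaleC_op c (?W o\<^sub>L y)" for c and y :: "'a ell2 \<Rightarrow>\<^sub>L 'a ell2"
    by (rule blinfun_eqI) (simp add: bounded_opsD[OF b])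
  have "VN_trace (T ?W o\<^sub>L adj_op ?W) = VN_trace (?W o\<^sub>L adj_op (T ?W))"
    using T VN_closed(1)[OF \<sigma>] unfolding selfadjoint_map_def by blast
  then show ?thesis
    using one by (simp add: \<phi> left right adj_op_ell2_linear(2)[OF b] VN_trace_eq)
qed

lemma contractively_decomposable_kernel:
  fixes \<sigma> :: "'g::group_add \<Rightarrow> 'g \<Rightarrow> complex"
  assumes \<sigma>: "two_cocycle \<sigma>" and F: "fourier_multiplier \<sigma> \<phi> M"
    and dec: "contractively_decomposable (VN \<sigma>) M"
  obtains \<psi>\<^sub>1 \<psi>\<^sub>2 where "psd_kernel (block_kernel \<psi>\<^sub>1 \<phi> \<psi>\<^sub>2)" "\<forall>s. cmod (\<psi>\<^sub>1 s) \<le> 1" "\<forall>s. cmod (\<psi>\<^sub>2 s) \<le> 1"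
proof (rule psd_block_kernel_limit)
  fix n
  define r where "r = 1 + inverse (real (Suc n))"
  have r: "1 < r" by (simp add: r_def)
  have "dec_norm (VN \<sigma>) M \<le> 1" using dec by (simp add: contractively_decomposable_def)
  also have "(1::ennreal) < ennreal r" using ennreal_lessI[of r 1] r by simp
  finally obtain v\<^sub>1 v\<^sub>2 where v: "(v\<^sub>1, v\<^sub>2) \<in> decomposing_pairs (VN \<sigma>) M"
    and "max (map_norm (VN \<sigma>) v\<^sub>1) (map_norm (VN \<sigma>) v\<^sub>2) < ennreal r"
    unfolding dec_norm_def INF_less_iff by auto
  then have norms: "map_norm (VN \<sigma>) v\<^sub>1 \<le> ennreal r" "map_norm (VN \<sigma>) v\<^sub>2 \<le> ennreal r" by auto
  have lin: "linear_map (VN \<sigma>) v\<^sub>1" "linear_map (VN \<sigma>) v\<^sub>2"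
    and cp: "completely_positive (mat2_algebra (VN \<sigma>)) (block_map v\<^sub>1 M (circ_map M) v\<^sub>2)"
    using v by (auto simp: decomposing_pairs_def)
  have M: "linear_map (VN \<sigma>) M" "\<And>s. M (twisted_translation \<sigma> s) = scaleC_op (\<phi> s) (twisted_translation \<sigma> s)"
    using F by (auto simp: fourier_multiplier_def)
  have bound: "cmod (matrix_entry (v (twisted_translation \<sigma> s)) s 0) \<le> r" if "map_norm (VN \<sigma>) v \<le> ennreal r" for v s
    using norm_le_of_map_norm[OF that VN_closed(1)[OF \<sigma>] norm_twisted_translation_le[OF \<sigma>]] r
    by (intro order_trans[OF cmod_matrix_entry_le]) simp
  show "\<exists>\<psi>\<^sub>1 \<psi>\<^sub>2. psd_kernel (block_kernel \<psi>\<^sub>1 \<phi> \<psi>\<^sub>2) \<and>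
    (\<forall>s. cmod (\<psi>\<^sub>1 s) \<le> 1 + inverse (Suc n)) \<and> (\<forall>s. cmod (\<psi>\<^sub>2 s) \<le> 1 + inverse (Suc n))"
    using psd_kernel_of_completely_positive[OF \<sigma> M lin cp] bound[OF norms(1)] bound[OF norms(2)]
    unfolding r_def by blast
qed

lemma completely_contractive_of_unital_block:
  fixes \<sigma> :: "'g::group_add \<Rightarrow> 'g \<Rightarrow> complex"
  assumes \<sigma>: "two_cocycle \<sigma>" and "completely_positive (mat2_algebra (VN \<sigma>)) \<Phi>" "unital_map \<Phi>"
  shows "completely_contractive (mat2_algebra (VN \<sigma>)) \<Phi>"
proof (rule completely_contractive_of_unital[OF assms(2)])
  note V = VN_closed[OF \<sigma>]
  show "\<Phi> id_blinfun = id_blinfun" using assms(3) by (simp add: unital_map_def)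
  show "mat2_algebra (VN \<sigma>) \<subseteq> bounded_ops"
    by (auto elim!: mat2_algebraE intro!: mat2_bounded_ops V(7))
  show "id_blinfun \<in> mat2_algebra (VN \<sigma>)"
    using V(2,3) mat2_algebra_iff[of id_blinfun 0 0 id_blinfun "VN \<sigma>"] by (simp add: mat2_id)
  show "scaleC_op c x \<in> mat2_algebra (VN \<sigma>)" if "x \<in> mat2_algebra (VN \<sigma>)" for c x
    using that by (elim mat2_algebraE) (simp add: mat2_scaleC V(5))
  show "\<exists>y\<in>mat2_algebra (VN \<sigma>). \<forall>\<xi> \<eta>. cinner (blinfun_apply y \<xi>) \<eta> = cinner \<xi> (x \<eta>)"
    if xV: "x \<in> mat2_algebra (VN \<sigma>)" for x
  proof -
    obtain a b c d where x: "x = mat2 a b c d" and abcd: "a \<in> VN \<sigma>" "b \<in> VN \<sigma>" "c \<in> VN \<sigma>" "d \<in> VN \<sigma>"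
      using xV by (rule mat2_algebraE)
    show ?thesis
      unfolding x
    proof (intro bexI[of _ "mat2 (adj_op a) (adj_op c) (adj_op b) (adj_op d)"] allI)
      show "cinner (mat2 (adj_op a) (adj_op c) (adj_op b) (adj_op d) \<xi>) \<eta> = cinner \<xi> (mat2 a b c d \<eta>)" for \<xi> \<eta>
        by (intro cinner_adj_mat2 V(7) abcd)
      show "mat2 (adj_op a) (adj_op c) (adj_op b) (adj_op d) \<in> mat2_algebra (VN \<sigma>)"
        by (simp add: V(6) abcd)
    qed
  qed
qed

text \<open>Matrices with a single nonzero entry have the norm of that entry and are mapped by the block map to
matrices of the same shape.\<close>

lemma property_P_imp_selfadjoint_decomposable:
  fixes \<sigma> :: "'g::group_add \<Rightarrow> 'g \<Rightarrow> complex"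
  assumes \<sigma>: "two_cocycle \<sigma>" and P: "property_P (VN \<sigma>) VN_trace T"
  shows "selfadjoint_map (VN \<sigma>) VN_trace T" and "contractively_decomposable (VN \<sigma>) T"
proof -
  note V = VN_closed[OF \<sigma>]
  obtain v\<^sub>1 v\<^sub>2 where lin: "linear_map (VN \<sigma>) T" "linear_map (VN \<sigma>) v\<^sub>1" "linear_map (VN \<sigma>) v\<^sub>2"
    and wstar: "weak_star_continuous (VN \<sigma>) T"
    and cp: "completely_positive (mat2_algebra (VN \<sigma>)) (block_map v\<^sub>1 T (circ_map T) v\<^sub>2)"
    and sa: "selfadjoint_map (mat2_algebra (VN \<sigma>)) (mat2_trace VN_trace) (block_map v\<^sub>1 T (circ_map T) v\<^sub>2)"
    using P unfolding property_P_def Let_def by blast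
  define \<Phi> where "\<Phi> = block_map v\<^sub>1 T (circ_map T) v\<^sub>2"
  have zero: "T 0 = 0" "v\<^sub>1 0 = 0" "v\<^sub>2 0 = 0" "circ_map T 0 = 0"
    using lin linear_map_circ_map[OF \<sigma> lin(1)] by (intro linear_map_zero[OF _ V(2)]; simp)+
  have \<Phi>_single: "\<Phi> (mat2 x 0 0 0) = mat2 (v\<^sub>1 x) 0 0 0" "\<Phi> (mat2 0 x 0 0) = mat2 0 (T x) 0 0"
    "\<Phi> (mat2 0 0 0 x) = mat2 0 0 0 (v\<^sub>2 x)" for x
    by (simp_all add: \<Phi>_def block_map_mat2 zero)
  have norm_\<Phi>: "norm (\<Phi> y) \<le> 1" if "y \<in> mat2_algebra (VN \<sigma>)" "norm y \<le> 1" for y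
    using sa that norm_le_of_map_norm[of "mat2_algebra (VN \<sigma>)" \<Phi> 1 y]
    by (simp add: selfadjoint_map_def \<Phi>_def)
  have norms: "norm (v\<^sub>1 x) \<le> 1" "norm (T x) \<le> 1" "norm (v\<^sub>2 x) \<le> 1" if "x \<in> VN \<sigma>" "norm x \<le> 1" for x
    using norm_\<Phi>[of "mat2 x 0 0 0"] norm_\<Phi>[of "mat2 0 x 0 0"] norm_\<Phi>[of "mat2 0 0 0 x"] that
    by (simp_all add: \<Phi>_single norm_mat2_single V(2))
  have map_norm: "map_norm (VN \<sigma>) v\<^sub>1 \<le> 1" "map_norm (VN \<sigma>) T \<le> 1" "map_norm (VN \<sigma>) v\<^sub>2 \<le> 1"
    unfolding map_norm_def using norms by (auto intro!: SUP_least simp: ennreal_le_1)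
  show "selfadjoint_map (VN \<sigma>) VN_trace T"
    unfolding selfadjoint_map_def
  proof (intro conjI ballI lin wstar map_norm)
    fix x y assume x: "x \<in> VN \<sigma>" and y: "y \<in> VN \<sigma>"
    have "mat2_trace VN_trace (\<Phi> (mat2 0 x 0 0) o\<^sub>L adj_op (mat2 0 y 0 0))
        = mat2_trace VN_trace (mat2 0 x 0 0 o\<^sub>L adj_op (\<Phi> (mat2 0 y 0 0)))"
      using sa x y V(2) unfolding selfadjoint_map_def \<Phi>_def by simp
    moreover have "VN_trace (0 o\<^sub>L z) = 0" for z :: "'g ell2 \<Rightarrow>\<^sub>L 'g ell2"
      by (simp add: VN_trace_def)
    ultimately show "VN_trace (T x o\<^sub>L adj_op y) = VN_trace (x o\<^sub>L adj_op (T y))"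
      using V(7)[OF y] V(7)[OF linear_mapD(1)[OF lin(1) y]]
      by (simp add: \<Phi>_single mat2_trace_compose_adj bounded_ops_intros(1))
  qed
  have pair: "(v\<^sub>1, v\<^sub>2) \<in> decomposing_pairs (VN \<sigma>) T"
    using lin cp by (simp add: decomposing_pairs_def)
  have "dec_norm (VN \<sigma>) T \<le> (case (v\<^sub>1, v\<^sub>2) of (v\<^sub>1, v\<^sub>2) \<Rightarrow> max (map_norm (VN \<sigma>) v\<^sub>1) (map_norm (VN \<sigma>) v\<^sub>2))"
    unfolding dec_norm_def by (rule INF_lower[OF pair])
  also have "\<dots> \<le> 1" using map_norm by simp
  finally show "contractively_decomposable (VN \<sigma>) T"
    using pair lin by (auto simp: contractively_decomposable_def decomposable_def)
qed

theorem proposition8p2: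
  fixes \<sigma> :: "'g::group_add \<Rightarrow> 'g \<Rightarrow> complex" and \<phi> :: "'g \<Rightarrow> complex"
  assumes "two_cocycle \<sigma>"
  shows "((\<exists>M. fourier_multiplier \<sigma> \<phi> M \<and>
          selfadjoint_map (VN \<sigma>) VN_trace M \<and> contractively_decomposable (VN \<sigma>) M)
      \<longleftrightarrow> (\<exists>M. fourier_multiplier \<sigma> \<phi> M \<and> property_P (VN \<sigma>) VN_trace M)) \<and>
    ((\<exists>M. fourier_multiplier \<sigma> \<phi> M \<and> property_P (VN \<sigma>) VN_trace M)
      \<longleftrightarrow> (\<exists>(\<phi>\<^sub>1 :: 'g \<Rightarrow> real) (\<phi>\<^sub>2 :: 'g \<Rightarrow> real) M M\<^sub>1 M\<^sub>2.
          fourier_multiplier \<sigma> \<phi> M \<and>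
          fourier_multiplier \<sigma> (\<lambda>s. complex_of_real (\<phi>\<^sub>1 s)) M\<^sub>1 \<and>
          fourier_multiplier \<sigma> (\<lambda>s. complex_of_real (\<phi>\<^sub>2 s)) M\<^sub>2 \<and>
          (let \<Phi> = block_map M\<^sub>1 M (circ_map M) M\<^sub>2 in
            unital_map \<Phi> \<and>
            completely_positive (mat2_algebra (VN \<sigma>)) \<Phi> \<and>
            weak_star_continuous (mat2_algebra (VN \<sigma>)) \<Phi> \<and>
            selfadjoint_map (mat2_algebra (VN \<sigma>)) (mat2_trace VN_trace) \<Phi>)))"
    (is "(?decomposable \<longleftrightarrow> ?property_P) \<and> (?property_P \<longleftrightarrow> ?unital_block)")
proof -
  note \<sigma> = assms
  have "?unital_block" if "?decomposable"
  proof -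
    obtain M where F: "fourier_multiplier \<sigma> \<phi> M" and sa: "selfadjoint_map (VN \<sigma>) VN_trace M"
      and dec: "contractively_decomposable (VN \<sigma>) M" using \<open>?decomposable\<close> by blast
    have real: "cnj (\<phi> s) = \<phi> s" for s
      using F by (intro real_symbol_of_selfadjoint[OF \<sigma> sa]) (simp add: fourier_multiplier_def)
    obtain \<psi>\<^sub>1 \<psi>\<^sub>2 where \<psi>: "psd_kernel (block_kernel \<psi>\<^sub>1 \<phi> \<psi>\<^sub>2)"
      "\<forall>s. cmod (\<psi>\<^sub>1 s) \<le> 1" "\<forall>s. cmod (\<psi>\<^sub>2 s) \<le> 1"
      by (rule contractively_decomposable_kernel[OF \<sigma> F dec])
    obtain \<phi>\<^sub>1 \<phi>\<^sub>2 :: "'g \<Rightarrow> real"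
      where psd: "psd_kernel (block_kernel (\<lambda>s. complex_of_real (\<phi>\<^sub>1 s)) \<phi> (\<lambda>s. complex_of_real (\<phi>\<^sub>2 s)))"
        and one: "\<phi>\<^sub>1 0 = 1" "\<phi>\<^sub>2 0 = 1"
      by (rule psd_block_kernel_normalize[OF \<psi>(1) \<psi>(2,3)[THEN spec, of 0] real])
    have one': "complex_of_real (\<phi>\<^sub>1 0) = 1" "complex_of_real (\<phi>\<^sub>2 0) = 1"
      by (simp_all add: one)
    have real': "cnj (complex_of_real r) = complex_of_real r" for r by simp
    obtain M\<^sub>1 M' M\<^sub>2 where "fourier_multiplier \<sigma> (\<lambda>s. complex_of_real (\<phi>\<^sub>1 s)) M\<^sub>1" "fourier_multiplier \<sigma> \<phi> M'"
      "fourier_multiplier \<sigma> (\<lambda>s. complex_of_real (\<phi>\<^sub>2 s)) M\<^sub>2"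
      "unital_map (block_map M\<^sub>1 M' (circ_map M') M\<^sub>2)"
      "completely_positive (mat2_algebra (VN \<sigma>)) (block_map M\<^sub>1 M' (circ_map M') M\<^sub>2)"
      "weak_star_continuous (mat2_algebra (VN \<sigma>)) (block_map M\<^sub>1 M' (circ_map M') M\<^sub>2)"
      "selfadjoint_map (mat2_algebra (VN \<sigma>)) (mat2_trace VN_trace) (block_map M\<^sub>1 M' (circ_map M') M\<^sub>2)"
      by (rule psd_block_multipliers[OF \<sigma> psd one' real' real real'])
    then show ?thesis unfolding Let_def by blast
  qed
  moreover have "?property_P" if "?unital_block"
  proof -
    obtain \<phi>\<^sub>1 \<phi>\<^sub>2 :: "'g \<Rightarrow> real" and M M\<^sub>1 M\<^sub>2 where F: "fourier_multiplier \<sigma> \<phi> M"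
      "fourier_multiplier \<sigma> (\<lambda>s. complex_of_real (\<phi>\<^sub>1 s)) M\<^sub>1" "fourier_multiplier \<sigma> (\<lambda>s. complex_of_real (\<phi>\<^sub>2 s)) M\<^sub>2"
      and \<Phi>: "unital_map (block_map M\<^sub>1 M (circ_map M) M\<^sub>2)"
      "completely_positive (mat2_algebra (VN \<sigma>)) (block_map M\<^sub>1 M (circ_map M) M\<^sub>2)"
      "weak_star_continuous (mat2_algebra (VN \<sigma>)) (block_map M\<^sub>1 M (circ_map M) M\<^sub>2)"
      "selfadjoint_map (mat2_algebra (VN \<sigma>)) (mat2_trace VN_trace) (block_map M\<^sub>1 M (circ_map M) M\<^sub>2)"
      using \<open>?unital_block\<close> unfolding Let_def by blast
    have "property_P (VN \<sigma>) VN_trace M"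
      unfolding property_P_def Let_def
      using F \<Phi> completely_contractive_of_unital_block[OF \<sigma> \<Phi>(2,1)]
      unfolding fourier_multiplier_def by blast
    with F(1) show ?thesis by blast
  qed
  moreover have "?decomposable" if "?property_P"
    using that property_P_imp_selfadjoint_decomposable[OF \<sigma>] by blast
  ultimately show ?thesis by argo
qed

end
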